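(* Let $W$ be one of the Weyl groups $W_{A_{n-1}}$, $W_{D_n}$ or $W_{B_n}$. The even center of the rational spin double affine Hecke algebra $\ddot{\mathfrak H}^-_W$ contains $\mathbb C[y_1,\dots,y_n]^W$ and $\mathbb C[\xi_1^2,\dots,\xi_n^2]^W$. In particular, $\ddot{\mathfrak H}^-_W$ is module-finite over its even center.
   Context: Ground field $\mathbb C$. The even center of a superalgebra consists of its even central elements. $W_{A_{n-1}}=S_n$ acts on the $y_i$ by permuting indices; $W_{B_n}$ ($n\ge2$) acts on $y_1,\dots,y_n$ by all signed permutations; $W_{D_n}$ ($n\ge4$) is the subgroup of signed permutations with an even number of sign changes. On the (commutative) algebra $\mathbb C[\xi_1^2,\dots,\xi_n^2]$, $W$ acts by permuting the $\xi_i^2$ through the underlying permutations (signs act trivially). Superscript $W$ denotes invariants. Spin Weyl group algebra $\mathbb CW^-$. Type $A_{n-1}$: generated by $t_1,\dots,t_{n-1}$ with $t_i^2=1$, $t_it_{i+1}t_i=t_{i+1}t_it_{i+1}$, $(t_it_j)^2=-1$ if $|i-j|>1$. Type $B_n$: add $t_n$ with $t_n^2=1$, $(t_it_n)^2=-1$ for $i\ne n-1,n$, $(t_{n-1}t_n)^4=-1$. Type $D_n$: add $t_n$ with $t_n^2=1$, $(t_it_n)^2=-1$ for $i\neq n-2,n$, $t_{n-2}t_nt_{n-2}=t_nt_{n-2}t_n$. Put $t_{i\uparrow j}=t_it_{i+1}\cdots t_j$ if $i\le j$ and $1$ otherwise; $t_{i\downarrow j}=t_it_{i-1}\cdots t_j$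 if $i\ge j$ and $1$ otherwise. For $1\le i<j\le n$ put $[i,j]=(-1)^{j-i-1}t_{j-1}\cdots t_{i+1}t_it_{i+1}\cdots t_{j-1}$, $[j,i]=-[i,j]$; $\overline{[i,j]}=\overline{[j,i]}=(-1)^{j-i-1}t_{j\uparrow n-1}t_{i\uparrow n-2}\,t_n\,t_{n-2\downarrow i}t_{n-1\downarrow j}$ in type $D_n$, and $=(-1)^{j-i}t_{j\uparrow n-1}t_{i\uparrow n-2}\,t_nt_{n-1}t_n\,t_{n-2\downarrow i}t_{n-1\downarrow j}$ in type $B_n$; $\overline{[i]}=(-1)^{n-i}t_i\cdots t_{n-1}t_nt_{n-1}\cdots t_i$ ($1\le i\le n$) in type $B_n$. The algebra $\ddot{\mathfrak H}^-_W$. Let $u\in\mathbb C$ (and $v\in\mathbb C$ in type $B_n$). $\ddot{\mathfrak H}^-_W$ is generated by $\xi_i,y_i$ ($1\le i\le n$) and $\mathbb CW^-$, subject to: $y_iy_j=y_jy_i$; $\xi_i\xi_j=-\xi_j\xi_i$ ($i\ne j$); for $1\le i\le n-1$: $t_iy_i=y_{i+1}t_i$, $t_i\xi_i=-\xi_{i+1}t_i$, and $t_iy_j=y_jt_i$, $t_i\xi_j=-\xi_jt_i$ for $j\ne i,i+1$; and type $A_{n-1}$: $[y_j,\xi_i]=-u[i,j]$ ($i\ne j$), $[y_i,\xi_i]=u\sum_{k\ne i}[i,k]$; type $D_n$: $t_ny_n=-y_{n-1}t_n$, $t_n\xi_n=-\xi_{n-1}t_n$, $t_ny_j=y_jt_n$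 and $t_n\xi_j=-\xi_jt_n$ ($j\ne n-1,n$), $[y_j,\xi_i]=-u[i,j]+u\overline{[i,j]}$ ($i\ne j$), $[y_i,\xi_i]=u\sum_{k\ne i}([i,k]+\overline{[i,k]})$; type $B_n$: $t_ny_n=-y_nt_n$, $t_n\xi_n=-\xi_nt_n$, $t_ny_j=y_jt_n$ and $t_n\xi_j=-\xi_jt_n$ ($j\ne n$), $[y_j,\xi_i]=-u[i,j]+u\overline{[i,j]}$ ($i\ne j$), $[y_i,\xi_i]=u\sum_{k\ne i}([i,k]+\overline{[i,k]})+v\overline{[i]}$. (The left-hand sides $[y_j,\xi_i]=y_j\xi_i-\xi_iy_j$ are commutators; $[i,j]$ with integer entries is the element of $\mathbb CW^-$ above.) It is a superalgebra with $y_i$ even and $\xi_i,t_i$ odd. *)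

theory Defs
  imports
    Complex_Main
    "HOL-Library.Poly_Mapping"
    "HOL-Combinatorics.Permutations"
    "HOL-Algebra.QuotRing"
begin

section \<open>Free associative algebras\<close>

datatype 'a fword = FWord (letters: "'a list")

instantiation fword :: (type) monoid_add
begin

definition zero_fword :: "'a fword" where "zero_fword = FWord []"
definition plus_fword :: "'a fword \<Rightarrow> 'a fword \<Rightarrow> 'a fword"
  where "plus_fword v w = FWord (letters v @ letters w)"

instance by standard (simp_all add: zero_fword_def plus_fword_def)

end

text \<open>
  Finitely supported functions on words multiply by convolution along the addition
  of words, that is, along concatenation; so this type is the free algebra on all letters.
\<close>

datatype gen = Xi nat | Y nat | T nat

type_synonym free = "gen fword \<Rightarrow>\<^sub>0 complex"

definition gen :: "gen \<Rightarrow> free"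
  where "gen g = Poly_Mapping.single (FWord [g]) 1"

definition scal :: "complex \<Rightarrow> free"
  where "scal c = Poly_Mapping.single 0 c"

abbreviation xg :: "nat \<Rightarrow> free" where "xg i \<equiv> gen (Xi i)"
abbreviation yg :: "nat \<Rightarrow> free" where "yg i \<equiv> gen (Y i)"
abbreviation tg :: "nat \<Rightarrow> free" where "tg i \<equiv> gen (T i)"

definition comm :: "free \<Rightarrow> free \<Rightarrow> free"
  where "comm a b = a * b - b * a"

section \<open>Weyl groups of classical type\<close>

text \<open>
  Each type comes with the number \<open>n\<close> of variables, so \<open>TypeA\<close> with \<open>n\<close>
  stands for \<open>A\<close> of rank \<open>n - 1\<close>.
\<close>

datatype weyl_type = TypeA | TypeB | TypeD

fun admissible :: "weyl_type \<Rightarrow> nat \<Rightarrow> bool" where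
  "admissible TypeA n \<longleftrightarrow> n \<ge> 1"
| "admissible TypeB n \<longleftrightarrow> n \<ge> 2"
| "admissible TypeD n \<longleftrightarrow> n \<ge> 4"

text \<open>
  A pair \<open>(\<sigma>, S)\<close> is the signed permutation sending the \<open>i\<close>-th variable to the
  \<open>\<sigma> i\<close>-th one, with a minus sign exactly if \<open>i \<in> S\<close>.
\<close>

fun weyl :: "weyl_type \<Rightarrow> nat \<Rightarrow> ((nat \<Rightarrow> nat) \<times> nat set) set" where
  "weyl TypeA n = {(\<sigma>, S). \<sigma> permutes {1..n} \<and> S = {}}"
| "weyl TypeB n = {(\<sigma>, S). \<sigma> permutes {1..n} \<and> S \<subseteq> {1..n}}"
| "weyl TypeD n = {(\<sigma>, S). \<sigma> permutes {1..n} \<and> S \<subseteq> {1..n} \<and> even (card S)}"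

section \<open>The rational spin double affine Hecke algebra\<close>

fun t_index :: "weyl_type \<Rightarrow> nat \<Rightarrow> nat set" where
  "t_index TypeA n = {1..<n}"
| "t_index TypeB n = {1..n}"
| "t_index TypeD n = {1..n}"

definition gens :: "weyl_type \<Rightarrow> nat \<Rightarrow> gen set"
  where "gens W n = Xi ` {1..n} \<union> Y ` {1..n} \<union> T ` t_index W n"

definition t_up :: "nat \<Rightarrow> nat \<Rightarrow> free"
  where "t_up i j = prod_list (map tg [i..<Suc j])"

definition t_down :: "nat \<Rightarrow> nat \<Rightarrow> free"
  where "t_down i j = prod_list (map tg (rev [j..<Suc i]))"

definition br_less :: "nat \<Rightarrow> nat \<Rightarrow> free"
  where "br_less i j = (-1) ^ (j - i - 1) * t_down (j - 1) (i + 1) * tg i * t_up (i + 1) (j - 1)"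

definition br :: "nat \<Rightarrow> nat \<Rightarrow> free"
  where "br i j = (if i < j then br_less i j else - br_less j i)"

definition obarD_less :: "nat \<Rightarrow> nat \<Rightarrow> nat \<Rightarrow> free"
  where "obarD_less n i j = (-1) ^ (j - i - 1) *
    t_up j (n - 1) * t_up i (n - 2) * tg n * t_down (n - 2) i * t_down (n - 1) j"

definition obarD :: "nat \<Rightarrow> nat \<Rightarrow> nat \<Rightarrow> free"
  where "obarD n i j = (if i < j then obarD_less n i j else obarD_less n j i)"

definition obarB_less :: "nat \<Rightarrow> nat \<Rightarrow> nat \<Rightarrow> free"
  where "obarB_less n i j = (-1) ^ (j - i) *
    t_up j (n - 1) * t_up i (n - 2) * (tg n * tg (n - 1) * tg n) *
    t_down (n - 2) i * t_down (n - 1) j"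

definition obarB :: "nat \<Rightarrow> nat \<Rightarrow> nat \<Rightarrow> free"
  where "obarB n i j = (if i < j then obarB_less n i j else obarB_less n j i)"

definition obarB1 :: "nat \<Rightarrow> nat \<Rightarrow> free"
  where "obarB1 n i = (-1) ^ (n - i) * t_up i (n - 1) * tg n * t_down (n - 1) i"

text \<open>Defining relations (left-hand side, right-hand side) of the spin Weyl group algebra.\<close>

inductive spin_weyl_rel :: "weyl_type \<Rightarrow> nat \<Rightarrow> free \<Rightarrow> free \<Rightarrow> bool"
  for W :: weyl_type and n :: nat where
  t_sq: "i \<in> t_index W n \<Longrightarrow> spin_weyl_rel W n (tg i * tg i) 1"
| braid: "1 \<le> i \<Longrightarrow> i + 1 < n \<Longrightarrow>
    spin_weyl_rel W n (tg i * tg (i+1) * tg i) (tg (i+1) * tg i * tg (i+1))"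
| far: "i \<in> {1..<n} \<Longrightarrow> j \<in> {1..<n} \<Longrightarrow> i + 1 < j \<or> j + 1 < i \<Longrightarrow>
    spin_weyl_rel W n ((tg i * tg j) ^ 2) (- 1)"
| far_B: "W = TypeB \<Longrightarrow> i \<in> {1..n} - {n - 1, n} \<Longrightarrow>
    spin_weyl_rel W n ((tg i * tg n) ^ 2) (- 1)"
| quad_B: "W = TypeB \<Longrightarrow> spin_weyl_rel W n ((tg (n - 1) * tg n) ^ 4) (- 1)"
| far_D: "W = TypeD \<Longrightarrow> i \<in> {1..n} - {n - 2, n} \<Longrightarrow>
    spin_weyl_rel W n ((tg i * tg n) ^ 2) (- 1)"
| braid_D: "W = TypeD \<Longrightarrow>
    spin_weyl_rel W n (tg (n - 2) * tg n * tg (n - 2)) (tg n * tg (n - 2) * tg n)"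

text \<open>All defining relations; the parameter \<open>v\<close> occurs in type \<open>B\<close> only.\<close>

inductive rsd_rel :: "weyl_type \<Rightarrow> nat \<Rightarrow> complex \<Rightarrow> complex \<Rightarrow> free \<Rightarrow> free \<Rightarrow> bool"
  for W :: weyl_type and n :: nat and u v :: complex where
  spin_weyl: "spin_weyl_rel W n a b \<Longrightarrow> rsd_rel W n u v a b"
| y_y: "i \<in> {1..n} \<Longrightarrow> j \<in> {1..n} \<Longrightarrow> rsd_rel W n u v (yg i * yg j) (yg j * yg i)"
| xi_xi: "i \<in> {1..n} \<Longrightarrow> j \<in> {1..n} \<Longrightarrow> i \<noteq> j \<Longrightarrow>
    rsd_rel W n u v (xg i * xg j) (- (xg j * xg i))"
| t_y: "i \<in> {1..<n} \<Longrightarrow> rsd_rel W n u v (tg i * yg i) (yg (i+1) * tg i)"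
| t_xi: "i \<in> {1..<n} \<Longrightarrow> rsd_rel W n u v (tg i * xg i) (- (xg (i+1) * tg i))"
| t_y_far: "i \<in> {1..<n} \<Longrightarrow> j \<in> {1..n} - {i, i+1} \<Longrightarrow>
    rsd_rel W n u v (tg i * yg j) (yg j * tg i)"
| t_xi_far: "i \<in> {1..<n} \<Longrightarrow> j \<in> {1..n} - {i, i+1} \<Longrightarrow>
    rsd_rel W n u v (tg i * xg j) (- (xg j * tg i))"
| y_xi_A: "W = TypeA \<Longrightarrow> i \<in> {1..n} \<Longrightarrow> j \<in> {1..n} \<Longrightarrow> i \<noteq> j \<Longrightarrow>
    rsd_rel W n u v (comm (yg j) (xg i)) (- (scal u * br i j))"
| y_xi_same_A: "W = TypeA \<Longrightarrow> i \<in> {1..n} \<Longrightarrow>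
    rsd_rel W n u v (comm (yg i) (xg i)) (scal u * (\<Sum>k\<in>{1..n} - {i}. br i k))"
| tn_y_D: "W = TypeD \<Longrightarrow> rsd_rel W n u v (tg n * yg n) (- (yg (n - 1) * tg n))"
| tn_xi_D: "W = TypeD \<Longrightarrow> rsd_rel W n u v (tg n * xg n) (- (xg (n - 1) * tg n))"
| tn_y_far_D: "W = TypeD \<Longrightarrow> j \<in> {1..n} - {n - 1, n} \<Longrightarrow>
    rsd_rel W n u v (tg n * yg j) (yg j * tg n)"
| tn_xi_far_D: "W = TypeD \<Longrightarrow> j \<in> {1..n} - {n - 1, n} \<Longrightarrow>
    rsd_rel W n u v (tg n * xg j) (- (xg j * tg n))"
| y_xi_D: "W = TypeD \<Longrightarrow> i \<in> {1..n} \<Longrightarrow> j \<in> {1..n} \<Longrightarrow> i \<noteq> j \<Longrightarrow>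
    rsd_rel W n u v (comm (yg j) (xg i)) (- (scal u * br i j) + scal u * obarD n i j)"
| y_xi_same_D: "W = TypeD \<Longrightarrow> i \<in> {1..n} \<Longrightarrow>
    rsd_rel W n u v (comm (yg i) (xg i))
      (scal u * (\<Sum>k\<in>{1..n} - {i}. br i k + obarD n i k))"
| tn_y_B: "W = TypeB \<Longrightarrow> rsd_rel W n u v (tg n * yg n) (- (yg n * tg n))"
| tn_xi_B: "W = TypeB \<Longrightarrow> rsd_rel W n u v (tg n * xg n) (- (xg n * tg n))"
| tn_y_far_B: "W = TypeB \<Longrightarrow> j \<in> {1..n} - {n} \<Longrightarrow>
    rsd_rel W n u v (tg n * yg j) (yg j * tg n)"
| tn_xi_far_B: "W = TypeB \<Longrightarrow> j \<in> {1..n} - {n} \<Longrightarrow>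
    rsd_rel W n u v (tg n * xg j) (- (xg j * tg n))"
| y_xi_B: "W = TypeB \<Longrightarrow> i \<in> {1..n} \<Longrightarrow> j \<in> {1..n} \<Longrightarrow> i \<noteq> j \<Longrightarrow>
    rsd_rel W n u v (comm (yg j) (xg i)) (- (scal u * br i j) + scal u * obarB n i j)"
| y_xi_same_B: "W = TypeB \<Longrightarrow> i \<in> {1..n} \<Longrightarrow>
    rsd_rel W n u v (comm (yg i) (xg i))
      (scal u * (\<Sum>k\<in>{1..n} - {i}. br i k + obarB n i k) + scal v * obarB1 n i)"

definition free_alg :: "weyl_type \<Rightarrow> nat \<Rightarrow> free ring"
  where "free_alg W n =
    \<lparr>carrier = {f. \<forall>w\<in>Poly_Mapping.keys f. set (letters w) \<subseteq> gens W n},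
     monoid.mult = (*), one = 1, zero = 0, add = (+)\<rparr>"

text \<open>
  The ideal is two-sided. It is automatically stable under scalars, because the
  scalars \<open>scal c\<close> belong to the free algebra.
\<close>

definition rsd_ideal :: "weyl_type \<Rightarrow> nat \<Rightarrow> complex \<Rightarrow> complex \<Rightarrow> free set"
  where "rsd_ideal W n u v = genideal (free_alg W n) {a - b | a b. rsd_rel W n u v a b}"

definition rsdaha :: "weyl_type \<Rightarrow> nat \<Rightarrow> complex \<Rightarrow> complex \<Rightarrow> free set ring"
  where "rsdaha W n u v = FactRing (free_alg W n) (rsd_ideal W n u v)"

definition cls :: "weyl_type \<Rightarrow> nat \<Rightarrow> complex \<Rightarrow> complex \<Rightarrow> free \<Rightarrow> free set"
  where "cls W n u v f = a_r_coset (free_alg W n) (rsd_ideal W n u v) f"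

section \<open>Superalgebra structure and even center\<close>

fun odd_gen :: "gen \<Rightarrow> bool" where
  "odd_gen (Xi i) = True"
| "odd_gen (Y i) = False"
| "odd_gen (T i) = True"

definition even_part :: "weyl_type \<Rightarrow> nat \<Rightarrow> complex \<Rightarrow> complex \<Rightarrow> free set set"
  where "even_part W n u v = cls W n u v ` {f \<in> carrier (free_alg W n).
    \<forall>w\<in>Poly_Mapping.keys f. even (length (filter odd_gen (letters w)))}"

definition even_center :: "weyl_type \<Rightarrow> nat \<Rightarrow> complex \<Rightarrow> complex \<Rightarrow> free set set"
  where "even_center W n u v = {z \<in> even_part W n u v. \<forall>x\<in>carrier (rsdaha W n u v).
    z \<otimes>\<^bsub>rsdaha W n u v\<^esub> x = x \<otimes>\<^bsub>rsdaha W n u v\<^esub> z}"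

definition module_finite_over :: "('a, 'b) ring_scheme \<Rightarrow> 'a set \<Rightarrow> bool"
  where "module_finite_over R Z \<longleftrightarrow> (\<exists>B. finite B \<and> B \<subseteq> carrier R \<and>
    (\<forall>x\<in>carrier R. \<exists>c. c \<in> B \<rightarrow> Z \<and> x = (\<Oplus>\<^bsub>R\<^esub>b\<in>B. c b \<otimes>\<^bsub>R\<^esub> b)))"

section \<open>Invariant polynomials\<close>

text \<open>Polynomials in commuting variables indexed by \<open>nat\<close>, as maps from exponents to coefficients.\<close>

type_synonym cpoly = "(nat \<Rightarrow>\<^sub>0 nat) \<Rightarrow>\<^sub>0 complex"

definition var :: "nat \<Rightarrow> cpoly"
  where "var i = Poly_Mapping.single (Poly_Mapping.single i 1) 1"

definition subst :: "(nat \<Rightarrow> cpoly) \<Rightarrow> cpoly \<Rightarrow> cpoly"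
  where "subst f p = (\<Sum>m\<in>Poly_Mapping.keys p. Poly_Mapping.single 0 (Poly_Mapping.lookup p m) *
    (\<Prod>i\<in>Poly_Mapping.keys m. f i ^ Poly_Mapping.lookup m i))"

fun act_y :: "(nat \<Rightarrow> nat) \<times> nat set \<Rightarrow> nat \<Rightarrow> cpoly"
  where "act_y (\<sigma>, S) i = (if i \<in> S then - var (\<sigma> i) else var (\<sigma> i))"

fun act_xi_sq :: "(nat \<Rightarrow> nat) \<times> nat set \<Rightarrow> nat \<Rightarrow> cpoly"
  where "act_xi_sq (\<sigma>, S) i = var (\<sigma> i)"

definition invariants ::
  "weyl_type \<Rightarrow> nat \<Rightarrow> ((nat \<Rightarrow> nat) \<times> nat set \<Rightarrow> nat \<Rightarrow> cpoly) \<Rightarrow> cpoly set"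
  where "invariants W n act = {p. (\<forall>m\<in>Poly_Mapping.keys p. Poly_Mapping.keys m \<subseteq> {1..n}) \<and>
    (\<forall>w\<in>weyl W n. subst (act w) p = p)}"

text \<open>
  Value of a polynomial at \<open>x 1, \<dots>, x n\<close>. The factors of a monomial are taken in
  increasing order of their indices; for \<open>y\<^sub>i\<close> and for \<open>\<xi>\<^sub>i\<^sup>2\<close> the order does not
  matter modulo the relations.
\<close>

definition eval_at :: "nat \<Rightarrow> (nat \<Rightarrow> free) \<Rightarrow> cpoly \<Rightarrow> free"
  where "eval_at n x p = (\<Sum>m\<in>Poly_Mapping.keys p. scal (Poly_Mapping.lookup p m) *
    prod_list (map (\<lambda>i. x i ^ Poly_Mapping.lookup m i) [1..<Suc n]))"

definition y_invariants :: "weyl_type \<Rightarrow> nat \<Rightarrow> complex \<Rightarrow> complex \<Rightarrow> free set set"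
  where "y_invariants W n u v =
    (\<lambda>p. cls W n u v (eval_at n yg p)) ` invariants W n act_y"

definition xi_sq_invariants :: "weyl_type \<Rightarrow> nat \<Rightarrow> complex \<Rightarrow> complex \<Rightarrow> free set set"
  where "xi_sq_invariants W n u v =
    (\<lambda>p. cls W n u v (eval_at n (\<lambda>i. xg i ^ 2) p)) ` invariants W n act_xi_sq"

section \<open>Well-definedness\<close>

text \<open>
  The relations lie in the free algebra, so that \<open>genideal\<close> is not an empty
  intersection, and they are homogeneous for the parity grading, so that the quotient
  is a superalgebra.
\<close>

lemma free_alg_simps [simp]:
  "monoid.mult (free_alg W n) = (*)" "one (free_alg W n) = 1"
  "zero (free_alg W n) = 0" "add (free_alg W n) = (+)"
  by (simp_all add: free_alg_def)

definition homog :: "weyl_type \<Rightarrow> nat \<Rightarrow> bool \<Rightarrow> free set"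
  where "homog W n p = {f. \<forall>w\<in>Poly_Mapping.keys f. set (letters w) \<subseteq> gens W n \<and>
    odd (length (filter odd_gen (letters w))) = p}"

lemma free_alg_mult_closed:
  assumes "f \<in> carrier (free_alg W n)" "g \<in> carrier (free_alg W n)"
  shows "f * g \<in> carrier (free_alg W n)"
proof -
  have "set (letters w) \<subseteq> gens W n" if "w \<in> Poly_Mapping.keys (f * g)" for w
  proof -
    obtain p q where "p \<in> Poly_Mapping.keys f" "q \<in> Poly_Mapping.keys g" "w = p + q"
      using keys_mult[of f g] \<open>w \<in> Poly_Mapping.keys (f * g)\<close> by blast
    then show ?thesis using assms by (simp add: free_alg_def plus_fword_def)
  qed
  then show ?thesis by (simp add: free_alg_def)
qed

lemma free_alg_add_closed:
  assumes "f \<in> carrier (free_alg W n)" "g \<in> carrier (free_alg W n)"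
  shows "f + g \<in> carrier (free_alg W n)"
  using assms Poly_Mapping.keys_add[of f g] unfolding free_alg_def by auto

lemma ring_free_alg:
  "ring (free_alg W n)"
proof (rule ringI)
  show "abelian_group (free_alg W n)"
  proof (rule abelian_groupI)
    fix x assume "x \<in> carrier (free_alg W n)"
    then have "- x \<in> carrier (free_alg W n)" by (simp add: free_alg_def)
    then show "\<exists>y\<in>carrier (free_alg W n). y \<oplus>\<^bsub>free_alg W n\<^esub> x = \<zero>\<^bsub>free_alg W n\<^esub>"
      by (intro bexI[of _ "-x"]) simp_all
  qed (simp_all add: free_alg_add_closed algebra_simps, simp add: free_alg_def)
  show "Group.monoid (free_alg W n)"
    by (rule monoidI)
      (simp_all add: free_alg_mult_closed algebra_simps, simp add: free_alg_def zero_fword_def)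
qed (simp_all add: algebra_simps)

lemma homog_mult:
  assumes "f \<in> homog W n p" "g \<in> homog W n q"
  shows "f * g \<in> homog W n (p \<noteq> q)"
proof -
  have "set (letters w) \<subseteq> gens W n \<and> odd (length (filter odd_gen (letters w))) = (p \<noteq> q)"
    if "w \<in> Poly_Mapping.keys (f * g)" for w
  proof -
    obtain a b where "a \<in> Poly_Mapping.keys f" "b \<in> Poly_Mapping.keys g" "w = a + b"
      using keys_mult[of f g] \<open>w \<in> Poly_Mapping.keys (f * g)\<close> by blast
    moreover from this have "odd (length (filter odd_gen (letters a))) = p"
      "odd (length (filter odd_gen (letters b))) = q"
      using assms by (simp_all add: homog_def)
    ultimately show ?thesis using assms by (auto simp: homog_def plus_fword_def)
  qed
  then show ?thesis by (simp add: homog_def)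
qed

lemma homog_add:
  assumes "f \<in> homog W n p" "g \<in> homog W n p"
  shows "f + g \<in> homog W n p"
  using assms Poly_Mapping.keys_add[of f g] unfolding homog_def by blast

lemma homog_neg:
  "f \<in> homog W n p \<Longrightarrow> - f \<in> homog W n p"
  by (simp add: homog_def)

lemma homog_1:
  "1 \<in> homog W n False"
  by (simp add: homog_def zero_fword_def)

lemma homog_0:
  "0 \<in> homog W n p"
  by (simp add: homog_def)

lemma homog_scal:
  "scal c \<in> homog W n False"
  by (simp add: homog_def scal_def zero_fword_def)

lemma homog_gen:
  "g \<in> gens W n \<Longrightarrow> gen g \<in> homog W n (odd_gen g)"
  by (simp add: homog_def gen_def)

lemma homog_pow:
  "f \<in> homog W n p \<Longrightarrow> f ^ k \<in> homog W n (p \<and> odd k)"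
proof (induct k)
  case (Suc k)
  then show ?case using homog_mult[of f W n p "f^k" "p \<and> odd k"] by (cases p) auto
qed (simp add: homog_1)

lemma homog_sum:
  "(\<And>k. k \<in> K \<Longrightarrow> f k \<in> homog W n p) \<Longrightarrow> sum f K \<in> homog W n p"
  by (induct K rule: infinite_finite_induct) (auto intro: homog_add homog_0)

lemma homog_prod:
  "set l \<subseteq> t_index W n \<Longrightarrow> prod_list (map tg l) \<in> homog W n (odd (length l))"
proof (induct l)
  case (Cons a l)
  then have "tg a \<in> homog W n True"
    using homog_gen[of "T a" W n] by (auto simp: gens_def)
  then show ?case
    using homog_mult[of "tg a" W n True "prod_list (map tg l)" "odd (length l)"] Cons by auto
qed (simp add: homog_1)

lemma homog_sgn:
  "(-1) ^ k \<in> homog W n False"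
  using homog_pow[OF homog_neg[OF homog_1], where k = k] by simp

lemma homog_t:
  "i \<in> t_index W n \<Longrightarrow> tg i \<in> homog W n True"
  using homog_gen[of "T i" W n] by (auto simp: gens_def)

lemma homog_y:
  "i \<in> {1..n} \<Longrightarrow> yg i \<in> homog W n False"
  using homog_gen[of "Y i" W n] by (auto simp: gens_def)

lemma homog_x:
  "i \<in> {1..n} \<Longrightarrow> xg i \<in> homog W n True"
  using homog_gen[of "Xi i" W n] by (auto simp: gens_def)

lemma homog_up:
  "1 \<le> i \<Longrightarrow> j < n \<Longrightarrow> t_up i j \<in> homog W n (odd (Suc j - i))"
  unfolding t_up_def using homog_prod[of "[i..<Suc j]" W n]
  by (cases W) (auto simp: subset_eq simp del: upt_Suc)

lemma homog_down:
  "1 \<le> i \<Longrightarrow> j < n \<Longrightarrow> t_down j i \<in> homog W n (odd (Suc j - i))"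
  unfolding t_down_def using homog_prod[of "rev [i..<Suc j]" W n]
  by (cases W) (auto simp: subset_eq simp del: upt_Suc)

lemma homog_cong: "f \<in> homog W n p \<Longrightarrow> p = q \<Longrightarrow> f \<in> homog W n q"
  by simp

lemma t_indexI: "i \<in> {1..<n} \<Longrightarrow> i \<in> t_index W n"
  by (cases W) auto

lemma t_indexI_BD: "W \<noteq> TypeA \<Longrightarrow> i \<in> {1..n} \<Longrightarrow> i \<in> t_index W n"
  by (cases W) auto

lemmas homog_t_intros = homog_mult homog_sgn homog_up homog_down homog_t

lemma homog_br:
  assumes "i \<in> {1..n}" "j \<in> {1..n}" "i \<noteq> j"
  shows "br i j \<in> homog W n True"
proof -
  have "br_less i j \<in> homog W n True" if "1 \<le> i" "i < j" "j \<le> n" for i j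
  proof -
    have "i \<in> t_index W n" using that by (intro t_indexI) auto
    then have "br_less i j \<in> homog W n (((False \<noteq> odd (Suc (j - 1) - (i + 1))) \<noteq> True) \<noteq>
        odd (Suc (j - 1) - (i + 1)))"
      unfolding br_less_def using that by (intro homog_t_intros) auto
    then show ?thesis by (rule homog_cong) auto
  qed
  then show ?thesis using assms by (auto simp: br_def intro: homog_neg)
qed

lemma homog_obarD:
  assumes "W \<noteq> TypeA" "i \<in> {1..n}" "j \<in> {1..n}" "i \<noteq> j"
  shows "obarD n i j \<in> homog W n True"
proof -
  have "obarD_less n i j \<in> homog W n True" if "1 \<le> i" "i < j" "j \<le> n" for i j
  proof -
    have "n \<in> t_index W n" using that assms(1) by (intro t_indexI_BD) auto
    then have "obarD_less n i j \<in> homog W n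
        (((((False \<noteq> odd (Suc (n - 1) - j)) \<noteq> odd (Suc (n - 2) - i)) \<noteq> True) \<noteq>
          odd (Suc (n - 2) - i)) \<noteq> odd (Suc (n - 1) - j))"
      unfolding obarD_less_def using that by (intro homog_t_intros) auto
    then show ?thesis by (rule homog_cong) auto
  qed
  then show ?thesis using assms by (auto simp: obarD_def)
qed

lemma homog_obarB:
  assumes "W \<noteq> TypeA" "i \<in> {1..n}" "j \<in> {1..n}" "i \<noteq> j"
  shows "obarB n i j \<in> homog W n True"
proof -
  have "obarB_less n i j \<in> homog W n True" if "1 \<le> i" "i < j" "j \<le> n" for i j
  proof -
    have "n \<in> t_index W n" "n - 1 \<in> t_index W n"
      using that assms(1) by (auto intro!: t_indexI_BD)
    then have "obarB_less n i j \<in> homog W n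
        (((((False \<noteq> odd (Suc (n - 1) - j)) \<noteq> odd (Suc (n - 2) - i)) \<noteq>
          ((True \<noteq> True) \<noteq> True)) \<noteq> odd (Suc (n - 2) - i)) \<noteq> odd (Suc (n - 1) - j))"
      unfolding obarB_less_def using that by (intro homog_t_intros) auto
    then show ?thesis by (rule homog_cong) auto
  qed
  then show ?thesis using assms by (auto simp: obarB_def)
qed

lemma homog_obarB1:
  assumes "W \<noteq> TypeA" "i \<in> {1..n}"
  shows "obarB1 n i \<in> homog W n True"
proof -
  have "n \<in> t_index W n" using assms by (intro t_indexI_BD) auto
  then have "obarB1 n i \<in> homog W n
      (((False \<noteq> odd (Suc (n - 1) - i)) \<noteq> True) \<noteq> odd (Suc (n - 1) - i))"
    unfolding obarB1_def using assms by (intro homog_t_intros) auto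
  then show ?thesis by (rule homog_cong) auto
qed

lemma homog_mult_eq:
  "f \<in> homog W n p \<Longrightarrow> g \<in> homog W n q \<Longrightarrow> r = (p \<noteq> q) \<Longrightarrow> f * g \<in> homog W n r"
  using homog_mult by blast

lemma homog_even_pow: "f \<in> homog W n p \<Longrightarrow> even k \<Longrightarrow> f ^ k \<in> homog W n False"
  using homog_pow[of f W n p k] by simp

lemma homog_comm: "f \<in> homog W n False \<Longrightarrow> g \<in> homog W n p \<Longrightarrow> comm f g \<in> homog W n p"
  unfolding comm_def diff_conv_add_uminus
  by (intro homog_add homog_neg; erule (1) homog_mult_eq, simp)

lemma homog_scal_mult: "f \<in> homog W n p \<Longrightarrow> scal c * f \<in> homog W n p"
  by (rule homog_mult_eq[OF homog_scal]) auto

lemma spin_weyl_rel_homog: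
  assumes "spin_weyl_rel W n a b" and adm: "admissible W n"
  shows "\<exists>p. a \<in> homog W n p \<and> b \<in> homog W n p"
  using assms(1)
proof cases
  case (t_sq i)
  then show ?thesis
    by (auto intro!: exI[of _ False] homog_1 homog_mult_eq[OF homog_t homog_t])
next
  case (braid i)
  then have "i \<in> t_index W n" "i + 1 \<in> t_index W n" by (auto intro!: t_indexI)
  with braid show ?thesis
    by (auto intro!: exI[of _ True] homog_mult_eq[OF homog_mult_eq[OF homog_t homog_t refl] homog_t])
next
  case (far i j)
  then have "i \<in> t_index W n" "j \<in> t_index W n" by (auto intro!: t_indexI)
  with far show ?thesis
    by (auto intro!: exI[of _ False] homog_neg homog_1
        homog_even_pow[OF homog_mult_eq[OF homog_t homog_t refl]])
next
  case (far_B i)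
  then show ?thesis
    by (auto intro!: exI[of _ False] homog_neg homog_1
        homog_even_pow[OF homog_mult_eq[OF homog_t homog_t refl]])
next
  case quad_B
  with adm show ?thesis
    by (auto intro!: exI[of _ False] homog_neg homog_1
        homog_even_pow[OF homog_mult_eq[OF homog_t homog_t refl]])
next
  case (far_D i)
  then show ?thesis
    by (auto intro!: exI[of _ False] homog_neg homog_1
        homog_even_pow[OF homog_mult_eq[OF homog_t homog_t refl]])
next
  case braid_D
  with adm show ?thesis
    by (auto intro!: exI[of _ True] homog_mult_eq[OF homog_mult_eq[OF homog_t homog_t refl] homog_t])
qed

lemmas homog_rel_intros = homog_neg homog_add homog_scal_mult homog_sum homog_comm
  homog_mult_eq[OF homog_t homog_y] homog_mult_eq[OF homog_y homog_t]
  homog_mult_eq[OF homog_t homog_x] homog_mult_eq[OF homog_x homog_t]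
  homog_mult_eq[OF homog_x homog_x] homog_mult_eq[OF homog_y homog_y]
  homog_br homog_obarD homog_obarB homog_obarB1 homog_y homog_x

proposition rsd_rel_homog:
  assumes "rsd_rel W n u v a b" and adm: "admissible W n"
  shows "\<exists>p. a \<in> homog W n p \<and> b \<in> homog W n p"
  using assms(1)
proof cases
  case spin_weyl
  then show ?thesis using spin_weyl_rel_homog adm by blast
next
  case y_y
  show ?thesis unfolding y_y
    by (intro exI[of _ False] conjI homog_rel_intros) (use y_y adm in auto)
next
  case xi_xi
  show ?thesis unfolding xi_xi
    by (intro exI[of _ False] conjI homog_rel_intros) (use xi_xi adm in auto)
next
  case t_y
  show ?thesis unfolding t_y
    by (intro exI[of _ True] conjI homog_rel_intros t_indexI) (use t_y adm in auto)
next
  case t_xi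
  show ?thesis unfolding t_xi
    by (intro exI[of _ False] conjI homog_rel_intros t_indexI) (use t_xi adm in auto)
next
  case t_y_far
  show ?thesis unfolding t_y_far
    by (intro exI[of _ True] conjI homog_rel_intros t_indexI) (use t_y_far adm in auto)
next
  case t_xi_far
  show ?thesis unfolding t_xi_far
    by (intro exI[of _ False] conjI homog_rel_intros t_indexI) (use t_xi_far adm in auto)
next
  case tn_y_D
  show ?thesis unfolding tn_y_D
    by (intro exI[of _ True] conjI homog_rel_intros) (use tn_y_D adm in auto)
next
  case tn_xi_D
  show ?thesis unfolding tn_xi_D
    by (intro exI[of _ False] conjI homog_rel_intros) (use tn_xi_D adm in auto)
next
  case tn_y_far_D
  show ?thesis unfolding tn_y_far_D
    by (intro exI[of _ True] conjI homog_rel_intros) (use tn_y_far_D adm in auto)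
next
  case tn_xi_far_D
  show ?thesis unfolding tn_xi_far_D
    by (intro exI[of _ False] conjI homog_rel_intros) (use tn_xi_far_D adm in auto)
next
  case tn_y_B
  show ?thesis unfolding tn_y_B
    by (intro exI[of _ True] conjI homog_rel_intros) (use tn_y_B adm in auto)
next
  case tn_xi_B
  show ?thesis unfolding tn_xi_B
    by (intro exI[of _ False] conjI homog_rel_intros) (use tn_xi_B adm in auto)
next
  case tn_y_far_B
  show ?thesis unfolding tn_y_far_B
    by (intro exI[of _ True] conjI homog_rel_intros) (use tn_y_far_B adm in auto)
next
  case tn_xi_far_B
  show ?thesis unfolding tn_xi_far_B
    by (intro exI[of _ False] conjI homog_rel_intros) (use tn_xi_far_B adm in auto)
next
  case y_xi_A
  show ?thesis unfolding y_xi_A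
    by (intro exI[of _ True] conjI homog_rel_intros) (use y_xi_A adm in auto)
next
  case y_xi_same_A
  show ?thesis unfolding y_xi_same_A
    by (intro exI[of _ True] conjI homog_rel_intros) (use y_xi_same_A adm in auto)
next
  case y_xi_D
  show ?thesis unfolding y_xi_D
    by (intro exI[of _ True] conjI homog_rel_intros) (use y_xi_D adm in auto)
next
  case y_xi_same_D
  show ?thesis unfolding y_xi_same_D
    by (intro exI[of _ True] conjI homog_rel_intros) (use y_xi_same_D adm in auto)
next
  case y_xi_B
  show ?thesis unfolding y_xi_B
    by (intro exI[of _ True] conjI homog_rel_intros) (use y_xi_B adm in auto)
next
  case y_xi_same_B
  show ?thesis unfolding y_xi_same_B
    by (intro exI[of _ True] conjI homog_rel_intros) (use y_xi_same_B adm in auto)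
qed

proposition ring_rsdaha:
  assumes "admissible W n"
  shows "ring (rsdaha W n u v)"
proof -
  have hc: "homog W n p \<subseteq> carrier (free_alg W n)" for p
    by (auto simp: homog_def free_alg_def)
  have "a - b \<in> carrier (free_alg W n)" if rel: "rsd_rel W n u v a b" for a b
  proof -
    obtain p where "a \<in> homog W n p" "b \<in> homog W n p"
      using rsd_rel_homog[OF rel assms] by blast
    then have "a + - b \<in> homog W n p" by (intro homog_add homog_neg)
    then show ?thesis using hc by auto
  qed
  then have "ideal (rsd_ideal W n u v) (free_alg W n)"
    unfolding rsd_ideal_def by (intro ring.genideal_ideal ring_free_alg) auto
  then show ?thesis
    unfolding rsdaha_def by (rule ideal.quotient_is_ring)
qed

end

theory Submission
  imports Defs
begin

text \<open>
  Each generator \<open>t\<^sub>k\<close>, and hence each reflection \<open>[i,j]\<close> and its barred analogues, moves the \<open>y\<^sub>j\<close>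
  like the corresponding signed permutation and the \<open>\<xi>\<^sub>j\<^sup>2\<close> like the underlying permutation. Hence
  the commutator of a polynomial \<open>f(y)\<close> with \<open>\<xi>\<^sub>i\<close> obeys a twisted Leibniz rule and is a sum of
  divided differences of \<open>f\<close> times reflections, which vanishes if \<open>f\<close> is invariant; similarly for
  polynomials in the \<open>\<xi>\<^sub>j\<^sup>2\<close> and commutators with \<open>y\<^sub>i\<close>.

  For finiteness, the algebra is spanned by the products of a word in the \<open>y\<^sub>i\<close>, a word in the \<open>\<xi>\<^sub>i\<close>
  and a word in the \<open>t\<^sub>k\<close>. Both \<open>y\<^sub>i\<^sup>2\<close> and \<open>\<xi>\<^sub>i\<^sup>2\<close> are roots of monic polynomials whose
  coefficients are elementary symmetric, hence central. Finally, up to sign there are finitely many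
  words in the \<open>t\<^sub>k\<close>, because the reflections form, up to sign, a finite set of involutions that is
  closed under conjugation (Dietzmann's lemma); this uses the Coxeter relations only, so that no
  basis theorem is needed.
\<close>

section \<open>Invariant polynomials and divided differences\<close>

text \<open>Nothing is known beforehand about the size of the algebra: differences of the
  \<open>y\<close> might be zero divisors in it, and different words might coincide. Division
  therefore has to happen elsewhere: divided differences are formed in the polynomial ring, which is
  a domain, and only the identities that they satisfy are evaluated in the algebra.

  Signs are the second obstacle: distant \<open>t_k\<close> anticommute, so the Coxeter relations
  hold only up to sign. Conjugation uses each factor twice and does not see these signs. For this
  reason the combinatorics of the reflections is done for abstract conjugation operators, which obey
  the Coxeter relations exactly on classes \<open>{r, - r}\<close>.

  In a spanning product the \<open>y\<close> stand in front because the commutator of a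
  \<open>y\<close> with a \<open>\<xi>\<close> is a combination of products of the
  \<open>t_k\<close>, which in turn permute the \<open>y\<close> and the \<open>\<xi>\<close> up to
  sign. Moving a \<open>\<xi>\<close> to the right across a \<open>y\<close> thus costs only terms
  with a shorter \<open>y\<close>-word.\<close>

lemma poly_mapping_induct_add [case_names single add]:
  fixes p :: "'a \<Rightarrow>\<^sub>0 'b::comm_monoid_add"
  assumes "\<And>k c. P (Poly_Mapping.single k c)"
    and "\<And>f g. P f \<Longrightarrow> P g \<Longrightarrow> P (f + g)"
  shows "P p"
proof -
  have "P (\<Sum>k\<in>K. Poly_Mapping.single k (Poly_Mapping.lookup p k))" if "finite K" for K
    using that
  proof (induct K)
    case empty
    then show ?case using assms(1)[of undefined 0] by simp
  next
    case (insert k K)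
    then show ?case using assms by simp
  qed
  moreover have "p = (\<Sum>k\<in>Poly_Mapping.keys p. Poly_Mapping.single k (Poly_Mapping.lookup p k))"
    by (rule poly_mapping_eqI)
      (auto simp: lookup_sum lookup_single when_def sum.delta in_keys_iff)
  ultimately show ?thesis by (metis finite_keys)
qed

text \<open>This single construction lies behind the substitution \<open>subst\<close>, the
  evaluation \<open>ev\<close> and the truncation \<open>proj\<close>. In the lemmas below,
  \<open>c\<close> has to respect zero, sums and products, but not a unit, because the target of
  \<open>ev\<close> is a ring without one.\<close>

definition lin_ext :: "('c \<Rightarrow> 'r) \<Rightarrow> ('k \<Rightarrow> 'r) \<Rightarrow> ('k \<Rightarrow>\<^sub>0 'c::zero) \<Rightarrow> 'r::semiring_0"
  where "lin_ext c \<mu> p = (\<Sum>k\<in>Poly_Mapping.keys p. c (Poly_Mapping.lookup p k) * \<mu> k)"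

lemma lin_ext_superset:
  assumes "finite K" "Poly_Mapping.keys p \<subseteq> K" "c 0 = 0"
  shows "lin_ext c \<mu> p = (\<Sum>k\<in>K. c (Poly_Mapping.lookup p k) * \<mu> k)"
  unfolding lin_ext_def
  by (rule sum.mono_neutral_left) (use assms in \<open>auto simp: in_keys_iff\<close>)

lemma lin_ext_single: "c 0 = 0 \<Longrightarrow> lin_ext c \<mu> (Poly_Mapping.single k a) = c a * \<mu> k"
  by (simp add: lin_ext_def)

lemma lin_ext_add:
  assumes "c 0 = 0" "\<And>a b. c (a + b) = c a + c b"
  shows "lin_ext c \<mu> (p + q) = lin_ext c \<mu> p + lin_ext c \<mu> q"
proof -
  let ?K = "Poly_Mapping.keys p \<union> Poly_Mapping.keys q"
  have "Poly_Mapping.keys (p + q) \<subseteq> ?K" by (rule Poly_Mapping.keys_add)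
  then show ?thesis
    using assms by (simp add: lin_ext_superset[where K = ?K] lookup_add distrib_right sum.distrib)
qed

lemma lin_ext_mult:
  fixes p q :: "'k::monoid_add \<Rightarrow>\<^sub>0 'c::semiring_0"
  assumes c: "c 0 = 0" "\<And>a b. c (a + b) = c a + c b" "\<And>a b. c (a * b) = c a * c b"
    and \<mu>: "\<And>k l. \<mu> (k + l) = \<mu> k * \<mu> l" and cm: "\<And>a k. \<mu> k * c a = c a * \<mu> k"
  shows "lin_ext c \<mu> (p * q) = lin_ext c \<mu> p * lin_ext c \<mu> q"
proof (induct p rule: poly_mapping_induct_add)
  case (single k a)
  show ?case
  proof (induct q rule: poly_mapping_induct_add)
    case (single l b)
    have "c a * c b * (\<mu> k * \<mu> l) = c a * \<mu> k * (c b * \<mu> l)"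
      by (simp add: mult.assoc) (simp add: mult.assoc[symmetric] cm)
    then show ?case by (simp add: mult_single lin_ext_single c \<mu>)
  next
    case (add f g)
    then show ?case by (simp add: distrib_left lin_ext_add c)
  qed
next
  case (add f g)
  then show ?case by (simp add: distrib_right lin_ext_add c)
qed

abbreviation Cst :: "complex \<Rightarrow> cpoly" where "Cst \<equiv> Poly_Mapping.single 0"

lemma single_monomial_induct:
  assumes "P 1" "\<And>i. P (var i)" "\<And>f g. P f \<Longrightarrow> P g \<Longrightarrow> P (f * g)"
  shows "P (Poly_Mapping.single m 1)"
proof (induct m rule: poly_mapping_induct_add)
  case (single i k)
  show ?case
  proof (induct k)
    case (Suc k)
    have "Poly_Mapping.single (Poly_Mapping.single i (Suc k)) 1 =
      var i * Poly_Mapping.single (Poly_Mapping.single i k) 1"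
      by (simp add: var_def mult_single flip: single_add)
    then show ?case using Suc assms by simp
  qed (simp add: assms)
next
  case (add m m')
  then show ?case using assms(3)[of "Poly_Mapping.single m 1" "Poly_Mapping.single m' 1"]
    by (simp add: mult_single)
qed

lemma cpoly_induct [case_names const var add mult]:
  assumes "\<And>c. P (Cst c)" "\<And>i. P (var i)"
    "\<And>f g. P f \<Longrightarrow> P g \<Longrightarrow> P (f + g)" "\<And>f g. P f \<Longrightarrow> P g \<Longrightarrow> P (f * g)"
  shows "P (p :: cpoly)"
proof (induct p rule: poly_mapping_induct_add)
  case (single m c)
  have "P (Poly_Mapping.single m 1)"
    by (rule single_monomial_induct) (use assms(1)[of 1] assms in auto)
  then show ?case using assms(4)[OF assms(1)[of c]] by (force simp: mult_single)
qed (rule assms)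

section \<open>Substitution as a homomorphism\<close>

lemma subst_eq_lin_ext:
  "subst f = lin_ext Cst (\<lambda>m. \<Prod>i\<in>Poly_Mapping.keys m. f i ^ Poly_Mapping.lookup m i)"
  by (rule ext) (simp add: subst_def lin_ext_def)

lemma prod_keys_add:
  fixes f :: "nat \<Rightarrow> cpoly"
  shows "(\<Prod>i\<in>Poly_Mapping.keys (k + l). f i ^ Poly_Mapping.lookup (k + l) i) =
    (\<Prod>i\<in>Poly_Mapping.keys k. f i ^ Poly_Mapping.lookup k i) *
    (\<Prod>i\<in>Poly_Mapping.keys l. f i ^ Poly_Mapping.lookup l i)"
proof -
  let ?K = "Poly_Mapping.keys k \<union> Poly_Mapping.keys l"
  have *: "(\<Prod>i\<in>Poly_Mapping.keys m. f i ^ Poly_Mapping.lookup m i) =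
    (\<Prod>i\<in>?K. f i ^ Poly_Mapping.lookup m i)" if "Poly_Mapping.keys m \<subseteq> ?K" for m
    by (rule prod.mono_neutral_left) (use that in \<open>auto simp: in_keys_iff\<close>)
  show ?thesis
    by (subst (1 2 3) *) (use Poly_Mapping.keys_add[of k l] in
        \<open>auto simp: lookup_add power_add prod.distrib\<close>)
qed

lemma subst_add: "subst f (p + q) = subst f p + subst f q"
  unfolding subst_eq_lin_ext by (rule lin_ext_add) (simp_all add: single_add)

lemma subst_mult: "subst f (p * q) = subst f p * subst f q"
  unfolding subst_eq_lin_ext
  by (rule lin_ext_mult) (simp_all add: single_add mult_single mult.commute prod_keys_add)

lemma subst_Cst: "subst f (Cst c) = Cst c"
  unfolding subst_eq_lin_ext by (simp add: lin_ext_single)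

lemma subst_var: "subst f (var i) = f i"
  unfolding subst_eq_lin_ext by (simp add: lin_ext_single var_def)

lemma subst_0: "subst f 0 = 0" and subst_1: "subst f 1 = 1"
  using subst_Cst[of f 0] subst_Cst[of f 1] by simp_all

lemma subst_minus: "subst f (- p) = - subst f p"
  using subst_add[of f p "- p"] by (simp add: subst_0 eq_neg_iff_add_eq_0 add.commute)

lemma subst_sum: "subst f (sum g A) = (\<Sum>a\<in>A. subst f (g a))"
  by (induct A rule: infinite_finite_induct) (simp_all add: subst_0 subst_add)

lemma subst_prod: "subst f (prod g A) = (\<Prod>a\<in>A. subst f (g a))"
  by (induct A rule: infinite_finite_induct) (simp_all add: subst_1 subst_mult)

lemma subst_power: "subst f (p ^ k) = subst f p ^ k"
  by (induct k) (simp_all add: subst_1 subst_mult)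

lemma lookup_var: "Poly_Mapping.lookup (var i) (Poly_Mapping.single j 1) = (if i = j then 1 else 0)"
proof -
  have "Poly_Mapping.single i (1::nat) = Poly_Mapping.single j 1 \<longleftrightarrow> i = j"
    by (metis lookup_single_eq lookup_single_not_eq zero_neq_one)
  then show ?thesis by (simp add: var_def lookup_single when_def)
qed

text \<open>These are the roots of the classical Weyl groups, up to scale. They serve as
  denominators of divided differences and can be cancelled since polynomials form a domain.\<close>

lemma var_diff_nonzero: "i \<noteq> j \<Longrightarrow> var i - var j \<noteq> 0"
  and var_add_nonzero: "i \<noteq> j \<Longrightarrow> var i + var j \<noteq> 0"
  and var_double_nonzero: "var i + var i \<noteq> 0"
  using lookup_minus[of "var i" "var j" "Poly_Mapping.single i 1"]
    lookup_add[of "var i" "var j" "Poly_Mapping.single i 1"]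
    lookup_add[of "var i" "var i" "Poly_Mapping.single i 1"]
  by (auto simp: lookup_var simp del: One_nat_def)

lemma twisted_commute:
  fixes ev :: "cpoly \<Rightarrow> 'r::ring"
  assumes add: "\<And>p q. ev (p + q) = ev p + ev q" and mult: "\<And>p q. ev (p * q) = ev p * ev q"
    and const: "\<And>c. h * ev (Cst c) = ev (Cst c) * h"
    and var: "\<And>j. h * ev (var j) = ev (f j) * h"
  shows "h * ev p = ev (subst f p) * h"
proof (induct p rule: cpoly_induct)
  case (mult p q)
  then show ?case by (metis assms(2) mult.assoc subst_mult)
qed (simp_all add: const var subst_Cst subst_var subst_add add distrib_left distrib_right)

text \<open>
  The \<open>g s\<close> below are the divided differences of \<open>p\<close>, that is \<open>(p - subst (f s) p) / \<alpha> s\<close>.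
  They satisfy a twisted Leibniz rule which matches that of the commutator with \<open>D\<close>,
  and they vanish if \<open>p\<close> is invariant.
\<close>

lemma invariant_commute:
  fixes ev :: "cpoly \<Rightarrow> 'r::ring"
  assumes add: "\<And>p q. ev (p + q) = ev p + ev q" and mult: "\<And>p q. ev (p * q) = ev p * ev q"
    and const: "\<And>c. ev (Cst c) * D = D * ev (Cst c)"
    and twist: "\<And>s p. s \<in> R \<Longrightarrow> \<rho> s * ev p = ev (subst (f s) p) * \<rho> s"
    and var: "\<And>j. \<exists>d. (\<forall>s\<in>R. var j - f s j = \<alpha> s * d s) \<and>
      ev (var j) * D - D * ev (var j) = (\<Sum>s\<in>R. ev (d s) * \<rho> s)"
    and \<alpha>: "\<And>s. s \<in> R \<Longrightarrow> \<alpha> s \<noteq> 0"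
    and inv: "\<And>s. s \<in> R \<Longrightarrow> \<rho> s = 0 \<or> subst (f s) p = p"
  shows "ev p * D = D * ev p"
proof -
  have ev0: "ev 0 = 0" using add[of 0 0] by simp
  have "\<exists>g. (\<forall>s\<in>R. p - subst (f s) p = \<alpha> s * g s) \<and>
      ev p * D - D * ev p = (\<Sum>s\<in>R. ev (g s) * \<rho> s)"
  proof (induct p rule: cpoly_induct)
    case (const c)
    show ?case by (rule exI[of _ "\<lambda>_. 0"]) (simp add: subst_Cst ev0 assms(3))
  next
    case (var i)
    then show ?case using assms(5)[of i] by (simp add: subst_var)
  next
    case (add p q)
    then obtain g g' where g:
      "\<forall>s\<in>R. p - subst (f s) p = \<alpha> s * g s" "\<forall>s\<in>R. q - subst (f s) q = \<alpha> s * g' s"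
      "ev p * D - D * ev p = (\<Sum>s\<in>R. ev (g s) * \<rho> s)"
      "ev q * D - D * ev q = (\<Sum>s\<in>R. ev (g' s) * \<rho> s)" by blast
    moreover have "p + q - subst (f s) (p + q) = \<alpha> s * (g s + g' s)" if "s \<in> R" for s
      using g(1,2) that by (simp add: subst_add distrib_left add_diff_add)
    moreover have "ev (p + q) * D - D * ev (p + q) = (\<Sum>s\<in>R. ev (g s + g' s) * \<rho> s)"
    proof -
      have "ev (p + q) * D - D * ev (p + q) = (ev p * D - D * ev p) + (ev q * D - D * ev q)"
        by (simp add: assms(1) algebra_simps)
      then show ?thesis by (simp add: g(3,4) assms(1) distrib_right sum.distrib)
    qed
    ultimately show ?case by (intro exI[of _ "\<lambda>s. g s + g' s"]) blast
  next
    case (mult p q)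
    then obtain g g' where g:
      "\<forall>s\<in>R. p - subst (f s) p = \<alpha> s * g s" "\<forall>s\<in>R. q - subst (f s) q = \<alpha> s * g' s"
      "ev p * D - D * ev p = (\<Sum>s\<in>R. ev (g s) * \<rho> s)"
      "ev q * D - D * ev q = (\<Sum>s\<in>R. ev (g' s) * \<rho> s)" by blast
    \<comment> \<open>Of the two possible product rules, the one with \<open>subst (f s)\<close> on
      \<open>q\<close> is needed: in the commutator \<open>\<rho> s\<close> stands to the left of
      \<open>ev q\<close> and twists it in passing.\<close>
    have "p * q - subst (f s) (p * q) = \<alpha> s * (p * g' s + g s * subst (f s) q)" if "s \<in> R" for s
    proof -
      have "p * q - subst (f s) (p * q) =
          p * (q - subst (f s) q) + (p - subst (f s) p) * subst (f s) q"
        by (simp add: subst_mult algebra_simps)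
      then show ?thesis using g that by (simp add: algebra_simps)
    qed
    moreover have "ev (p * q) * D - D * ev (p * q) =
      (\<Sum>s\<in>R. ev (p * g' s + g s * subst (f s) q) * \<rho> s)"
    proof -
      have "ev (p * q) * D - D * ev (p * q) =
          ev p * (ev q * D - D * ev q) + (ev p * D - D * ev p) * ev q"
        by (simp add: assms(2) algebra_simps)
      also have "\<dots> = (\<Sum>s\<in>R. ev p * (ev (g' s) * \<rho> s) + ev (g s) * (\<rho> s * ev q))"
        by (simp add: g sum_distrib_left sum_distrib_right sum.distrib mult.assoc)
      also have "\<dots> = (\<Sum>s\<in>R. ev (p * g' s + g s * subst (f s) q) * \<rho> s)"
        by (intro sum.cong) (simp_all add: assms(1,2) twist distrib_right mult.assoc)
      finally show ?thesis .
    qed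
    ultimately show ?case by (intro exI[of _ "\<lambda>s. p * g' s + g s * subst (f s) q"]) blast
  qed
  then obtain g where g: "\<And>s. s \<in> R \<Longrightarrow> p - subst (f s) p = \<alpha> s * g s"
    "ev p * D - D * ev p = (\<Sum>s\<in>R. ev (g s) * \<rho> s)" by blast
  \<comment> \<open>For invariant \<open>p\<close> the polynomial identity reads
    \<open>0 = \<alpha> s * g s\<close>, so \<open>g s\<close> vanishes before it is evaluated. The
    alternative \<open>\<rho> s = 0\<close> covers reflections that do not belong to
    \<open>W\<close>.\<close>
  have "ev (g s) * \<rho> s = 0" if "s \<in> R" for s
    using inv[OF that] g(1)[OF that] \<alpha>[OF that] ev0 by auto
  then show ?thesis using g(2) by simp
qed

section \<open>Elementary symmetric polynomials\<close>

definition polys :: "nat \<Rightarrow> cpoly set"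
  where "polys n = {p. \<forall>m\<in>Poly_Mapping.keys p. Poly_Mapping.keys m \<subseteq> {1..n}}"

lemma polys_add: "p \<in> polys n \<Longrightarrow> q \<in> polys n \<Longrightarrow> p + q \<in> polys n"
  using Poly_Mapping.keys_add[of p q] by (auto simp: polys_def)

lemma polys_minus: "p \<in> polys n \<Longrightarrow> - p \<in> polys n"
  by (simp add: polys_def)

lemma polys_mult:
  assumes "p \<in> polys n" "q \<in> polys n"
  shows "p * q \<in> polys n"
proof -
  have "Poly_Mapping.keys m \<subseteq> {1..n}" if "m \<in> Poly_Mapping.keys (p * q)" for m
  proof -
    obtain k l where "k \<in> Poly_Mapping.keys p" "l \<in> Poly_Mapping.keys q" "m = k + l"
      using keys_mult[of p q] \<open>m \<in> _\<close> by blast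
    then show ?thesis using assms Poly_Mapping.keys_add[of k l] unfolding polys_def by blast
  qed
  then show ?thesis by (simp add: polys_def)
qed

lemma polys_Cst: "Cst c \<in> polys n"
  by (simp add: polys_def)

lemma polys_var: "i \<in> {1..n} \<Longrightarrow> var i \<in> polys n"
  by (simp add: polys_def var_def)

lemma polys_prod: "(\<And>a. a \<in> A \<Longrightarrow> g a \<in> polys n) \<Longrightarrow> prod g A \<in> polys n"
  using polys_Cst[of 1 n]
  by (induct A rule: infinite_finite_induct) (auto intro: polys_mult)

lemma polys_sum: "(\<And>a. a \<in> A \<Longrightarrow> g a \<in> polys n) \<Longrightarrow> sum g A \<in> polys n"
  using polys_Cst[of 0 n]
  by (induct A rule: infinite_finite_induct) (auto intro: polys_add)

text \<open>This is \<open>(-1) ^ k\<close> times the \<open>k\<close>-th elementary symmetric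
  polynomial in \<open>a 1, ..., a n\<close>. With the sign built in, these are the coefficients of
  the monic polynomial whose roots are the \<open>a j\<close>.\<close>

definition esym :: "nat \<Rightarrow> (nat \<Rightarrow> cpoly) \<Rightarrow> nat \<Rightarrow> cpoly"
  where "esym n a k = (\<Sum>S | S \<subseteq> {1..n} \<and> card S = k. \<Prod>j\<in>S. - a j)"

lemma esym_polys: "(\<And>j. j \<in> {1..n} \<Longrightarrow> a j \<in> polys n) \<Longrightarrow> esym n a k \<in> polys n"
  unfolding esym_def by (intro polys_sum polys_prod polys_minus) auto

text \<open>Only the effect of \<open>f\<close> on the \<open>a j\<close> matters, so with
  \<open>a j = var j ^ 2\<close> the signs of a signed permutation disappear. What remains is a
  permutation of the index sets \<open>S\<close>.\<close>

lemma subst_esym: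
  assumes \<sigma>: "\<sigma> permutes {1..n}" and "\<And>j. j \<in> {1..n} \<Longrightarrow> subst f (a j) = a (\<sigma> j)"
  shows "subst f (esym n a k) = esym n a k"
proof -
  let ?A = "{S. S \<subseteq> {1..n} \<and> card S = k}" and ?\<tau> = "inv_into UNIV \<sigma>"
  have inj: "inj_on \<sigma> S" "inj_on ?\<tau> S" for S
    using permutes_inj[OF \<sigma>] permutes_inj[OF permutes_inv[OF \<sigma>]]
    by (auto intro: inj_on_subset)
  have "subst f (esym n a k) = (\<Sum>S\<in>?A. \<Prod>j\<in>S. subst f (- a j))"
    by (simp only: esym_def subst_sum subst_prod)
  also have "\<dots> = (\<Sum>S\<in>?A. \<Prod>j\<in>S. - a (\<sigma> j))"
    by (intro sum.cong prod.cong) (use assms(2) in \<open>auto simp: subst_minus\<close>)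
  also have "\<dots> = (\<Sum>S\<in>?A. \<Prod>j\<in>\<sigma> ` S. - a j)"
    by (intro sum.cong refl) (simp only: prod.reindex[OF inj(1)] o_def)
  also have "\<dots> = (\<Sum>S\<in>?A. \<Prod>j\<in>S. - a j)"
  proof (rule sum.reindex_bij_witness[where j = "(`) \<sigma>" and i = "(`) ?\<tau>"])
    fix S assume S: "S \<in> ?A"
    show "?\<tau> ` \<sigma> ` S = S" "\<sigma> ` ?\<tau> ` S = S"
      by (simp_all add: image_image permutes_inverses[OF \<sigma>])
    have "\<sigma> ` S \<subseteq> {1..n}" "?\<tau> ` S \<subseteq> {1..n}"
      using S permutes_image[OF \<sigma>] permutes_image[OF permutes_inv[OF \<sigma>]] by blast+
    then show "\<sigma> ` S \<in> ?A" "?\<tau> ` S \<in> ?A"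
      using S by (simp_all add: card_image inj)
  qed simp
  finally show ?thesis by (simp add: esym_def)
qed

text \<open>Vieta's formula for the product of all \<open>a i - a j\<close>.\<close>

lemma esym_root:
  assumes "i \<in> {1..n}"
  shows "(\<Sum>k\<le>n. esym n a k * a i ^ (n - k)) = 0"
proof -
  have "0 = (\<Prod>j\<in>{1..n}. - a j + a i)" using assms by (auto intro!: prod_zero[symmetric])
  also have "\<dots> = (\<Sum>S\<in>Pow {1..n}. (\<Prod>j\<in>S. - a j) * a i ^ (n - card S))"
    by (subst prod_add) (auto intro!: sum.cong simp: card_Diff_subset finite_subset)
  also have "\<dots> = (\<Sum>k\<le>n. \<Sum>S | S \<in> Pow {1..n} \<and> card S = k. (\<Prod>j\<in>S. - a j) * a i ^ (n - card S))"
    by (rule sum.group[symmetric]) (auto dest: card_mono[rotated])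
  also have "\<dots> = (\<Sum>k\<le>n. esym n a k * a i ^ (n - k))"
    unfolding esym_def sum_distrib_right by (intro sum.cong) auto
  finally show ?thesis by simp
qed

lemma esym_0: "esym n a 0 = 1"
proof -
  have "{S. S \<subseteq> {1..n} \<and> card S = 0} = {{}}" by (auto dest: finite_subset)
  then show ?thesis by (simp add: esym_def)
qed

section \<open>The action of reflections\<close>

lemma scal_add: "scal (a + b) = scal a + scal b"
  and scal_mult: "scal (a * b) = scal a * scal b"
  and scal_0: "scal 0 = 0" and scal_1: "scal 1 = 1"
  by (simp_all add: scal_def single_add mult_single)

lemma scal_central: "scal c * f = f * scal c"
  by (induct f rule: poly_mapping_induct_add)
    (simp_all add: scal_def mult_single mult.commute distrib_left distrib_right)

text \<open>Working with an arbitrary additive and multiplicative map that respects the relations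
  keeps ideals and cosets out of the computations. \<open>\<Phi> 1\<close> need not be a unit of the
  target; it acts as one on the image of \<open>\<Phi>\<close>, and this suffices.\<close>

locale rsd_hom =
  fixes W :: weyl_type and n :: nat and u v :: complex and \<Phi> :: "free \<Rightarrow> 'r::ring"
  assumes adm: "admissible W n"
    and \<Phi>_add: "\<Phi> (a + b) = \<Phi> a + \<Phi> b" and \<Phi>_mult: "\<Phi> (a * b) = \<Phi> a * \<Phi> b"
    and \<Phi>_rel: "rsd_rel W n u v a b \<Longrightarrow> \<Phi> a = \<Phi> b"
begin

abbreviation \<xi> where "\<xi> i \<equiv> \<Phi> (xg i)"
abbreviation \<eta> where "\<eta> i \<equiv> \<Phi> (yg i)"
abbreviation \<tau> where "\<tau> i \<equiv> \<Phi> (tg i)"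
abbreviation \<kappa> where "\<kappa> c \<equiv> \<Phi> (scal c)"

lemma \<Phi>_0: "\<Phi> 0 = 0"
  using \<Phi>_add[of 0 0] by simp

lemma \<Phi>_minus: "\<Phi> (- a) = - \<Phi> a"
  using \<Phi>_add[of a "- a"] by (simp add: \<Phi>_0 eq_neg_iff_add_eq_0 add.commute)

lemma \<Phi>_diff: "\<Phi> (a - b) = \<Phi> a - \<Phi> b"
  using \<Phi>_add[of a "- b"] by (simp add: \<Phi>_minus)

lemma \<Phi>_sum: "\<Phi> (sum f A) = (\<Sum>a\<in>A. \<Phi> (f a))"
  by (induct A rule: infinite_finite_induct) (simp_all add: \<Phi>_0 \<Phi>_add)

lemma \<Phi>_1_left: "\<Phi> 1 * \<Phi> a = \<Phi> a" and \<Phi>_1_right: "\<Phi> a * \<Phi> 1 = \<Phi> a"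
  and \<Phi>_1_right': "z * \<Phi> a * \<Phi> 1 = z * \<Phi> a"
  by (metis \<Phi>_mult mult_1 mult_1_right mult.assoc)+

lemma \<Phi>_sgn: "\<Phi> ((-1) ^ k) = (if even k then \<Phi> 1 else - \<Phi> 1)"
  by (simp add: \<Phi>_minus)

lemmas \<Phi>_simps = \<Phi>_0 \<Phi>_add \<Phi>_mult \<Phi>_minus \<Phi>_diff \<Phi>_sum \<Phi>_1_left \<Phi>_1_right \<Phi>_1_right' \<Phi>_sgn

lemma \<kappa>_central: "\<kappa> c * \<Phi> a = \<Phi> a * \<kappa> c"
  by (metis \<Phi>_mult scal_central)

lemma \<tau>_sq: "i \<in> t_index W n \<Longrightarrow> \<tau> i * \<tau> i = \<Phi> 1"
  by (metis \<Phi>_mult \<Phi>_rel spin_weyl t_sq)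

lemma \<tau>_cancel: "i \<in> t_index W n \<Longrightarrow> \<tau> i * (\<tau> i * \<Phi> a) = \<Phi> a"
  "i \<in> t_index W n \<Longrightarrow> \<Phi> a * \<tau> i * \<tau> i = \<Phi> a"
  by (metis \<tau>_sq \<Phi>_1_left mult.assoc) (metis \<tau>_sq \<Phi>_1_right mult.assoc)

text \<open>The minus sign at the \<open>\<xi>\<close> is that of an odd element \<open>h\<close>
  and is independent of \<open>S\<close>. This is why the squares of the \<open>\<xi>\<close> see
  the underlying permutation only.\<close>

definition moves :: "free \<Rightarrow> (nat \<Rightarrow> nat) \<Rightarrow> nat set \<Rightarrow> bool"
  where "moves h \<sigma> S \<longleftrightarrow> (\<forall>j\<in>{1..n}.
    \<Phi> h * \<eta> j = (if j \<in> S then - (\<eta> (\<sigma> j) * \<Phi> h) else \<eta> (\<sigma> j) * \<Phi> h) \<and>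
    \<Phi> h * \<xi> j = - (\<xi> (\<sigma> j) * \<Phi> h))"

text \<open>The defining relations state how \<open>t_k\<close> passes one of the two variables that
  it exchanges; since \<open>t_k\<close> squares to the unit, the rule for the other variable
  follows.\<close>

lemma \<tau>_swap:
  assumes i: "i \<in> t_index W n" and "\<tau> i * \<Phi> a = \<Phi> b * \<tau> i"
  shows "\<tau> i * \<Phi> b = \<Phi> a * \<tau> i"
proof -
  have "\<tau> i * \<Phi> b = \<tau> i * (\<Phi> b * \<tau> i) * \<tau> i"
    using \<tau>_cancel(2)[OF i, of "tg i * b"] by (simp add: \<Phi>_mult mult.assoc)
  also have "\<dots> = \<Phi> a * \<tau> i"
    using \<tau>_cancel(1)[OF i, of a] by (simp add: assms(2)[symmetric])
  finally show ?thesis .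
qed

lemma \<tau>_swap_neg:
  assumes "i \<in> t_index W n" and "\<tau> i * \<Phi> a = - (\<Phi> b * \<tau> i)"
  shows "\<tau> i * \<Phi> b = - (\<Phi> a * \<tau> i)"
  using \<tau>_swap[of i "- a" b] assms by (simp add: \<Phi>_minus)

lemma moves_\<tau>:
  assumes i: "i \<in> {1..<n}"
  shows "moves (tg i) (transpose i (i + 1)) {}"
proof -
  have near: "\<tau> i * \<eta> i = \<eta> (i + 1) * \<tau> i" "\<tau> i * \<xi> i = - (\<xi> (i + 1) * \<tau> i)"
    using \<Phi>_rel[OF t_y[OF i]] \<Phi>_rel[OF t_xi[OF i]] by (simp_all add: \<Phi>_simps)
  have far: "\<tau> i * \<eta> j = \<eta> j * \<tau> i" "\<tau> i * \<xi> j = - (\<xi> j * \<tau> i)" if "j \<in> {1..n} - {i, i + 1}" for j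
    using \<Phi>_rel[OF t_y_far[OF i]] \<Phi>_rel[OF t_xi_far[OF i]] that
    by (simp_all add: \<Phi>_simps)
  have swap: "\<tau> i * \<eta> (i + 1) = \<eta> i * \<tau> i" "\<tau> i * \<xi> (i + 1) = - (\<xi> i * \<tau> i)"
    using \<tau>_swap[OF t_indexI[OF i]] \<tau>_swap_neg[OF t_indexI[OF i]] near by metis+
  show ?thesis using near far swap by (auto simp: moves_def transpose_def)
qed

lemma moves_\<tau>n_D:
  assumes D: "W = TypeD"
  shows "moves (tg n) (transpose (n - 1) n) {n - 1, n}"
proof -
  have n: "n \<in> t_index W n" using D adm by auto
  have near: "\<tau> n * \<eta> n = - (\<eta> (n - 1) * \<tau> n)" "\<tau> n * \<xi> n = - (\<xi> (n - 1) * \<tau> n)"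
    using \<Phi>_rel[OF tn_y_D[OF D]] \<Phi>_rel[OF tn_xi_D[OF D]] by (simp_all add: \<Phi>_simps)
  have far: "\<tau> n * \<eta> j = \<eta> j * \<tau> n" "\<tau> n * \<xi> j = - (\<xi> j * \<tau> n)" if "j \<in> {1..n} - {n - 1, n}" for j
    using \<Phi>_rel[OF tn_y_far_D[OF D]] \<Phi>_rel[OF tn_xi_far_D[OF D]] that
    by (simp_all add: \<Phi>_simps)
  have swap: "\<tau> n * \<eta> (n - 1) = - (\<eta> n * \<tau> n)" "\<tau> n * \<xi> (n - 1) = - (\<xi> n * \<tau> n)"
    using \<tau>_swap_neg[OF n] near by metis+
  show ?thesis using near far swap by (auto simp: moves_def transpose_def)
qed

lemma moves_\<tau>n_B:
  assumes B: "W = TypeB"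
  shows "moves (tg n) id {n}"
proof -
  have "\<tau> n * \<eta> n = - (\<eta> n * \<tau> n)" "\<tau> n * \<xi> n = - (\<xi> n * \<tau> n)"
    using \<Phi>_rel[OF tn_y_B[OF B]] \<Phi>_rel[OF tn_xi_B[OF B]] by (simp_all add: \<Phi>_simps)
  moreover have "\<tau> n * \<eta> j = \<eta> j * \<tau> n" "\<tau> n * \<xi> j = - (\<xi> j * \<tau> n)" if "j \<in> {1..n} - {n}" for j
    using \<Phi>_rel[OF tn_y_far_B[OF B]] \<Phi>_rel[OF tn_xi_far_B[OF B]] that
    by (simp_all add: \<Phi>_simps)
  ultimately show ?thesis by (auto simp: moves_def)
qed

lemma moves_minus: "moves h \<sigma> S \<Longrightarrow> moves (- h) \<sigma> S"
  by (auto simp: moves_def \<Phi>_minus)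

lemma moves_0: "moves 0 \<sigma> S"
  by (simp add: moves_def \<Phi>_0)

lemma moves_\<Phi>: "moves h \<sigma> S \<Longrightarrow> \<Phi> h = \<Phi> h' \<Longrightarrow> moves h' \<sigma> S"
  by (simp add: moves_def)

text \<open>On its way through \<open>g * h * g\<close> a variable meets \<open>g\<close> at
  \<open>j\<close>, \<open>h\<close> at \<open>\<rho> j\<close> and \<open>g\<close> again at
  \<open>\<sigma> (\<rho> j)\<close>; the new sign set is the parity of the three signs. For the
  \<open>\<xi>\<close>, three minus signs make one.\<close>

lemma moves_conj:
  assumes "moves g \<rho> A" "moves h \<sigma> S" "\<rho> ` {1..n} \<subseteq> {1..n}" "\<sigma> ` {1..n} \<subseteq> {1..n}"
  shows "moves (g * h * g) (\<rho> \<circ> \<sigma> \<circ> \<rho>) {j. (j \<in> A) \<noteq> ((\<rho> j \<in> S) \<noteq> (\<sigma> (\<rho> j) \<in> A))}"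
  unfolding moves_def
proof
  fix j assume j: "j \<in> {1..n}"
  then have j': "\<rho> j \<in> {1..n}" "\<sigma> (\<rho> j) \<in> {1..n}" using assms(3,4) by blast+
  \<comment> \<open>A conditional sign that commutes with multiplication on either side; it spares
    the case distinction over the three signs until the end.\<close>
  define e where "e A j r = (if j \<in> A then - r else r)" for A :: "nat set" and j and r :: 'r
  have e: "z * e A j r = e A j (z * r)" "e A j r * z = e A j (r * z)" for A j z r
    by (simp_all add: e_def)
  have "\<Phi> g * \<eta> j = e A j (\<eta> (\<rho> j) * \<Phi> g)" "\<Phi> h * \<eta> (\<rho> j) = e S (\<rho> j) (\<eta> (\<sigma> (\<rho> j)) * \<Phi> h)"
    "\<Phi> g * \<eta> (\<sigma> (\<rho> j)) = e A (\<sigma> (\<rho> j)) (\<eta> (\<rho> (\<sigma> (\<rho> j))) * \<Phi> g)"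
    using j j' assms(1,2) unfolding moves_def e_def by blast+
  then have "\<Phi> (g * h * g) * \<eta> j =
      e A j (e S (\<rho> j) (e A (\<sigma> (\<rho> j)) (\<eta> (\<rho> (\<sigma> (\<rho> j))) * \<Phi> (g * h * g))))"
    by (simp add: \<Phi>_mult e mult.assoc) (simp add: e flip: mult.assoc)
  moreover have "\<Phi> g * \<xi> j = - (\<xi> (\<rho> j) * \<Phi> g)" "\<Phi> h * \<xi> (\<rho> j) = - (\<xi> (\<sigma> (\<rho> j)) * \<Phi> h)"
    "\<Phi> g * \<xi> (\<sigma> (\<rho> j)) = - (\<xi> (\<rho> (\<sigma> (\<rho> j))) * \<Phi> g)"
    using j j' assms(1,2) unfolding moves_def by blast+
  then have "\<Phi> (g * h * g) * \<xi> j = - (\<xi> (\<rho> (\<sigma> (\<rho> j))) * \<Phi> (g * h * g))"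
    by (simp add: \<Phi>_mult mult.assoc) (simp flip: mult.assoc)
  ultimately show "\<Phi> (g * h * g) * \<eta> j =
       (if j \<in> {j. (j \<in> A) \<noteq> ((\<rho> j \<in> S) \<noteq> (\<sigma> (\<rho> j) \<in> A))}
        then - (\<eta> ((\<rho> \<circ> \<sigma> \<circ> \<rho>) j) * \<Phi> (g * h * g))
        else \<eta> ((\<rho> \<circ> \<sigma> \<circ> \<rho>) j) * \<Phi> (g * h * g)) \<and>
    \<Phi> (g * h * g) * \<xi> j = - (\<xi> ((\<rho> \<circ> \<sigma> \<circ> \<rho>) j) * \<Phi> (g * h * g))"
    by (auto simp: e_def)
qed

lemma transpose_conj:
  "transpose k l \<circ> transpose a b \<circ> transpose k l =
    transpose (transpose k l a) (transpose k l b)"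
  by (auto simp: transpose_def)

lemma transpose_image: "a \<in> {1..n} \<Longrightarrow> b \<in> {1..n} \<Longrightarrow> transpose a b ` {1..n} \<subseteq> {1..n}"
  by (auto simp: transpose_def)

lemma transpose_vimage: "{j. transpose k l j \<in> S} = transpose k l ` S"
  by (auto simp: image_iff intro!: bexI[of _ "transpose k l _"])

lemma moves_conj_\<tau>:
  assumes "k \<in> {1..<n}" "moves h (transpose a b) S" "a \<in> {1..n}" "b \<in> {1..n}"
  shows "moves (tg k * h * tg k) (transpose (transpose k (k + 1) a) (transpose k (k + 1) b))
    (transpose k (k + 1) ` S)"
  using moves_conj[OF moves_\<tau>[OF assms(1)] assms(2) transpose_image transpose_image] assms
  by (simp add: transpose_conj transpose_vimage)

section \<open>Brackets as iterated conjugates of generators\<close>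

lemma t_up_Suc: "i \<le> Suc j \<Longrightarrow> t_up i (Suc j) = t_up i j * tg (Suc j)"
  and t_down_Suc: "i \<le> Suc j \<Longrightarrow> t_down (Suc j) i = tg (Suc j) * t_down j i"
  and t_up_rec: "i \<le> j \<Longrightarrow> t_up i j = tg i * t_up (Suc i) j"
  and t_down_rec: "i \<le> j \<Longrightarrow> t_down j i = t_down j (Suc i) * tg i"
  and t_up_empty: "j < i \<Longrightarrow> t_up i j = 1"
  and t_down_empty: "j < i \<Longrightarrow> t_down j i = 1"
  unfolding t_up_def t_down_def by (simp_all add: upt_rec[of i] del: upt_Suc) (simp_all add: upt_Suc mult.assoc)

lemma br_less_base: "\<Phi> (br_less i (Suc i)) = \<tau> i"
  by (simp add: br_less_def t_up_empty t_down_empty)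

lemma br_less_Suc:
  assumes "i < j" shows "\<Phi> (br_less i (Suc j)) = - (\<tau> j * \<Phi> (br_less i j) * \<tau> j)"
proof -
  \<comment> \<open>With this form of \<open>j\<close>, the exponents \<open>j - i - 1\<close> and
    \<open>Suc j - i - 1\<close> of the signs become \<open>k\<close> and \<open>Suc k\<close>,
    whose parities differ.\<close>
  obtain k where j: "j = Suc (i + k)" using assms less_iff_Suc_add by blast
  show ?thesis
    by (cases "even k") (simp_all add: j br_less_def t_up_Suc t_down_Suc \<Phi>_mult \<Phi>_minus mult.assoc)
qed

lemma moves_br_less:
  assumes "1 \<le> i" "i < j" "j \<le> n"
  shows "moves (br_less i j) (transpose i j) {}"
proof -
  have "Suc i \<le> j" using assms by simp
  then show ?thesis using \<open>j \<le> n\<close>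
  proof (induct j rule: dec_induct)
    case base
    then show ?case using moves_\<Phi>[OF moves_\<tau>[of i]] assms by (simp add: br_less_base)
  next
    case (step m)
    have "moves (- (tg m * br_less i m * tg m)) (transpose i (Suc m)) {}"
      using moves_minus[OF moves_conj_\<tau>[of m "br_less i m" i m "{}"]] step assms
      by (simp add: transpose_apply_other)
    then show ?case by (rule moves_\<Phi>) (use step in \<open>simp add: br_less_Suc \<Phi>_simps\<close>)
  qed
qed

lemma moves_br: "i \<in> {1..n} \<Longrightarrow> j \<in> {1..n} \<Longrightarrow> i \<noteq> j \<Longrightarrow> moves (br i j) (transpose i j) {}"
  using moves_br_less[of i j] moves_br_less[of j i]
  by (auto simp: br_def transpose_commute intro: moves_minus)

text \<open>The barred brackets of types B and D differ, apart from sign, only in their core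
  \<open>c\<close>, which exchanges the last two variables and negates both. The inner conjugation
  carries the index \<open>n - 1\<close> to \<open>i\<close>; the outer one, in
  \<open>moves_outer\<close>, then carries \<open>n\<close> to \<open>j\<close> and leaves
  \<open>i\<close> alone because \<open>i < j\<close>.\<close>

lemma moves_inner:
  assumes "moves c (transpose (n - 1) n) {n - 1, n}" "1 \<le> i" "i \<le> n - 1"
  shows "moves (t_up i (n - 2) * c * t_down (n - 2) i) (transpose i n) {i, n}"
  using \<open>i \<le> n - 1\<close>
proof (induct i rule: inc_induct)
  case base
  then show ?case using assms by (simp add: t_up_empty t_down_empty)
next
  case (step m)
  let ?h = "t_up (Suc m) (n - 2) * c * t_down (n - 2) (Suc m)"
  have "moves (tg m * ?h * tg m) (transpose m n) {m, n}"
    using moves_conj_\<tau>[of m ?h "Suc m" n "{Suc m, n}"] step assms by (simp add: transpose_apply_other)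
  then show ?case
    by (rule moves_\<Phi>) (use step in \<open>simp add: t_up_rec[of m] t_down_rec[of m] mult.assoc\<close>)
qed

lemma moves_outer:
  assumes "moves h (transpose i n) {i, n}" "1 \<le> i" "i < j" "j \<le> n"
  shows "moves (t_up j (n - 1) * h * t_down (n - 1) j) (transpose i j) {i, j}"
  using \<open>j \<le> n\<close>
proof (induct j rule: inc_induct)
  case base
  then show ?case using assms by (simp add: t_up_empty t_down_empty)
next
  case (step m)
  let ?h = "t_up (Suc m) (n - 1) * h * t_down (n - 1) (Suc m)"
  have "moves (tg m * ?h * tg m) (transpose i m) {i, m}"
    using moves_conj_\<tau>[of m ?h i "Suc m" "{i, Suc m}"] step assms by (simp add: transpose_apply_other)
  then show ?case
    by (rule moves_\<Phi>) (use step in \<open>simp add: t_up_rec[of m] t_down_rec[of m] mult.assoc\<close>)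
qed

lemma moves_sgn: "moves h \<sigma> S \<Longrightarrow> moves ((-1) ^ k * h) \<sigma> S"
  using moves_minus[of h \<sigma> S] by (cases "even k") simp_all

lemma moves_obarD:
  assumes "W = TypeD" "i \<in> {1..n}" "j \<in> {1..n}" "i \<noteq> j"
  shows "moves (obarD n i j) (transpose i j) {i, j}"
proof -
  have "moves (obarD_less n i j) (transpose i j) {i, j}" if "1 \<le> i" "i < j" "j \<le> n" for i j
    using moves_sgn[OF moves_outer[OF moves_inner[OF moves_\<tau>n_D]]] that assms(1)
    by (simp add: obarD_less_def mult.assoc)
  from this[of i j] this[of j i] show ?thesis
    using assms by (auto simp: obarD_def transpose_commute insert_commute)
qed

lemma moves_obarB:
  assumes "W = TypeB" "i \<in> {1..n}" "j \<in> {1..n}" "i \<noteq> j"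
  shows "moves (obarB n i j) (transpose i j) {i, j}"
proof -
  have n: "n \<ge> 2" using adm assms by simp
  have "moves (tg n * tg (n - 1) * tg n) (transpose (n - 1) n)
      {j. (j \<in> {n}) \<noteq> (transpose (n - 1) n j \<in> {n})}"
    using moves_conj[OF moves_\<tau>n_B[OF assms(1)] moves_\<tau>[of "n - 1"]] n
      transpose_image[of "n - 1" n] by simp
  also have "{j. (j \<in> {n}) \<noteq> (transpose (n - 1) n j \<in> {n})} = {n - 1, n}"
    using n by (auto simp: transpose_def)
  finally have c: "moves (tg n * tg (n - 1) * tg n) (transpose (n - 1) n) {n - 1, n}" .
  have "moves (obarB_less n i j) (transpose i j) {i, j}" if "1 \<le> i" "i < j" "j \<le> n" for i j
    using moves_sgn[OF moves_outer[OF moves_inner[OF c]]] that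
    by (simp add: obarB_less_def mult.assoc)
  from this[of i j] this[of j i] show ?thesis
    using assms by (auto simp: obarB_def transpose_commute insert_commute)
qed

lemma moves_obarB1:
  assumes "W = TypeB" "i \<in> {1..n}"
  shows "moves (obarB1 n i) id {i}"
proof -
  have "i \<le> n" using assms by simp
  then have "moves (t_up i (n - 1) * tg n * t_down (n - 1) i) id {i}"
  proof (induct i rule: inc_induct)
    case base
    then show ?case using assms moves_\<tau>n_B by (simp add: t_up_empty t_down_empty id_def)
  next
    case (step m)
    let ?h = "t_up (Suc m) (n - 1) * tg n * t_down (n - 1) (Suc m)"
    have "moves (tg m * ?h * tg m) id {m}"
      using moves_conj_\<tau>[of m ?h m m "{Suc m}"] step assms by (simp add: id_def)
    then show ?case
      by (rule moves_\<Phi>) (use step in \<open>simp add: t_up_rec[of m] t_down_rec[of m] mult.assoc\<close>)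
  qed
  then show ?thesis using moves_sgn by (simp add: obarB1_def mult.assoc)
qed

end

section \<open>Central invariants\<close>

lemma carrier_free_induct [consumes 1, case_names scal gen add mult]:
  assumes "f \<in> carrier (free_alg W n)"
    and "\<And>c. P (scal c)" "\<And>g. g \<in> gens W n \<Longrightarrow> P (gen g)"
    and "\<And>f g. P f \<Longrightarrow> P g \<Longrightarrow> P (f + g)" "\<And>f g. P f \<Longrightarrow> P g \<Longrightarrow> P (f * g)"
  shows "P f"
proof -
  have word: "P (Poly_Mapping.single (FWord l) c)" if "set l \<subseteq> gens W n" for l c
    using that
  proof (induct l)
    case Nil
    then show ?case using assms(2)[of c] by (simp add: scal_def zero_fword_def)
  next
    case (Cons g l)
    have "Poly_Mapping.single (FWord (g # l)) c = gen g * Poly_Mapping.single (FWord l) c"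
      by (simp add: gen_def mult_single plus_fword_def)
    then show ?case using Cons assms by simp
  qed
  have "P (\<Sum>w\<in>K. Poly_Mapping.single w (Poly_Mapping.lookup f w))"
    if "finite K" "K \<subseteq> Poly_Mapping.keys f" for K
    using that
  proof (induct K)
    case empty
    then show ?case using assms(2)[of 0] by (simp add: scal_0)
  next
    case (insert w K)
    have "set (letters w) \<subseteq> gens W n" using insert assms(1) by (auto simp: free_alg_def)
    then have "P (Poly_Mapping.single w (Poly_Mapping.lookup f w))" using word[of "letters w"] by simp
    then show ?case using insert assms(4) by simp
  qed
  moreover have "f = (\<Sum>w\<in>Poly_Mapping.keys f. Poly_Mapping.single w (Poly_Mapping.lookup f w))"
    by (rule poly_mapping_eqI)
      (auto simp: lookup_sum lookup_single when_def sum.delta in_keys_iff)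
  ultimately show ?thesis by (metis finite_keys order_refl)
qed

text \<open>A reflection that a type lacks is set to 0. Since 0 satisfies \<open>moves\<close> for
  every signed permutation, one commutator formula then serves all three types.\<close>

fun obar :: "weyl_type \<Rightarrow> nat \<Rightarrow> nat \<Rightarrow> nat \<Rightarrow> free" where
  "obar TypeA n i j = 0"
| "obar TypeB n i j = obarB n i j"
| "obar TypeD n i j = obarD n i j"

fun obar1 :: "weyl_type \<Rightarrow> nat \<Rightarrow> nat \<Rightarrow> free" where
  "obar1 TypeB n i = obarB1 n i"
| "obar1 _ n i = 0"

lemma commute_prod:
  fixes a b z :: "'a::semigroup_mult"
  shows "z * a = a * z \<Longrightarrow> z * b = b * z \<Longrightarrow> z * (a * b) = a * b * z"
  by (metis mult.assoc)

lemma twist_prod: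
  fixes a b x y :: "'a::semigroup_mult"
  shows "b * x = y * b \<Longrightarrow> a * y = y * a \<Longrightarrow> a * b * x = y * (a * b)"
  by (metis mult.assoc)

context rsd_hom
begin

abbreviation bar :: "nat \<Rightarrow> nat \<Rightarrow> free" where "bar \<equiv> obar W n"
abbreviation sing :: "nat \<Rightarrow> free" where "sing \<equiv> obar1 W n"

lemma bar_commute: "bar i j = bar j i"
  by (cases W; cases i j rule: linorder_cases) (simp_all add: obarB_def obarD_def)

lemma br_swap: "i \<noteq> j \<Longrightarrow> br j i = - br i j"
  by (auto simp: br_def)

lemma moves_bar: "i \<in> {1..n} \<Longrightarrow> j \<in> {1..n} \<Longrightarrow> i \<noteq> j \<Longrightarrow> moves (bar i j) (transpose i j) {i, j}"
  using moves_obarB moves_obarD moves_0 by (cases W) simp_all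

lemma moves_sing: "i \<in> {1..n} \<Longrightarrow> moves (sing i) id {i}"
  using moves_obarB1 moves_0 by (cases W) simp_all

lemma y_xi_commutator:
  assumes "i \<in> {1..n}" "j \<in> {1..n}" "i \<noteq> j"
  shows "\<eta> j * \<xi> i - \<xi> i * \<eta> j = \<kappa> u * (\<Phi> (bar i j) - \<Phi> (br i j))"
  using \<Phi>_rel[OF y_xi_A[OF _ assms]] \<Phi>_rel[OF y_xi_B[OF _ assms]] \<Phi>_rel[OF y_xi_D[OF _ assms]]
  by (cases W) (simp_all add: comm_def \<Phi>_simps algebra_simps)

lemma y_xi_commutator_same:
  assumes "i \<in> {1..n}"
  shows "\<eta> i * \<xi> i - \<xi> i * \<eta> i =
    \<kappa> u * (\<Sum>k\<in>{1..n} - {i}. \<Phi> (br i k) + \<Phi> (bar i k)) + \<kappa> v * \<Phi> (sing i)"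
  using \<Phi>_rel[OF y_xi_same_A[OF _ assms]] \<Phi>_rel[OF y_xi_same_B[OF _ assms]]
    \<Phi>_rel[OF y_xi_same_D[OF _ assms]]
  by (cases W) (simp_all add: comm_def \<Phi>_simps)

section \<open>Evaluation of polynomials in the algebra\<close>

definition ev :: "(nat \<Rightarrow> free) \<Rightarrow> cpoly \<Rightarrow> 'r"
  where "ev z p = \<Phi> (eval_at n z p)"

lemma ev_eq_lin_ext:
  "ev z = lin_ext \<kappa> (\<lambda>m. \<Phi> (prod_list (map (\<lambda>i. z i ^ Poly_Mapping.lookup m i) [1..<Suc n])))"
  by (rule ext) (simp only: ev_def eval_at_def lin_ext_def \<Phi>_sum \<Phi>_mult)

lemma \<kappa>_hom: "\<kappa> 0 = 0" "\<kappa> (a + b) = \<kappa> a + \<kappa> b" "\<kappa> (a * b) = \<kappa> a * \<kappa> b"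
  by (simp_all add: scal_0 scal_add scal_mult \<Phi>_0 \<Phi>_add \<Phi>_mult)

lemma ev_add: "ev z (p + q) = ev z p + ev z q"
  unfolding ev_eq_lin_ext by (rule lin_ext_add) (simp_all add: \<kappa>_hom)

lemma ev_Cst: "ev z (Cst c) = \<kappa> c"
proof -
  have "prod_list (map (\<lambda>i. z i ^ 0) l) = 1" for l by (induct l) auto
  then show ?thesis by (simp add: ev_eq_lin_ext lin_ext_single \<kappa>_hom \<Phi>_1_right del: upt_Suc)
qed

lemma ev_0: "ev z 0 = 0" and ev_1: "ev z 1 = \<Phi> 1"
  using ev_Cst[of z 0] ev_Cst[of z 1] by (simp_all add: scal_0 scal_1 \<Phi>_0)

lemma ev_minus: "ev z (- p) = - ev z p"
  using ev_add[of z p "- p"] by (simp add: ev_0 eq_neg_iff_add_eq_0 add.commute)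

text \<open>A variable outside the range does not occur in the ordered product and thus becomes the
  unit. With this default, arguments that go variable by variable work on all of
  \<open>cpoly\<close>.\<close>

lemma ev_var: "ev z (var i) = (if i \<in> {1..n} then \<Phi> (z i) else \<Phi> 1)"
proof -
  have "prod_list (map (\<lambda>j. z j ^ Poly_Mapping.lookup (Poly_Mapping.single i 1) j) l) =
    (if i \<in> set l then z i else 1)" if "distinct l" for l
    using that by (induct l) (auto simp: lookup_single when_def)
  from this[of "[1..<Suc n]"] show ?thesis
    by (auto simp: ev_eq_lin_ext var_def lin_ext_single \<kappa>_hom scal_1 \<Phi>_1_left simp del: upt_Suc)
qed

lemma commute_mult: "\<Phi> a * \<Phi> b = \<Phi> b * \<Phi> a \<Longrightarrow> \<Phi> a * \<Phi> c = \<Phi> c * \<Phi> a \<Longrightarrow>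
    \<Phi> a * \<Phi> (b * c) = \<Phi> (b * c) * \<Phi> a"
  by (metis \<Phi>_mult mult.assoc)

lemma commute_power: "\<Phi> a * \<Phi> b = \<Phi> b * \<Phi> a \<Longrightarrow> \<Phi> a * \<Phi> (b ^ k) = \<Phi> (b ^ k) * \<Phi> a"
  by (induct k) (auto simp: \<Phi>_1_left \<Phi>_1_right intro: commute_mult)

text \<open>\<open>eval_at\<close> multiplies in the order of the indices. Commutation of the
  \<open>z i\<close> is needed to move a power of one of them past the later factors of the other
  monomial.\<close>

lemma ev_mult:
  assumes com: "\<And>i j. i \<in> {1..n} \<Longrightarrow> j \<in> {1..n} \<Longrightarrow> \<Phi> (z i) * \<Phi> (z j) = \<Phi> (z j) * \<Phi> (z i)"
  shows "ev z (p * q) = ev z p * ev z q"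
  unfolding ev_eq_lin_ext
proof (rule lin_ext_mult)
  fix k m :: "nat \<Rightarrow>\<^sub>0 nat"
  let ?P = "\<lambda>m l. prod_list (map (\<lambda>i. z i ^ Poly_Mapping.lookup m i) l)"
  have *: "\<Phi> (?P (k + m) l) = \<Phi> (?P k l) * \<Phi> (?P m l)" if "set l \<subseteq> {1..n}" for l
    using that
  proof (induct l)
    case (Cons i l)
    have "\<Phi> (z i) * \<Phi> (?P k l) = \<Phi> (?P k l) * \<Phi> (z i)" if "set l \<subseteq> {1..n}" for l
      using that
      by (induct l) (use Cons.prems in \<open>auto simp: \<Phi>_1_left \<Phi>_1_right intro!: commute_mult commute_power com\<close>)
    then have "\<Phi> (z i ^ Poly_Mapping.lookup m i) * \<Phi> (?P k l) =
        \<Phi> (?P k l) * \<Phi> (z i ^ Poly_Mapping.lookup m i)"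
      using Cons.prems commute_power[of "?P k l" "z i"] by simp
    then have "\<Phi> (z i ^ Poly_Mapping.lookup m i) * (\<Phi> (?P k l) * r) =
        \<Phi> (?P k l) * (\<Phi> (z i ^ Poly_Mapping.lookup m i) * r)" for r
      by (simp flip: mult.assoc)
    then show ?case using Cons by (simp add: lookup_add power_add \<Phi>_mult mult.assoc)
  qed (simp add: \<Phi>_1_left)
  show "\<Phi> (?P (k + m) [1..<Suc n]) = \<Phi> (?P k [1..<Suc n]) * \<Phi> (?P m [1..<Suc n])"
    by (rule *) auto
qed (rule \<kappa>_hom \<kappa>_central[symmetric])+

abbreviation xg2 :: "nat \<Rightarrow> free" where "xg2 i \<equiv> xg i ^ 2"

lemma y_commute: "i \<in> {1..n} \<Longrightarrow> j \<in> {1..n} \<Longrightarrow> \<eta> i * \<eta> j = \<eta> j * \<eta> i"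
  by (metis \<Phi>_rel[OF y_y] \<Phi>_mult)

lemma xi_anticommute: "i \<in> {1..n} \<Longrightarrow> j \<in> {1..n} \<Longrightarrow> i \<noteq> j \<Longrightarrow> \<xi> i * \<xi> j = - (\<xi> j * \<xi> i)"
  by (metis \<Phi>_rel[OF xi_xi] \<Phi>_mult \<Phi>_minus)

lemma xi_xi2_commute:
  assumes "i \<in> {1..n}" "j \<in> {1..n}"
  shows "\<xi> i * \<Phi> (xg2 j) = \<Phi> (xg2 j) * \<xi> i"
proof (cases "i = j")
  case False
  note ij = xi_anticommute[OF assms False]
  have "\<xi> i * (\<xi> j * \<xi> j) = \<xi> i * \<xi> j * \<xi> j" by (simp only: mult.assoc)
  also have "\<dots> = - (\<xi> j * (\<xi> i * \<xi> j))" by (subst ij) (simp add: mult.assoc)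
  also have "\<dots> = \<xi> j * \<xi> j * \<xi> i" by (subst ij) (simp add: mult.assoc)
  finally show ?thesis by (simp add: power2_eq_square \<Phi>_mult)
qed (simp add: power2_eq_square \<Phi>_mult mult.assoc)

lemma xi2_commute: "i \<in> {1..n} \<Longrightarrow> j \<in> {1..n} \<Longrightarrow> \<Phi> (xg2 i) * \<Phi> (xg2 j) = \<Phi> (xg2 j) * \<Phi> (xg2 i)"
  using commute_power[of "xg2 j" "xg i" 2] by (simp add: xi_xi2_commute)

lemma ev_y_mult: "ev yg (p * q) = ev yg p * ev yg q"
  by (rule ev_mult) (rule y_commute)

lemma ev_xi_mult: "ev xg2 (p * q) = ev xg2 p * ev xg2 q"
  by (rule ev_mult) (rule xi2_commute)

lemma moves_ev_y:
  assumes "moves h \<sigma> S" "\<sigma> permutes {1..n}" "S \<subseteq> {1..n}"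
  shows "\<Phi> h * ev yg p = ev yg (subst (act_y (\<sigma>, S)) p) * \<Phi> h"
proof (rule twisted_commute)
  fix j show "\<Phi> h * ev yg (var j) = ev yg (act_y (\<sigma>, S) j) * \<Phi> h"
  proof (cases "j \<in> {1..n}")
    case True
    then have "\<sigma> j \<in> {1..n}" using permutes_in_image[OF assms(2)] by blast
    with True show ?thesis using assms(1) by (simp add: ev_var ev_minus moves_def)
  next
    case False
    then have "\<sigma> j = j" "j \<notin> S" using assms(2,3) by (auto dest: permutes_not_in)
    with False show ?thesis by (auto simp: ev_var \<Phi>_1_left \<Phi>_1_right)
  qed
qed (simp_all add: ev_add ev_y_mult ev_Cst \<kappa>_central)

lemma moves_ev_xi:
  assumes "moves h \<sigma> S" "\<sigma> permutes {1..n}"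
  shows "\<Phi> h * ev xg2 p = ev xg2 (subst (act_xi_sq (\<sigma>, S)) p) * \<Phi> h"
proof (rule twisted_commute)
  fix j show "\<Phi> h * ev xg2 (var j) = ev xg2 (act_xi_sq (\<sigma>, S) j) * \<Phi> h"
  proof (cases "j \<in> {1..n}")
    case True
    then have "\<sigma> j \<in> {1..n}" using permutes_in_image[OF assms(2)] by blast
    moreover have "\<Phi> h * \<xi> j = - (\<xi> (\<sigma> j) * \<Phi> h)" using assms(1) True by (simp add: moves_def)
    then have "\<Phi> h * (\<xi> j * \<xi> j) = \<xi> (\<sigma> j) * \<xi> (\<sigma> j) * \<Phi> h"
      by (simp flip: mult.assoc) (simp add: mult.assoc)
    ultimately show ?thesis using True by (simp add: ev_var power2_eq_square \<Phi>_mult)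
  next
    case False
    then have "\<sigma> j = j" using assms(2) by (auto dest: permutes_not_in)
    with False show ?thesis by (auto simp: ev_var \<Phi>_1_left \<Phi>_1_right)
  qed
qed (simp_all add: ev_add ev_xi_mult ev_Cst \<kappa>_central)

lemma \<Phi>_1_left_\<kappa>: "\<Phi> 1 * (\<Phi> a * z) = \<Phi> a * z"
  by (metis \<Phi>_1_left mult.assoc)

lemma xi_ev_commute: "i \<in> {1..n} \<Longrightarrow> \<xi> i * ev xg2 p = ev xg2 p * \<xi> i"
proof (induct p rule: cpoly_induct)
  case (mult p q)
  then show ?case unfolding ev_xi_mult by (intro commute_prod)
qed (simp_all add: ev_add ev_Cst ev_var \<kappa>_central \<Phi>_1_left \<Phi>_1_right xi_xi2_commute distrib_left distrib_right)

lemma t_weyl: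
  assumes "k \<in> t_index W n"
  obtains \<sigma> S where "moves (tg k) \<sigma> S" "(\<sigma>, S) \<in> weyl W n" "\<sigma> permutes {1..n}" "S \<subseteq> {1..n}"
proof -
  note wit = that
  have less: thesis if "k \<in> {1..<n}"
  proof (rule wit)
    show "moves (tg k) (transpose k (k + 1)) {}" using moves_\<tau> that by blast
    show "transpose k (k + 1) permutes {1..n}" using that by (intro permutes_swap_id) auto
    then show "(transpose k (k + 1), {}) \<in> weyl W n" by (cases W) auto
  qed simp
  show thesis
  proof (cases W)
    case TypeA
    then show ?thesis using assms less by simp
  next
    case TypeB
    show ?thesis
    proof (cases "k = n")
      case True
      show ?thesis using wit[of id "{n}"] moves_\<tau>n_B True TypeB adm by (auto simp: permutes_id)
    qed (use assms TypeB less in auto)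
  next
    case TypeD
    show ?thesis
    proof (cases "k = n")
      case True
      have "transpose (n - 1) n permutes {1..n}" "n - 1 \<noteq> n"
        using TypeD adm by (auto intro!: permutes_swap_id)
      then show ?thesis
        using wit[of "transpose (n - 1) n" "{n - 1, n}"] moves_\<tau>n_D True TypeD adm by auto
    qed (use assms TypeD less in auto)
  qed
qed

lemma commute_carrier:
  assumes "f \<in> carrier (free_alg W n)"
    and "\<And>g. g \<in> gens W n \<Longrightarrow> z * \<Phi> (gen g) = \<Phi> (gen g) * z" "\<And>c. z * \<kappa> c = \<kappa> c * z"
  shows "z * \<Phi> f = \<Phi> f * z"
  using assms(1)
proof (induct f rule: carrier_free_induct)
  case (mult f g)
  then show ?case by (metis \<Phi>_mult mult.assoc)
qed (simp_all add: assms \<Phi>_add distrib_left distrib_right)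

lemma transpose_weyl:
  assumes "i \<in> {1..n}" "j \<in> {1..n}"
  shows "(transpose i j, {}) \<in> weyl W n"
    "i \<noteq> j \<Longrightarrow> W \<noteq> TypeA \<Longrightarrow> (transpose i j, {i, j}) \<in> weyl W n"
    "W = TypeB \<Longrightarrow> (id, {i}) \<in> weyl W n"
  using assms by (cases W; auto intro: permutes_swap_id permutes_id)+

lemma \<kappa>_twist: "\<Phi> h * \<Phi> a = \<Phi> b * \<Phi> h \<Longrightarrow> \<kappa> c * \<Phi> h * \<Phi> a = \<Phi> b * (\<kappa> c * \<Phi> h)"
  by (metis \<kappa>_central mult.assoc)

section \<open>Commutators of invariants with the opposite variables\<close>

lemma y_invariant_xi_commute:
  assumes p: "p \<in> invariants W n act_y" and i: "i \<in> {1..n}"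
  shows "ev yg p * \<xi> i = \<xi> i * ev yg p"
proof -
  \<comment> \<open>The reflections in the commutator with \<open>\<xi> i\<close> are indexed by
    pairs: for \<open>k \<noteq> i\<close> the flag \<open>b\<close> selects the bracket of
    \<open>i\<close> and \<open>k\<close> or its barred form, \<open>(i, True)\<close> is the barred
    \<open>[i]\<close> with coefficient \<open>v\<close>, and \<open>(i, False)\<close> is padding
    with \<open>\<rho> = 0\<close>. Here \<open>?\<alpha>\<close> is a root that the reflection
    negates, and \<open>?d j\<close> is the divided difference of the \<open>j\<close>-th
    variable.\<close>
  let ?w = "\<lambda>(k, b). if k \<noteq> i then (transpose i k, if b then {i, k} else {}) else (id, {i})"
  let ?\<rho> = "\<lambda>(k, b). if k \<noteq> i then \<kappa> u * \<Phi> (if b then bar i k else br i k)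
    else if b then \<kappa> v * \<Phi> (sing i) else 0"
  let ?\<alpha> = "\<lambda>(k, b). if k \<noteq> i then (if b then var i + var k else var i - var k) else var i + var i"
  let ?d = "\<lambda>j (k, b). if j = i then 1 else if k = i \<or> j \<noteq> k then 0 else if b then 1 else - 1"
  show ?thesis
  proof (rule invariant_commute[where R = "{1..n} \<times> UNIV" and f = "act_y \<circ> ?w" and \<rho> = ?\<rho> and \<alpha> = ?\<alpha>])
    fix s :: "nat \<times> bool" and q assume s: "s \<in> {1..n} \<times> UNIV"
    obtain k b where kb: "s = (k, b)" by (cases s)
    have k: "k \<in> {1..n}" using s kb by simp
    have "\<exists>c h. ?\<rho> s = \<kappa> c * \<Phi> h \<and> moves h (fst (?w s)) (snd (?w s))"
    proof (cases "k = i")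
      case True
      show ?thesis
      proof (cases b)
        case True
        then show ?thesis using \<open>k = i\<close> moves_sing[OF i] by (auto simp: kb)
      next
        case False
        have "0 = \<kappa> v * \<Phi> 0" by (simp add: \<Phi>_0)
        then show ?thesis using \<open>k = i\<close> False moves_0 by (auto simp: kb)
      qed
    next
      case False
      then show ?thesis using moves_bar[OF i k] moves_br[OF i k] by (auto simp: kb)
    qed
    then obtain c h where h: "?\<rho> s = \<kappa> c * \<Phi> h" "moves h (fst (?w s)) (snd (?w s))" by blast
    have "fst (?w s) permutes {1..n}" "snd (?w s) \<subseteq> {1..n}"
      using i k by (auto simp: kb intro!: permutes_swap_id permutes_id)
    from \<kappa>_twist[OF moves_ev_y[OF h(2) this, of q, unfolded ev_def], of c] show "?\<rho> s * ev yg q = ev yg (subst ((act_y \<circ> ?w) s) q) * ?\<rho> s"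
      unfolding h(1) o_def by (simp add: ev_def)
    show "?\<alpha> s \<noteq> 0"
      using var_diff_nonzero[of i k] var_add_nonzero[of i k] var_double_nonzero[of i] by (auto simp: kb)
    have "?\<rho> s = 0 \<or> ?w s \<in> weyl W n"
      using transpose_weyl[OF i k] by (cases W) (auto simp: kb \<Phi>_0)
    then show "?\<rho> s = 0 \<or> subst ((act_y \<circ> ?w) s) p = p"
      using p by (auto simp: invariants_def)
  next
    fix j
    have "var j - (act_y \<circ> ?w) s j = ?\<alpha> s * ?d j s" for s
      by (cases s) (auto simp: transpose_def)
    moreover have "ev yg (var j) * \<xi> i - \<xi> i * ev yg (var j) =
      (\<Sum>s\<in>{1..n} \<times> UNIV. ev yg (?d j s) * ?\<rho> s)"
    proof -
      have "(\<Sum>s\<in>{1..n} \<times> UNIV. ev yg (?d j s) * ?\<rho> s) =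
          (\<Sum>k\<in>{1..n}. ev yg (?d j (k, False)) * ?\<rho> (k, False) + ev yg (?d j (k, True)) * ?\<rho> (k, True))"
        by (simp add: UNIV_bool add.commute sum.cartesian_product')
      also have "\<dots> = ev yg (var j) * \<xi> i - \<xi> i * ev yg (var j)"
      proof (cases "j = i")
        case True
        have "ev yg (var j) * \<xi> i - \<xi> i * ev yg (var j) = \<kappa> v * \<Phi> (sing i) +
            (\<Sum>k\<in>{1..n} - {i}. \<kappa> u * \<Phi> (br i k) + \<kappa> u * \<Phi> (bar i k))"
          using y_xi_commutator_same[OF i] True i
          by (simp add: ev_var sum_distrib_left distrib_left)
        then show ?thesis using i True
          by (subst sum.remove[OF _ i]) (auto simp: ev_1 \<Phi>_1_left simp flip: \<Phi>_mult intro!: sum.cong)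
      next
        case False
        have "(\<Sum>k\<in>{1..n}. ev yg (?d j (k, False)) * ?\<rho> (k, False) + ev yg (?d j (k, True)) * ?\<rho> (k, True)) =
            (\<Sum>k\<in>{1..n}. if k = j then \<kappa> u * (\<Phi> (bar i j) - \<Phi> (br i j)) else 0)"
          using False
          by (intro sum.cong) (auto simp: ev_1 ev_0 ev_minus algebra_simps \<Phi>_1_left simp flip: \<Phi>_mult)
        also have "\<dots> = ev yg (var j) * \<xi> i - \<xi> i * ev yg (var j)"
          using y_xi_commutator[OF i _ not_sym[OF False]] by (auto simp: ev_var \<Phi>_1_left \<Phi>_1_right)
        finally show ?thesis .
      qed
      finally show ?thesis by simp
    qed
    ultimately show "\<exists>d. (\<forall>s\<in>{1..n} \<times> UNIV. var j - (act_y \<circ> ?w) s j = ?\<alpha> s * d s) \<and>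
        ev yg (var j) * \<xi> i - \<xi> i * ev yg (var j) = (\<Sum>s\<in>{1..n} \<times> UNIV. ev yg (d s) * ?\<rho> s)"
      by (intro exI[of _ "?d j"]) blast
  qed (simp_all add: ev_add ev_y_mult ev_Cst \<kappa>_central)
qed

text \<open>Barred and unbarred reflections act alike on the squares and enter through their sum, so
  one index \<open>k\<close> suffices. The factor \<open>\<xi> j - \<xi> k\<close> arises when a
  \<open>\<xi>\<close> is pulled across the reflection in the Leibniz rule for a square. It commutes
  with polynomials in the squares, so \<open>?\<rho> k\<close> still twists them like a
  transposition.\<close>

lemma xi_sq_invariant_y_commute:
  assumes p: "p \<in> invariants W n act_xi_sq" and j: "j \<in> {1..n}"
  shows "ev xg2 p * \<eta> j = \<eta> j * ev xg2 p"
proof -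
  let ?b = "\<lambda>k. br j k + bar j k"
  let ?\<rho> = "\<lambda>k. - (\<kappa> u * ((\<xi> j - \<xi> k) * \<Phi> (?b k)))"
  let ?f = "\<lambda>k. act_xi_sq (transpose j k, {})"
  let ?d = "\<lambda>l k. if l = j then 1 else if l = k then - 1 else 0"
  have moves_xi: "\<Phi> (?b k) * \<xi> l = - (\<xi> (transpose j k l) * \<Phi> (?b k))"
    if "k \<in> {1..n} - {j}" "l \<in> {1..n}" for k l
    using moves_br[OF j, of k] moves_bar[OF j, of k] that
    by (auto simp: moves_def \<Phi>_add distrib_left distrib_right)
  show ?thesis
  proof (rule invariant_commute[where R = "{1..n} - {j}" and f = ?f and \<rho> = ?\<rho>
        and \<alpha> = "\<lambda>k. var j - var k"])
    fix k q assume k: "k \<in> {1..n} - {j}"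
    let ?e = "ev xg2 (subst (?f k) q)"
    have perm: "transpose j k permutes {1..n}" using j k by (auto intro!: permutes_swap_id)
    have "act_xi_sq (transpose j k, {j, k}) = ?f k"
      by (rule ext) simp
    then have "\<Phi> (br j k) * ev xg2 q = ?e * \<Phi> (br j k)"
      "\<Phi> (bar j k) * ev xg2 q = ?e * \<Phi> (bar j k)"
      using moves_ev_xi[OF moves_br perm, OF j, of q] moves_ev_xi[OF moves_bar perm, OF j, of q] k
      by force+
    then have "\<Phi> (?b k) * ev xg2 q = ?e * \<Phi> (?b k)"
      by (simp only: \<Phi>_add distrib_left distrib_right)
    moreover have "(\<xi> j - \<xi> k) * ?e = ?e * (\<xi> j - \<xi> k)"
      using xi_ev_commute[OF j] xi_ev_commute[of k] k by (simp add: left_diff_distrib right_diff_distrib)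
    ultimately have "(\<xi> j - \<xi> k) * \<Phi> (?b k) * ev xg2 q = ?e * ((\<xi> j - \<xi> k) * \<Phi> (?b k))"
      by (rule twist_prod)
    then have "\<Phi> ((xg j - xg k) * ?b k) * \<Phi> (eval_at n xg2 q) =
        \<Phi> (eval_at n xg2 (subst (?f k) q)) * \<Phi> ((xg j - xg k) * ?b k)"
      by (simp add: ev_def \<Phi>_mult \<Phi>_diff)
    from \<kappa>_twist[OF this, of u] show "?\<rho> k * ev xg2 q = ?e * ?\<rho> k"
      by (simp add: ev_def \<Phi>_mult \<Phi>_diff)
    show "var j - var k \<noteq> 0" using k var_diff_nonzero[of j k] by auto
    show "?\<rho> k = 0 \<or> subst (?f k) p = p"
      using p transpose_weyl(1)[OF j, of k] k by (auto simp: invariants_def)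
  next
    fix l
    have "var l - ?f k l = (var j - var k) * ?d l k" for k
      by (auto simp: transpose_def)
    moreover have "ev xg2 (var l) * \<eta> j - \<eta> j * ev xg2 (var l) =
      (\<Sum>k\<in>{1..n} - {j}. ev xg2 (?d l k) * ?\<rho> k)"
    proof -
      consider "l = j" | "l \<in> {1..n}" "l \<noteq> j" | "l \<notin> {1..n}" by blast
      then show ?thesis
      proof cases
        case 1
        let ?S = "\<Sum>k\<in>{1..n} - {j}. \<Phi> (?b k)"
        have c: "\<eta> j * \<xi> j - \<xi> j * \<eta> j = \<kappa> u * ?S + \<kappa> v * \<Phi> (sing j)"
          using y_xi_commutator_same[OF j] by (simp add: \<Phi>_add)
        \<comment> \<open>Because of this sign the two contributions of the barred
          \<open>[j]\<close> to the commutator with the square of \<open>\<xi> j\<close> cancel, and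
          \<open>v\<close> disappears.\<close>
        have s: "\<Phi> (sing j) * \<xi> j = - (\<xi> j * \<Phi> (sing j))"
          using moves_sing[OF j] j by (simp add: moves_def)
        have "ev xg2 (var l) * \<eta> j - \<eta> j * ev xg2 (var l) =
            - (\<xi> j * (\<eta> j * \<xi> j - \<xi> j * \<eta> j)) - (\<eta> j * \<xi> j - \<xi> j * \<eta> j) * \<xi> j"
          using 1 j by (simp add: ev_var power2_eq_square \<Phi>_mult algebra_simps)
        also have "\<dots> = - (\<xi> j * \<kappa> u * ?S) - \<xi> j * \<kappa> v * \<Phi> (sing j)
            - (\<kappa> u * (?S * \<xi> j) + \<kappa> v * (\<Phi> (sing j) * \<xi> j))"
          unfolding c by (simp add: algebra_simps)
        also have "\<dots> = - (\<kappa> u * (\<xi> j * ?S)) - \<kappa> u * (?S * \<xi> j)"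
          unfolding s \<kappa>_central[symmetric] by (simp add: algebra_simps)
        also have "\<dots> = (\<Sum>k\<in>{1..n} - {j}. - (\<kappa> u * (\<xi> j * \<Phi> (?b k))) - \<kappa> u * (\<Phi> (?b k) * \<xi> j))"
          by (simp add: sum_distrib_left sum_distrib_right sum_negf sum_subtractf)
        also have "\<dots> = (\<Sum>k\<in>{1..n} - {j}. ev xg2 (?d l k) * ?\<rho> k)"
        proof (intro sum.cong refl)
          fix k assume "k \<in> {1..n} - {j}"
          then have "\<Phi> (?b k) * \<xi> j = - (\<xi> k * \<Phi> (?b k))" using moves_xi[of k j] j by simp
          then show "- (\<kappa> u * (\<xi> j * \<Phi> (?b k))) - \<kappa> u * (\<Phi> (?b k) * \<xi> j) = ev xg2 (?d l k) * ?\<rho> k"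
            using 1 by (simp add: ev_1 \<Phi>_1_left_\<kappa> left_diff_distrib right_diff_distrib)
        qed
        finally show ?thesis .
      next
        case 2
        have c: "\<eta> j * \<xi> l - \<xi> l * \<eta> j = \<kappa> u * \<Phi> (?b l)"
          using y_xi_commutator[OF 2(1) j 2(2)] 2 br_swap[of j l] bar_commute[of j l]
          by (simp add: \<Phi>_minus \<Phi>_add add.commute)
        have m: "\<Phi> (?b l) * \<xi> l = - (\<xi> j * \<Phi> (?b l))" using moves_xi[of l l] 2 by simp
        have "ev xg2 (var l) * \<eta> j - \<eta> j * ev xg2 (var l) =
            - (\<xi> l * (\<eta> j * \<xi> l - \<xi> l * \<eta> j)) - (\<eta> j * \<xi> l - \<xi> l * \<eta> j) * \<xi> l"
          using 2 by (simp add: ev_var power2_eq_square \<Phi>_mult algebra_simps)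
        also have "\<dots> = - (\<xi> l * \<kappa> u * \<Phi> (?b l)) - \<kappa> u * (\<Phi> (?b l) * \<xi> l)"
          unfolding c by (simp add: mult.assoc)
        also have "\<dots> = \<kappa> u * ((\<xi> j - \<xi> l) * \<Phi> (?b l))"
          unfolding m \<kappa>_central[symmetric] by (simp add: algebra_simps)
        also have "\<dots> = (\<Sum>k\<in>{1..n} - {j}. if k = l then \<kappa> u * ((\<xi> j - \<xi> l) * \<Phi> (?b l)) else 0)"
          using 2 by simp
        also have "\<dots> = (\<Sum>k\<in>{1..n} - {j}. ev xg2 (?d l k) * ?\<rho> k)"
          using 2 by (intro sum.cong) (auto simp: ev_0 ev_1 ev_minus \<Phi>_1_left_\<kappa>)
        finally show ?thesis .
      next
        case 3
        then show ?thesis using j by (auto simp: ev_var ev_0 \<Phi>_1_left \<Phi>_1_right intro!: sum.neutral)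
      qed
    qed
    ultimately show "\<exists>d. (\<forall>k\<in>{1..n} - {j}. var l - ?f k l = (var j - var k) * d k) \<and>
        ev xg2 (var l) * \<eta> j - \<eta> j * ev xg2 (var l) = (\<Sum>k\<in>{1..n} - {j}. ev xg2 (d k) * ?\<rho> k)"
      by (intro exI[of _ "?d l"]) blast
  qed (simp_all add: ev_add ev_xi_mult ev_Cst \<kappa>_central)
qed

theorem y_invariant_central:
  assumes "p \<in> invariants W n act_y" "f \<in> carrier (free_alg W n)"
  shows "ev yg p * \<Phi> f = \<Phi> f * ev yg p"
  using assms(2)
proof (rule commute_carrier)
  fix g assume "g \<in> gens W n"
  then consider i where "g = Xi i" "i \<in> {1..n}" | i where "g = Y i" "i \<in> {1..n}"
    | i where "g = T i" "i \<in> t_index W n"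
    by (auto simp: gens_def)
  then show "ev yg p * \<Phi> (gen g) = \<Phi> (gen g) * ev yg p"
  proof cases
    case 1
    then show ?thesis using y_invariant_xi_commute[OF assms(1)] by blast
  next
    case (2 i)
    have "\<Phi> (yg i) * ev yg q = ev yg q * \<Phi> (yg i)" for q
    proof (induct q rule: cpoly_induct)
      case (mult p q)
      then show ?case unfolding ev_y_mult by (intro commute_prod)
    qed (simp_all add: ev_add ev_Cst ev_var \<kappa>_central \<Phi>_1_left \<Phi>_1_right
        y_commute[OF 2(2)] distrib_left distrib_right)
    then show ?thesis using 2 by simp
  next
    case (3 i)
    obtain \<sigma> S where "moves (tg i) \<sigma> S" "(\<sigma>, S) \<in> weyl W n" "\<sigma> permutes {1..n}" "S \<subseteq> {1..n}"
      using t_weyl[OF 3(2)] .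
    then show ?thesis using moves_ev_y[of "tg i" \<sigma> S p] assms(1) 3(1) by (auto simp: invariants_def)
  qed
qed (simp add: ev_def \<kappa>_central)

theorem xi_sq_invariant_central:
  assumes "p \<in> invariants W n act_xi_sq" "f \<in> carrier (free_alg W n)"
  shows "ev xg2 p * \<Phi> f = \<Phi> f * ev xg2 p"
  using assms(2)
proof (rule commute_carrier)
  fix g assume "g \<in> gens W n"
  then consider i where "g = Xi i" "i \<in> {1..n}" | i where "g = Y i" "i \<in> {1..n}"
    | i where "g = T i" "i \<in> t_index W n"
    by (auto simp: gens_def)
  then show "ev xg2 p * \<Phi> (gen g) = \<Phi> (gen g) * ev xg2 p"
  proof cases
    case 1
    then show ?thesis using xi_ev_commute by simp
  next
    case 2
    then show ?thesis using xi_sq_invariant_y_commute[OF assms(1)] by blast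
  next
    case (3 i)
    obtain \<sigma> S where "moves (tg i) \<sigma> S" "(\<sigma>, S) \<in> weyl W n" "\<sigma> permutes {1..n}" "S \<subseteq> {1..n}"
      using t_weyl[OF 3(2)] .
    then show ?thesis using moves_ev_xi[of "tg i" \<sigma> S p] assms(1) 3(1) by (auto simp: invariants_def)
  qed
qed (simp add: ev_def \<kappa>_central)

end

section \<open>Finiteness of the set of reflections\<close>

text \<open>
  To be read up to sign: \<open>K k\<close> is conjugation by \<open>t\<^sub>k\<close> and \<open>b k\<close> is \<open>t\<^sub>k\<close>, so that \<open>a i j\<close> below
  is \<open>[i,j]\<close>.
\<close>

locale conj_ops =
  fixes n :: nat and K :: "nat \<Rightarrow> 'x \<Rightarrow> 'x" and X :: "'x set" and b :: "nat \<Rightarrow> 'x"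
  assumes b_closed: "1 \<le> k \<Longrightarrow> k < n \<Longrightarrow> b k \<in> X"
    and K_closed: "1 \<le> k \<Longrightarrow> k < n \<Longrightarrow> x \<in> X \<Longrightarrow> K k x \<in> X"
    and K_inv: "1 \<le> k \<Longrightarrow> k < n \<Longrightarrow> x \<in> X \<Longrightarrow> K k (K k x) = x"
    and K_far: "1 \<le> k \<Longrightarrow> k + 1 < l \<Longrightarrow> l < n \<Longrightarrow> x \<in> X \<Longrightarrow> K k (K l x) = K l (K k x)"
    and K_braid: "1 \<le> k \<Longrightarrow> Suc k < n \<Longrightarrow> x \<in> X \<Longrightarrow>
      K k (K (Suc k) (K k x)) = K (Suc k) (K k (K (Suc k) x))"
    and b_self: "1 \<le> k \<Longrightarrow> k < n \<Longrightarrow> K k (b k) = b k"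
    and b_far: "1 \<le> k \<Longrightarrow> k < n \<Longrightarrow> 1 \<le> l \<Longrightarrow> l < n \<Longrightarrow> k + 1 < l \<or> l + 1 < k \<Longrightarrow> K k (b l) = b l"
    and b_adj: "1 \<le> k \<Longrightarrow> Suc k < n \<Longrightarrow> K (Suc k) (b k) = K k (b (Suc k))"
begin

primrec a :: "nat \<Rightarrow> nat \<Rightarrow> 'x" where
  "a i 0 = b i"
| "a i (Suc j) = (if i < j then K j (a i j) else b i)"

lemma a_base: "a i (Suc i) = b i" and a_Suc: "i < j \<Longrightarrow> a i (Suc j) = K j (a i j)"
  by simp_all

declare a.simps [simp del]

lemma a_closed:
  assumes "1 \<le> i" "i < j" "j \<le> n" shows "a i j \<in> X"
proof -
  have "Suc i \<le> j" using assms by simp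
  then show ?thesis using \<open>j \<le> n\<close>
    by (induct j rule: dec_induct) (use assms(1) in \<open>auto simp: a_base a_Suc b_closed K_closed\<close>)
qed

lemma K_a_below:
  assumes "1 \<le> k" "k + 1 < i" "i < j" "j \<le> n" shows "K k (a i j) = a i j"
proof -
  have "Suc i \<le> j" using assms by simp
  then show ?thesis using \<open>j \<le> n\<close>
    by (induct j rule: dec_induct)
      (use assms(1,2) in \<open>auto simp: a_base a_Suc b_far K_far a_closed\<close>)
qed

lemma K_a_above:
  assumes "1 \<le> i" "i < j" "j < k" "k < n" shows "K k (a i j) = a i j"
proof -
  have "Suc i \<le> j" using assms by simp
  then show ?thesis using \<open>j < k\<close>
    by (induct j rule: dec_induct)
      (use assms(1,4) in \<open>auto simp: a_base a_Suc b_far K_far[symmetric] a_closed\<close>)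
qed

text \<open>For \<open>j = k + 2\<close> the braid relation replaces the outer \<open>K k\<close> by
  an inner \<open>K (Suc k)\<close>, which fixes \<open>a i k\<close>. The remaining conjugations,
  by indices beyond \<open>k + 1\<close>, commute with \<open>K k\<close>.\<close>

lemma K_a_between:
  assumes "1 \<le> i" "i < k" "k + 1 < j" "j \<le> n" shows "K k (a i j) = a i j"
proof -
  have "k + 2 \<le> j" using assms by simp
  then show ?thesis using \<open>j \<le> n\<close>
  proof (induct j rule: dec_induct)
    case base
    have "a i (k + 2) = K (Suc k) (K k (a i k))" using assms by (simp add: a_Suc)
    then show ?case using assms base by (simp add: K_braid a_closed K_a_above)
  next
    case (step m)
    then show ?case using assms K_far[of k m "a i m"] a_closed[of i m] by (simp add: a_Suc)
  qed
qed

text \<open>By \<open>b_adj\<close>, conjugating \<open>t_i\<close> by its right neighbour is the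
  same as conjugating the neighbour by \<open>t_i\<close>; a further conjugation by
  \<open>t_i\<close> leaves the neighbour alone.\<close>

lemma K_a_left:
  assumes "1 \<le> i" "i + 1 < j" "j \<le> n" shows "K i (a i j) = a (Suc i) j"
proof -
  have "i + 2 \<le> j" using assms by simp
  then show ?thesis using \<open>j \<le> n\<close>
  proof (induct j rule: dec_induct)
    case base
    then show ?case using assms
      by (simp add: a_Suc a_base b_adj K_inv b_closed numeral_2_eq_2)
  next
    case (step m)
    then show ?case using assms K_far[of i m "a i m"] a_closed[of i m] by (simp add: a_Suc)
  qed
qed

definition A_fam :: "'x set" where "A_fam = (\<lambda>(i, j). a i j) ` {(i, j). 1 \<le> i \<and> i < j \<and> j \<le> n}"

lemma finite_pairs: "finite {(i :: nat, j). l \<le> i \<and> i < j \<and> j \<le> n}"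
  by (rule finite_subset[of _ "{..n} \<times> {..n}"]) auto

lemma A_famI: "1 \<le> i \<Longrightarrow> i < j \<Longrightarrow> j \<le> n \<Longrightarrow> a i j \<in> A_fam"
  by (auto simp: A_fam_def)

lemma A_famE:
  assumes "x \<in> A_fam" obtains i j where "x = a i j" "1 \<le> i" "i < j" "j \<le> n"
  using assms by (auto simp: A_fam_def)

text \<open>Conjugation by \<open>t_k\<close> exchanges the indices \<open>k\<close> and
  \<open>k + 1\<close>, and the cases are the positions of these relative to \<open>i\<close> and
  \<open>j\<close>. Where an index goes down, \<open>k + 1 = i\<close> or \<open>k + 1 = j\<close>,
  the claim is read off from the opposite move since \<open>K k\<close> is an involution.\<close>

lemma K_A_fam:
  assumes "1 \<le> k" "k < n" "x \<in> A_fam" shows "K k x \<in> A_fam"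
proof -
  obtain i j where x: "x = a i j" and ij: "1 \<le> i" "i < j" "j \<le> n" using A_famE[OF assms(3)] .
  consider "k + 1 < i" | "k + 1 = i" | "k = i" "i + 1 < j" | "k = i" "j = Suc i"
    | "i < k" "k + 1 < j" | "i < k" "k + 1 = j" | "k = j" | "j < k"
    using ij by linarith
  then show ?thesis
  proof cases
    case 1
    then show ?thesis using K_a_below assms ij A_famI by (simp add: x)
  next
    case 2
    then have "x = K k (a k j)" using K_a_left[of k j] ij assms by (simp add: x)
    then show ?thesis using 2 ij assms by (simp add: K_inv a_closed A_famI)
  next
    case 3
    then show ?thesis using K_a_left ij A_famI by (simp add: x)
  next
    case 4
    then show ?thesis using ij b_self A_famI[of i j] by (simp add: x a_base)
  next
    case 5
    then show ?thesis using K_a_between assms ij A_famI by (simp add: x)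
  next
    case 6
    then have "x = K k (a i k)" using a_Suc[of i k] by (simp add: x)
    then show ?thesis using 6 ij assms by (simp add: K_inv a_closed A_famI)
  next
    case 7
    then show ?thesis using a_Suc[of i j] A_famI[of i "Suc j"] ij assms by (simp add: x)
  next
    case 8
    then show ?thesis using K_a_above assms ij A_famI by (simp add: x)
  qed
qed

lemma finite_A_fam: "finite A_fam"
  unfolding A_fam_def by (intro finite_imageI finite_pairs)

lemma A_fam_closed: "A_fam \<subseteq> X"
  using a_closed by (auto simp: A_fam_def)

lemma b_A_fam: "1 \<le> k \<Longrightarrow> k < n \<Longrightarrow> b k \<in> A_fam"
  using A_famI[of k "Suc k"] by (simp add: a_base)

end

text \<open>
  Up to sign, \<open>q i j\<close> below is the barred \<open>[i,j]\<close>, determined by its last column \<open>c i = q i n\<close>.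
  In type \<open>B\<close> the row \<open>i = 0\<close> is added for the barred \<open>[j]\<close>, which behave in the same way.
\<close>

locale conj_ops_column = conj_ops n K X b
  for n :: nat and K :: "nat \<Rightarrow> 'x \<Rightarrow> 'x" and X :: "'x set" and b :: "nat \<Rightarrow> 'x" +
  fixes c :: "nat \<Rightarrow> 'x" and l :: nat
  assumes l_le_1: "l \<le> 1"
    and c_closed: "l \<le> i \<Longrightarrow> i < n \<Longrightarrow> c i \<in> X"
    and c_far: "l \<le> i \<Longrightarrow> i < n \<Longrightarrow> 1 \<le> k \<Longrightarrow> k + 1 < n \<Longrightarrow> k \<noteq> i \<Longrightarrow> k + 1 \<noteq> i \<Longrightarrow> K k (c i) = c i"
    and c_Suc: "l \<le> i \<Longrightarrow> 1 \<le> i \<Longrightarrow> Suc i < n \<Longrightarrow> K i (c i) = c (Suc i)"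
    and c_last: "2 \<le> n \<Longrightarrow> K (n - 1) (c (n - 1)) = c (n - 1)"
begin

text \<open>The columns are built downwards from the last one, so the recursion runs over the
  distance \<open>d\<close> from column \<open>n\<close>.\<close>

primrec qd :: "nat \<Rightarrow> nat \<Rightarrow> 'x" where
  "qd i 0 = c i"
| "qd i (Suc d) = K (n - Suc d) (qd i d)"

definition q :: "nat \<Rightarrow> nat \<Rightarrow> 'x" where "q i j = qd i (n - j)"

lemma q_n: "q i n = c i"
  by (simp add: q_def)

lemma q_less: "j < n \<Longrightarrow> q i j = K j (q i (Suc j))"
proof -
  assume "j < n"
  then obtain d where d: "n - j = Suc d" "n - Suc j = d" by (cases "n - j") auto
  then have "n - Suc d = j" using \<open>j < n\<close> by linarith
  then show ?thesis by (simp add: q_def d)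
qed

lemma q_closed:
  assumes "l \<le> i" "i < j" "j \<le> n" shows "q i j \<in> X"
  using \<open>j \<le> n\<close>
  by (induct j rule: inc_induct) (use assms in \<open>auto simp: q_n q_less[of j] q_less c_closed K_closed\<close>)

text \<open>The three claims need a common descending induction. The diagonal one, for
  \<open>Suc i = j\<close>, combines the index shift and the diagonal claim of the next column:
  \<open>q i j\<close> is \<open>K j (K i x)\<close> with \<open>x = q j (Suc j)\<close> fixed by
  \<open>K j\<close>, and the braid relation turns an additional \<open>K i\<close> into that
  \<open>K j\<close>.\<close>

lemma K_q_below:
  assumes "j \<le> n"
  shows "\<forall>i k. l \<le> i \<and> i < j \<and> 1 \<le> k \<longrightarrow>
    (k + 1 < j \<and> k \<noteq> i \<and> k + 1 \<noteq> i \<longrightarrow> K k (q i j) = q i j) \<and>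
    (k = i \<and> i + 1 < j \<longrightarrow> K k (q i j) = q (Suc i) j) \<and>
    (k = i \<and> Suc i = j \<longrightarrow> K k (q i j) = q i j)"
  using assms
proof (induct j rule: inc_induct)
  case base
  then show ?case using c_far c_Suc c_last by (auto simp: q_n)
next
  case (step j)
  have far: "K k (q i (Suc j)) = q i (Suc j)"
    if "l \<le> i" "i < Suc j" "1 \<le> k" "k + 1 < Suc j" "k \<noteq> i" "k + 1 \<noteq> i" for i k
    using step(3) that by blast
  have left: "K i (q i (Suc j)) = q (Suc i) (Suc j)" if "l \<le> i" "1 \<le> i" "i < j" for i
    using step(3) that by simp
  have last: "K j (q j (Suc j)) = q j (Suc j)" if "l \<le> j" "1 \<le> j"
    using spec[OF spec[OF step(3), of j], of j] that by simp
  show ?case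
  proof (intro allI impI conjI; elim conjE)
    fix i k assume "l \<le> i" "i < j" "1 \<le> k" "k + 1 < j" "k \<noteq> i" "k + 1 \<noteq> i"
    then show "K k (q i j) = q i j" using step far[of i k] by (simp add: q_less K_far q_closed)
  next
    fix i k assume "l \<le> i" "i < j" "1 \<le> k" "k = i" "i + 1 < j"
    then show "K k (q i j) = q (Suc i) j"
      using step left[of i] K_far[of i j "q i (Suc j)"] q_closed[of i "Suc j"] by (simp add: q_less)
  next
    fix i k assume *: "l \<le> i" "i < j" "1 \<le> k" "k = i" "Suc i = j"
    then have j: "l \<le> j" "1 \<le> j" by auto
    have x: "q j (Suc j) \<in> X" using j step by (auto intro: q_closed)
    have "q i (Suc j) = K i (q j (Suc j))"
      using left[of i] * step K_inv[of i "q i (Suc j)"] q_closed[of i "Suc j"] by auto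
    then have "q i j = K j (K i (q j (Suc j)))" using step by (simp add: q_less)
    moreover have "K i (K j (K i (q j (Suc j)))) = K j (K i (q j (Suc j)))"
      using K_braid[of i "q j (Suc j)"] x last[OF j] * step by auto
    ultimately show "K k (q i j) = q i j" using * by simp
  qed
qed

text \<open>This mirrors \<open>K_a_between\<close>: for \<open>k = Suc j\<close> the braid relation
  replaces the outer \<open>K k\<close> by an inner \<open>K j\<close>, which fixes
  \<open>q i (Suc k)\<close>. For larger \<open>k\<close>, the operators commute.\<close>

lemma K_q_above:
  assumes "l \<le> i" "i < j" "j < k" "k < n"
  shows "K k (q i j) = q i j"
proof -
  have "j \<le> n" using assms by simp
  then show ?thesis using assms(2,3)
  proof (induct j rule: inc_induct)
    case base
    then show ?case using assms by simp
  next
    case (step j)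
    show ?case
    proof (cases "k = Suc j")
      case True
      have x: "q i (Suc k) \<in> X" using step assms by (auto intro: q_closed)
      have "K j (q i (Suc k)) = q i (Suc k)"
        using K_q_below[of "Suc k"] step assms True by auto
      then have "K k (K j (K k (q i (Suc k)))) = K j (K k (q i (Suc k)))"
        using K_braid[of j "q i (Suc k)"] x True step assms by auto
      moreover have "q i j = K j (K k (q i (Suc k)))"
        using step assms True by (simp add: q_less)
      ultimately show ?thesis by simp
    next
      case False
      then show ?thesis using step assms
        by (cases "j = 0") (auto simp: q_less[of j] K_far[symmetric] q_closed)
    qed
  qed
qed

definition Q_fam :: "'x set" where "Q_fam = (\<lambda>(i, j). q i j) ` {(i, j). l \<le> i \<and> i < j \<and> j \<le> n}"

lemma Q_famI: "l \<le> i \<Longrightarrow> i < j \<Longrightarrow> j \<le> n \<Longrightarrow> q i j \<in> Q_fam"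
  by (auto simp: Q_fam_def)

lemma Q_famE:
  assumes "x \<in> Q_fam" obtains i j where "x = q i j" "l \<le> i" "i < j" "j \<le> n"
  using assms by (auto simp: Q_fam_def)

lemma finite_Q_fam: "finite Q_fam"
  unfolding Q_fam_def by (intro finite_imageI finite_pairs)

lemma Q_fam_closed: "Q_fam \<subseteq> X"
  using q_closed by (auto simp: Q_fam_def)

lemma K_Q_fam:
  assumes "1 \<le> k" "k < n" "x \<in> Q_fam" shows "K k x \<in> Q_fam"
proof -
  obtain i j where x: "x = q i j" and ij: "l \<le> i" "i < j" "j \<le> n" using Q_famE[OF assms(3)] .
  consider "k + 1 < j" "k \<noteq> i" "k + 1 \<noteq> i" | "k + 1 = i" "l \<le> k" | "k + 1 = i" "i = l" | "k = i" "i + 1 < j"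
    | "k = i" "j = Suc i" | "i < k" "k + 1 = j" | "k = j" | "j < k"
    using ij by linarith
  then show ?thesis
  proof cases
    case 1
    then show ?thesis using K_q_below ij assms Q_famI by (simp add: x)
  next
    case 2
    then have "q i j = K k (q k j)" using K_q_below[OF ij(3)] ij assms by auto
    then show ?thesis using 2 ij assms by (simp add: x K_inv q_closed Q_famI)
  next
    \<comment> \<open>The first row cannot be lowered: \<open>l \<le> 1\<close> leaves no
      \<open>k \<ge> 1\<close> with \<open>k + 1 = l\<close>.\<close>
    case 3
    then show ?thesis using l_le_1 assms by simp
  next
    case 4
    then show ?thesis using K_q_below[OF ij(3)] ij assms Q_famI[of "Suc i" j] by (simp add: x)
  next
    case 5
    then show ?thesis using spec[OF spec[OF K_q_below[OF ij(3)], of i], of i] ij assms Q_famI[of i j]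
      by (simp add: x)
  next
    case 6
    then have "q i k = K k (q i j)" using q_less[of k i] assms by auto
    then show ?thesis using 6 ij by (simp add: x flip: \<open>q i k = _\<close>) (auto intro: Q_famI)
  next
    case 7
    then have "x = K k (q i (Suc k))" using q_less[of k i] assms by (simp add: x)
    then show ?thesis using 7 ij assms by (simp add: K_inv q_closed Q_famI)
  next
    case 8
    then show ?thesis using K_q_above assms ij Q_famI by (simp add: x)
  qed
qed

end

section \<open>The reflections of type B\<close>

locale conj_ops_B = conj_ops n K X b
  for n :: nat and K :: "nat \<Rightarrow> 'x \<Rightarrow> 'x" and X :: "'x set" and b :: "nat \<Rightarrow> 'x" +
  assumes n_ge_2: "2 \<le> n" and bn_closed: "b n \<in> X"
    and Kn_closed: "x \<in> X \<Longrightarrow> K n x \<in> X" and Kn_inv: "x \<in> X \<Longrightarrow> K n (K n x) = x"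
    and Kn_far: "1 \<le> k \<Longrightarrow> k + 1 < n \<Longrightarrow> x \<in> X \<Longrightarrow> K k (K n x) = K n (K k x)"
    and Kn_quad: "x \<in> X \<Longrightarrow>
      K n (K (n - 1) (K n (K (n - 1) x))) = K (n - 1) (K n (K (n - 1) (K n x)))"
    and bn_self: "K n (b n) = b n"
    and bn_far: "1 \<le> k \<Longrightarrow> k + 1 < n \<Longrightarrow> K k (b n) = b n" "1 \<le> k \<Longrightarrow> k + 1 < n \<Longrightarrow> K n (b k) = b k"
    and bn_quad: "K n (K (n - 1) (b n)) = K (n - 1) (b n)"
      "K (n - 1) (K n (b (n - 1))) = K n (b (n - 1))"
begin

lemma Kn_a: "1 \<le> i \<Longrightarrow> i < j \<Longrightarrow> j < n \<Longrightarrow> K n (a i j) = a i j"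
proof -
  assume i: "1 \<le> i" "i < j" "j < n"
  then have "Suc i \<le> j" by simp
  then show ?thesis using \<open>j < n\<close>
    by (induct j rule: dec_induct)
      (use i(1) in \<open>auto simp: a_base a_Suc bn_far Kn_far[symmetric] a_closed\<close>)
qed

text \<open>In type B conjugation by \<open>t_n\<close> negates the last variable and so makes the
  barred \<open>[i,n]\<close> out of \<open>[i,n]\<close>; \<open>t_n\<close> itself is the barred
  \<open>[n]\<close> and heads row 0.\<close>

definition cB :: "nat \<Rightarrow> 'x" where "cB i = (if i = 0 then b n else K n (a i n))"

sublocale conj_ops_column n K X b cB 0
proof
  fix i k assume "i < n" "1 \<le> k" "k + 1 < n" "k \<noteq> i" "k + 1 \<noteq> i"
  then show "K k (cB i) = cB i"
    using K_a_below[of k i n] K_a_between[of i k n]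
    by (cases "k < i") (auto simp: cB_def bn_far Kn_far a_closed)
next
  fix i assume "1 \<le> i" "Suc i < n"
  then show "K i (cB i) = cB (Suc i)"
    using K_a_left[of i n] by (auto simp: cB_def Kn_far a_closed)
next
  show "K (n - 1) (cB (n - 1)) = cB (n - 1)"
    using bn_quad(2) a_base[of "n - 1"] n_ge_2 by (auto simp: cB_def)
qed (use n_ge_2 in \<open>auto simp: cB_def bn_closed Kn_closed a_closed\<close>)

text \<open>In column \<open>n - 1\<close> the relation of length four moves \<open>K n\<close> to
  the innermost place, where it fixes \<open>a i (n - 1)\<close>; in row 0 this is the assumption
  \<open>bn_quad\<close>. Further conjugations, by smaller indices, commute with
  \<open>K n\<close>.\<close>

lemma Kn_q:
  assumes "i < j" "j < n" shows "K n (q i j) = q i j"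
proof -
  have "j \<le> n - 1" using assms by simp
  then show ?thesis using assms(1)
  proof (induct j rule: inc_induct)
    case base
    have q: "q i (n - 1) = K (n - 1) (cB i)" using n_ge_2 q_less[of "n - 1" i] by (simp add: q_n)
    show ?case
    proof (cases "i = 0")
      case True
      then have "cB i = b n" by (simp add: cB_def)
      then show ?thesis using bn_quad(1) by (simp only: q)
    next
      case False
      let ?x = "a i (n - 1)"
      have x: "?x \<in> X" using False base by (auto intro: a_closed)
      have "cB i = K n (K (n - 1) ?x)" using False base a_Suc[of i "n - 1"] n_ge_2 by (simp add: cB_def)
      then show ?thesis using Kn_quad[OF x] Kn_a[of i "n - 1"] False base n_ge_2 unfolding q by simp
    qed
  next
    case (step j)
    have "0 < j" using step by simp
    then show ?case using step Kn_far[of j "q i (Suc j)", symmetric] q_closed[of i "Suc j"]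
      by (simp add: q_less[of j])
  qed
qed

text \<open>Neither family alone is stable: \<open>K n\<close> exchanges \<open>a i n\<close> with
  \<open>q i n\<close> for \<open>i \<ge> 1\<close>. It fixes all other members of both.\<close>

theorem finite_invariant:
  "\<exists>F. finite F \<and> F \<subseteq> X \<and> (\<forall>k\<in>{1..n}. b k \<in> F \<and> K k ` F \<subseteq> F)"
proof (intro exI conjI ballI)
  show "finite (A_fam \<union> Q_fam)" "A_fam \<union> Q_fam \<subseteq> X"
    using finite_A_fam finite_Q_fam A_fam_closed Q_fam_closed by auto
  fix k assume k: "k \<in> {1..n}"
  have "q 0 n = b n" by (simp add: q_n cB_def)
  then show "b k \<in> A_fam \<union> Q_fam"
    using k b_A_fam[of k] Q_famI[of 0 n] n_ge_2 by (cases "k = n") auto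
  have "K n x \<in> A_fam \<union> Q_fam" if A: "x \<in> A_fam" for x
  proof -
    obtain i j where x: "x = a i j" "1 \<le> i" "i < j" "j \<le> n" using A_famE[OF A] .
    show ?thesis
    proof (cases "j = n")
      case True
      then have "K n x = q i n" using x by (simp add: q_n cB_def)
      then show ?thesis using x True Q_famI[of i n] by simp
    next
      case False
      then show ?thesis using x Kn_a[of i j] A by simp
    qed
  qed
  moreover have "K n x \<in> A_fam \<union> Q_fam" if Q: "x \<in> Q_fam" for x
  proof -
    obtain i j where x: "x = q i j" "i < j" "j \<le> n" using Q_famE[OF Q] .
    show ?thesis
    proof (cases "j = n")
      case True
      then show ?thesis
        using x A_famI[of i n] Q by (cases "i = 0") (auto simp: q_n cB_def bn_self Kn_inv a_closed)
    next
      case False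
      then show ?thesis using x Kn_q[of i j] Q by simp
    qed
  qed
  ultimately show "K k ` (A_fam \<union> Q_fam) \<subseteq> A_fam \<union> Q_fam"
    using k K_A_fam[of k] K_Q_fam[of k] by (cases "k = n") auto
qed

end

section \<open>The reflections of type D\<close>

locale conj_ops_D = conj_ops n K X b
  for n :: nat and K :: "nat \<Rightarrow> 'x \<Rightarrow> 'x" and X :: "'x set" and b :: "nat \<Rightarrow> 'x" +
  assumes n_ge_4: "4 \<le> n" and bn_closed: "b n \<in> X"
    and Kn_closed: "x \<in> X \<Longrightarrow> K n x \<in> X" and Kn_inv: "x \<in> X \<Longrightarrow> K n (K n x) = x"
    and Kn_far: "1 \<le> k \<Longrightarrow> k < n \<Longrightarrow> k \<noteq> n - 2 \<Longrightarrow> x \<in> X \<Longrightarrow> K k (K n x) = K n (K k x)"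
    and Kn_braid: "x \<in> X \<Longrightarrow> K (n - 2) (K n (K (n - 2) x)) = K n (K (n - 2) (K n x))"
    and bn_self: "K n (b n) = b n"
    and bn_far: "1 \<le> k \<Longrightarrow> k < n \<Longrightarrow> k \<noteq> n - 2 \<Longrightarrow> K k (b n) = b n"
      "1 \<le> k \<Longrightarrow> k < n \<Longrightarrow> k \<noteq> n - 2 \<Longrightarrow> K n (b k) = b k"
    and bn_adj: "K n (b (n - 2)) = K (n - 2) (b n)"
begin

text \<open>The bracket is built from \<open>t_i, ..., t_(j-1)\<close>, none of which is joined to
  \<open>t_n\<close> in the Dynkin diagram: in type D the node \<open>n\<close> is attached to
  \<open>n - 2\<close>.\<close>

lemma Kn_a:
  assumes "1 \<le> i" "i < j" "j \<le> n - 2" shows "K n (a i j) = a i j"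
proof -
  have "Suc i \<le> j" using assms by simp
  then show ?thesis using \<open>j \<le> n - 2\<close>
    by (induct j rule: dec_induct)
      (use assms(1) in \<open>auto simp: a_base a_Suc bn_far Kn_far[symmetric] a_closed\<close>)
qed

text \<open>In type D \<open>t_n\<close> is the barred \<open>[n-1,n]\<close>. It sends the variable
  with index \<open>n - 1\<close> to minus the last one, so conjugation turns \<open>[i,n-1]\<close>
  into the barred \<open>[i,n]\<close>.\<close>

definition cD :: "nat \<Rightarrow> 'x" where "cD i = (if i = n - 1 then b n else K n (a i (n - 1)))"

lemma a_n1: "i < n - 2 \<Longrightarrow> a i (n - 1) = K (n - 2) (a i (n - 2))"
  using a_Suc[of i "n - 2"] n_ge_4 by (simp add: Suc_diff_Suc numeral_2_eq_2)

lemma a_n: "i < n - 1 \<Longrightarrow> a i n = K (n - 1) (a i (n - 1))"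
  using a_Suc[of i "n - 1"] n_ge_4 by simp

sublocale conj_ops_column n K X b cD 1
proof
  fix i k assume ik: "1 \<le> i" "i < n" "1 \<le> k" "k + 1 < n" "k \<noteq> i" "k + 1 \<noteq> i"
  show "K k (cD i) = cD i"
  proof (cases "i = n - 1")
    case True
    then show ?thesis using ik by (simp add: cD_def bn_far)
  next
    case False
    have x: "a i (n - 1) \<in> X" using ik False by (auto intro: a_closed)
    show ?thesis
    proof (cases "k = n - 2")
      case True
      then have i: "i < n - 2" using ik False by simp
      then have "a i (n - 2) \<in> X" using ik by (auto intro: a_closed)
      \<comment> \<open>Here \<open>cD i = K n (K (n - 2) (a i (n - 2)))\<close>, and the braid
        relation trades the outer \<open>K (n - 2)\<close> for an inner \<open>K n\<close>, which
        fixes \<open>a i (n - 2)\<close>.\<close>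
      from Kn_braid[OF this] show ?thesis
        using False True a_n1[OF i] Kn_a[of i "n - 2"] i ik by (simp add: cD_def)
    next
      case k: False
      have "K k (a i (n - 1)) = a i (n - 1)"
        using K_a_below[of k i "n - 1"] K_a_between[of i k "n - 1"] ik False k
        by (cases "k < i") auto
      then show ?thesis using Kn_far[of k, OF _ _ _ x] k False ik by (simp add: cD_def)
    qed
  qed
next
  fix i assume i: "1 \<le> i" "Suc i < n"
  show "K i (cD i) = cD (Suc i)"
  proof (cases "i = n - 2")
    case True
    then have "i \<noteq> n - 1" "Suc i = n - 1" using n_ge_4 by auto
    then have "cD i = K i (b n)" using a_base[of i] bn_adj True by (simp add: cD_def)
    moreover have "Suc i = n - 1" using True n_ge_4 by simp
    ultimately show ?thesis using K_inv[of i "b n"] i bn_closed by (simp add: cD_def)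
  next
    case False
    then show ?thesis using i K_a_left[of i "n - 1"] Kn_far[of i "a i (n - 1)"] a_closed[of i "n - 1"]
      by (auto simp: cD_def)
  qed
next
  show "K (n - 1) (cD (n - 1)) = cD (n - 1)" using bn_far n_ge_4 by (simp add: cD_def)
qed (use n_ge_4 in \<open>auto simp: cD_def bn_closed Kn_closed a_closed\<close>)

lemma q_n1:
  assumes "1 \<le> i" "i < n - 1" shows "q i (n - 1) = K n (a i n)"
  using assms q_less[of "n - 1" i] n_ge_4 Kn_far[of "n - 1" "a i (n - 1)"] a_closed[of i "n - 1"]
  by (simp add: q_n cD_def a_n)

text \<open>In column \<open>n - 2\<close> the braid relation trades \<open>K n\<close> for
  \<open>K (n - 2)\<close> applied to \<open>a i n\<close>, where it is trivial because
  \<open>n - 2\<close> and \<open>n - 1\<close> lie strictly between \<open>i\<close> and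
  \<open>n\<close>.\<close>

lemma Kn_q:
  assumes "1 \<le> i" "i < j" "j \<le> n - 2" shows "K n (q i j) = q i j"
  using assms(3,2)
proof (induct j rule: inc_induct)
  case base
  have q: "q i (n - 2) = K (n - 2) (K n (a i n))"
    using q_less[of "n - 2" i] q_n1[of i] assms(1) base n_ge_4
    by (simp add: Suc_diff_Suc numeral_2_eq_2)
  have x: "a i n \<in> X" using assms by (auto intro: a_closed)
  have "K (n - 2) (a i n) = a i n" using K_a_between[of i "n - 2" n] assms(1) base n_ge_4 by simp
  then show ?case using Kn_braid[OF x] by (simp add: q)
next
  case (step j)
  then show ?case using Kn_far[of j "q i (Suc j)", symmetric] q_closed[of i "Suc j"] assms(1)
    by (simp add: q_less[of j])
qed

text \<open>For \<open>i < n - 1\<close>, \<open>K n\<close> exchanges \<open>a i (n - 1)\<close>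
  with \<open>q i n\<close> and \<open>a i n\<close> with \<open>q i (n - 1)\<close>. All other
  members are fixed.\<close>

theorem finite_invariant:
  "\<exists>F. finite F \<and> F \<subseteq> X \<and> (\<forall>k\<in>{1..n}. b k \<in> F \<and> K k ` F \<subseteq> F)"
proof (intro exI conjI ballI)
  show "finite (A_fam \<union> Q_fam)" "A_fam \<union> Q_fam \<subseteq> X"
    using finite_A_fam finite_Q_fam A_fam_closed Q_fam_closed by auto
  fix k assume k: "k \<in> {1..n}"
  have "q (n - 1) n = b n" by (simp add: q_n cD_def)
  then show "b k \<in> A_fam \<union> Q_fam"
    using k b_A_fam[of k] Q_famI[of "n - 1" n] n_ge_4 by (cases "k = n") auto
  have "K n x \<in> A_fam \<union> Q_fam" if A: "x \<in> A_fam" for x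
  proof -
    obtain i j where x: "x = a i j" "1 \<le> i" "i < j" "j \<le> n" using A_famE[OF A] .
    consider "j \<le> n - 2" | "j = n - 1" | "j = n" "i < n - 1" | "j = n" "i = n - 1" using x by linarith
    then show ?thesis
    proof cases
      case 1
      then show ?thesis using x Kn_a[of i j] A by simp
    next
      case 2
      then have "K n x = q i n" using x by (simp add: q_n cD_def)
      then show ?thesis using x 2 Q_famI[of i n] by simp
    next
      case 3
      then show ?thesis using x q_n1[of i] Q_famI[of i "n - 1"] by simp
    next
      case 4
      then have "x = b (n - 1)" using a_base[of "n - 1"] x by simp
      then show ?thesis using bn_far(2)[of "n - 1"] n_ge_4 A by simp
    qed
  qed
  moreover have "K n x \<in> A_fam \<union> Q_fam" if Q: "x \<in> Q_fam" for x
  proof -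
    obtain i j where x: "x = q i j" "1 \<le> i" "i < j" "j \<le> n" using Q_famE[OF Q] .
    consider "j \<le> n - 2" | "j = n - 1" | "j = n" "i < n - 1" | "j = n" "i = n - 1" using x by linarith
    then show ?thesis
    proof cases
      case 1
      then show ?thesis using x Kn_q[of i j] Q by simp
    next
      case 2
      then show ?thesis using x q_n1[of i] A_famI[of i n] by (simp add: Kn_inv a_closed)
    next
      case 3
      then show ?thesis using x A_famI[of i "n - 1"] by (simp add: q_n cD_def Kn_inv a_closed)
    next
      case 4
      then show ?thesis using x Q by (simp add: q_n cD_def bn_self)
    qed
  qed
  ultimately show "K k ` (A_fam \<union> Q_fam) \<subseteq> A_fam \<union> Q_fam"
    using k K_A_fam[of k] K_Q_fam[of k] by (cases "k = n") auto
qed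

end

theorem (in conj_ops) finite_invariant_A:
  "\<exists>F. finite F \<and> F \<subseteq> X \<and> (\<forall>k\<in>{1..<n}. b k \<in> F \<and> K k ` F \<subseteq> F)"
  using finite_A_fam A_fam_closed b_A_fam K_A_fam by (intro exI[of _ A_fam]) auto

section \<open>Computing up to sign, and Dietzmann's lemma\<close>

definition pm :: "'r::ring \<Rightarrow> 'r \<Rightarrow> bool" where "pm x y \<longleftrightarrow> x = y \<or> x = - y"

lemma pm_refl: "pm x x"
  and pm_trans [trans]: "pm x y \<Longrightarrow> pm y z \<Longrightarrow> pm x z"
  and pm_mult_left: "pm x y \<Longrightarrow> pm (z * x) (z * y)"
  and pm_mult_right: "pm x y \<Longrightarrow> pm (x * z) (y * z)"
  by (auto simp: pm_def)

text \<open>A relation is applied once to the left and once to the right of \<open>r\<close>, so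
  that its signs cancel. The same holds for \<open>conj_quad\<close>; the braid relation carries no
  sign.\<close>

lemma conj_far:
  fixes s t r :: "'r::ring"
  assumes "s * t = - (t * s)"
  shows "s * (t * r * t) * s = t * (s * r * s) * t"
proof -
  have "s * (t * r * t) * s = (s * t) * r * (t * s)" by (simp add: mult.assoc)
  also have "t * s = - (s * t)" using assms by simp
  also have "(s * t) * r * - (s * t) = t * (s * r * s) * t" by (subst assms) (simp add: mult.assoc)
  finally show ?thesis .
qed

lemma conj_braid:
  fixes s t r :: "'r::ring"
  assumes "s * t * s = t * s * t"
  shows "s * (t * (s * r * s) * t) * s = t * (s * (t * r * t) * s) * t"
proof -
  have "s * (t * (s * r * s) * t) * s = (s * t * s) * r * (s * t * s)" by (simp add: mult.assoc)
  also have "\<dots> = (t * s * t) * r * (t * s * t)" by (simp only: assms)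
  finally show ?thesis by (simp add: mult.assoc)
qed

lemma conj_quad:
  fixes s t r :: "'r::ring"
  assumes "s * t * s * t = - (t * s * t * s)"
  shows "t * (s * (t * (s * r * s) * t) * s) * t = s * (t * (s * (t * r * t) * s) * t) * s"
proof -
  have "s * (t * (s * (t * r * t) * s) * t) * s = (s * t * s * t) * r * (t * s * t * s)"
    by (simp add: mult.assoc)
  also have "\<dots> = (t * s * t * s) * r * (s * t * s * t)" by (simp add: assms)
  finally show ?thesis by (simp add: mult.assoc)
qed

text \<open>The empty product is a parameter because the ambient ring need not have a unit.\<close>

inductive_set words :: "'r::ring \<Rightarrow> 'r set \<Rightarrow> 'r set" for e and G where
  words_unit: "e \<in> words e G"
| words_step: "g \<in> G \<Longrightarrow> w \<in> words e G \<Longrightarrow> g * w \<in> words e G"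

lemma words_mono: "x \<in> words e G \<Longrightarrow> G \<subseteq> G' \<Longrightarrow> x \<in> words e G'"
  by (induct rule: words.induct) (auto intro: words.intros)

text \<open>
  Dietzmann's lemma, up to signs: in a product of elements of \<open>R\<close>, a repeated factor can be
  moved to its other occurrence, where it cancels, by conjugating the factors in between.
\<close>

lemma dietzmann:
  fixes e :: "'r::ring" and R :: "'r set"
  assumes fin: "finite R" and unit: "e * e = e" "\<And>r. r \<in> R \<Longrightarrow> e * r = r" "\<And>r. r \<in> R \<Longrightarrow> r * e = r"
    and sq: "\<And>r. r \<in> R \<Longrightarrow> pm (r * r) e"
    and conj: "\<And>r s. r \<in> R \<Longrightarrow> s \<in> R \<Longrightarrow> \<exists>s'\<in>R. pm (r * s) (s' * r)"
  shows "\<exists>B. finite B \<and> B \<subseteq> words e R \<and> (\<forall>x\<in>words e R. \<exists>b\<in>B. pm x b)"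
proof -
  define lp where "lp l = foldr (*) l e" for l :: "'r list"
  have lp: "lp [] = e" "lp (x # l) = x * lp l" for x l by (simp_all add: lp_def)
  have lp_words: "lp l \<in> words e R" if "set l \<subseteq> R" for l
    using that by (induct l) (auto simp: lp intro: words.intros)
  have lp_unit: "e * lp l = lp l" if "set l \<subseteq> R" for l
    using that by (cases l) (auto simp: lp unit simp flip: mult.assoc)
  have lp_append: "pm (lp (xs @ w)) (lp (xs @ w'))" if "pm (lp w) (lp w')" for xs w w'
    using that by (induct xs) (auto simp: lp intro: pm_mult_left)
  \<comment> \<open>The list \<open>ys'\<close> must not depend on the tail \<open>r\<close>. Taking
    a tail that begins with the second \<open>y\<close> brings the two copies side by side.\<close>
  have move: "\<exists>ys'. set ys' \<subseteq> R \<and> length ys' = length ys \<and>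
      (\<forall>r. pm (y * lp (ys @ r)) (lp (ys' @ y # r)))" if "y \<in> R" "set ys \<subseteq> R" for y ys
  proof -
    note y = \<open>y \<in> R\<close>
    show ?thesis using \<open>set ys \<subseteq> R\<close>
    proof (induct ys)
      case Nil
      show ?case by (rule exI[of _ "[]"]) (simp add: lp pm_refl)
    next
      case (Cons s ys)
      then obtain ys' where ys': "set ys' \<subseteq> R" "length ys' = length ys"
        "\<And>r. pm (y * lp (ys @ r)) (lp (ys' @ y # r))" by auto
      obtain s' where s': "s' \<in> R" "pm (y * s) (s' * y)" using conj[OF y, of s] Cons by auto
      have "pm (y * lp ((s # ys) @ r)) (lp ((s' # ys') @ y # r))" for r
      proof -
        have "pm (y * lp ((s # ys) @ r)) (s' * y * lp (ys @ r))"
          using pm_mult_right[OF s'(2), of "lp (ys @ r)"] by (simp add: lp mult.assoc)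
        also have "pm \<dots> (s' * lp (ys' @ y # r))"
          using pm_mult_left[OF ys'(3)] by (simp add: mult.assoc)
        finally show ?thesis by (simp add: lp)
      qed
      then show ?case using ys' s' by (intro exI[of _ "s' # ys'"]) auto
    qed
  qed
  have reduce: "\<exists>l'. set l' \<subseteq> R \<and> distinct l' \<and> pm (lp l) (lp l')" if "set l \<subseteq> R" for l
    using that
  proof (induct l rule: length_induct)
    case (1 l)
    show ?case
    proof (cases "distinct l")
      case True
      then show ?thesis using 1 pm_refl by blast
    next
      case False
      then obtain xs y ys zs where l: "l = xs @ [y] @ ys @ [y] @ zs"
        using not_distinct_decomp by blast
      then have R: "y \<in> R" "set xs \<subseteq> R" "set ys \<subseteq> R" "set zs \<subseteq> R" using 1 by auto
      obtain ys' where ys': "set ys' \<subseteq> R" "length ys' = length ys"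
        "\<And>r. pm (y * lp (ys @ r)) (lp (ys' @ y # r))" using move[OF R(1,3)] by blast
      have "pm (lp (y # y # zs)) (lp zs)"
        using pm_mult_right[OF sq[OF R(1)], of "lp zs"] lp_unit[OF R(4)] by (simp add: lp mult.assoc)
      then have "pm (lp (ys' @ y # y # zs)) (lp (ys' @ zs))" by (rule lp_append)
      moreover have "pm (lp (y # ys @ y # zs)) (lp (ys' @ y # y # zs))"
        using ys'(3)[of "y # zs"] by (simp add: lp)
      ultimately have *: "pm (lp l) (lp (xs @ ys' @ zs))"
        unfolding l append_Cons append_Nil using lp_append pm_trans by blast
      have "set (xs @ ys' @ zs) \<subseteq> R" "length (xs @ ys' @ zs) < length l"
        using R ys' l by auto
      then obtain l' where "set l' \<subseteq> R" "distinct l'" "pm (lp (xs @ ys' @ zs)) (lp l')"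
        using 1(1) by blast
      then show ?thesis using pm_trans[OF *] by blast
    qed
  qed
  let ?B = "lp ` {l. set l \<subseteq> R \<and> distinct l}"
  have "\<exists>b\<in>?B. pm x b" if "x \<in> words e R" for x
  proof -
    have "\<exists>l. set l \<subseteq> R \<and> x = lp l"
      using that
    proof (induct rule: words.induct)
      case words_unit
      show ?case by (rule exI[of _ "[]"]) (simp add: lp)
    next
      case (words_step g w)
      then obtain l where "set l \<subseteq> R" "w = lp l" by blast
      then show ?case using words_step by (intro exI[of _ "g # l"]) (simp add: lp)
    qed
    then obtain l where "set l \<subseteq> R" "x = lp l" by blast
    then show ?thesis using reduce[of l] by blast
  qed
  moreover have "finite ?B" using finite_subset_distinct[OF fin] by (rule finite_imageI)
  moreover have "?B \<subseteq> words e R" using lp_words by auto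
  ultimately show ?thesis by blast
qed

section \<open>Conjugation of reflections in the image of the algebra\<close>

context rsd_hom
begin

definition H :: "'r set" where "H = \<Phi> ` carrier (free_alg W n)"

abbreviation e where "e \<equiv> \<Phi> 1"

lemma carrier_homog: "homog W n p \<subseteq> carrier (free_alg W n)"
  by (auto simp: homog_def free_alg_def)

lemma H_I: "f \<in> carrier (free_alg W n) \<Longrightarrow> \<Phi> f \<in> H"
  by (simp add: H_def)

lemma H_homog: "f \<in> homog W n p \<Longrightarrow> \<Phi> f \<in> H"
  using carrier_homog H_I by blast

lemma H_mult: "x \<in> H \<Longrightarrow> y \<in> H \<Longrightarrow> x * y \<in> H"
  unfolding H_def using free_alg_mult_closed by (force simp flip: \<Phi>_mult)

lemma H_add: "x \<in> H \<Longrightarrow> y \<in> H \<Longrightarrow> x + y \<in> H"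
  unfolding H_def using free_alg_add_closed by (force simp flip: \<Phi>_add)

lemma H_minus: "x \<in> H \<Longrightarrow> - x \<in> H"
  unfolding H_def by (force simp: free_alg_def simp flip: \<Phi>_minus)

lemma H_pm: "pm x y \<Longrightarrow> y \<in> H \<Longrightarrow> x \<in> H"
  using H_minus by (auto simp: pm_def)

lemma H_e: "e \<in> H"
  by (rule H_homog[OF homog_1])

lemma H_0: "0 \<in> H"
  using H_homog[OF homog_0] by (simp add: \<Phi>_0)

lemma e_left: "x \<in> H \<Longrightarrow> e * x = x" and e_right: "x \<in> H \<Longrightarrow> x * e = x"
  by (auto simp: H_def \<Phi>_1_left \<Phi>_1_right)

lemma H_gens: "i \<in> {1..n} \<Longrightarrow> \<xi> i \<in> H" "i \<in> {1..n} \<Longrightarrow> \<eta> i \<in> H" "i \<in> t_index W n \<Longrightarrow> \<tau> i \<in> H"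
  by (blast intro: H_homog homog_x homog_y homog_t)+

lemma words_H: "x \<in> words e G \<Longrightarrow> G \<subseteq> H \<Longrightarrow> x \<in> H"
  by (induct rule: words.induct) (auto intro: H_mult H_e)

lemma words_mult:
  assumes "G \<subseteq> H" "x \<in> words e G" "y \<in> words e G"
  shows "x * y \<in> words e G"
  using assms(2)
proof (induct rule: words.induct)
  case words_unit
  then show ?case using words_H assms by (simp add: e_left)
next
  case (words_step g w)
  then show ?case by (simp add: mult.assoc words.words_step)
qed

lemma words_gen: "G \<subseteq> H \<Longrightarrow> g \<in> G \<Longrightarrow> g \<in> words e G"
  using words.words_step[OF _ words.words_unit, of g G e] e_right by auto

definition TW :: "'r set" where "TW = words e (\<tau> ` t_index W n)"

lemma \<tau>_H: "\<tau> ` t_index W n \<subseteq> H"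
  using H_gens by blast

lemma TW_H: "x \<in> TW \<Longrightarrow> x \<in> H"
  unfolding TW_def using words_H[OF _ \<tau>_H] .

lemma TW_mult: "x \<in> TW \<Longrightarrow> y \<in> TW \<Longrightarrow> x * y \<in> TW"
  unfolding TW_def using words_mult[OF \<tau>_H] .

lemma TW_\<tau>: "k \<in> t_index W n \<Longrightarrow> \<tau> k \<in> TW"
  unfolding TW_def using words_gen[OF \<tau>_H] by blast

text \<open>Possibly more than the reflections, but a set that visibly contains the
  \<open>\<tau> k\<close> and is stable under conjugation by them. The finite families are found
  inside it, and the condition on squares is the one that Dietzmann's lemma needs.\<close>

definition refls :: "'r set" where "refls = {r \<in> TW. pm (r * r) e}"

text \<open>Passing to classes turns equality up to sign into the equality that
  \<open>conj_ops\<close> asks for.\<close>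

definition cls_pm :: "'r \<Rightarrow> 'r set" where "cls_pm r = {r, - r}"

definition conj_set :: "nat \<Rightarrow> 'r set \<Rightarrow> 'r set"
  where "conj_set k S = (\<lambda>r. \<tau> k * r * \<tau> k) ` S"

lemma conj_set_cls: "conj_set k (cls_pm r) = cls_pm (\<tau> k * r * \<tau> k)"
  by (simp add: conj_set_def cls_pm_def)

lemma cls_pm_eq: "pm x y \<Longrightarrow> cls_pm x = cls_pm y"
  by (auto simp: pm_def cls_pm_def)

lemma \<tau>\<tau>:
  assumes "k \<in> t_index W n" "x \<in> H"
  shows "\<tau> k * (\<tau> k * x) = x" "x * \<tau> k * \<tau> k = x"
  using \<tau>_cancel[OF assms(1)] assms(2) by (auto simp: H_def)

lemma conj_inv: "k \<in> t_index W n \<Longrightarrow> x \<in> H \<Longrightarrow> \<tau> k * (\<tau> k * x * \<tau> k) * \<tau> k = x"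
  using \<tau>\<tau> H_mult H_gens by (simp add: mult.assoc e_right \<tau>_sq)

lemma refls_conj:
  assumes k: "k \<in> t_index W n" and r: "r \<in> refls"
  shows "\<tau> k * r * \<tau> k \<in> refls"
proof -
  have rTW: "r \<in> TW" and sq: "pm (r * r) e" using r by (auto simp: refls_def)
  have "\<tau> k * r * \<tau> k * (\<tau> k * r * \<tau> k) = \<tau> k * (r * (\<tau> k * (\<tau> k * (r * \<tau> k))))"
    by (simp add: mult.assoc)
  also have "\<dots> = \<tau> k * (r * r) * \<tau> k"
    using \<tau>\<tau>(1)[OF k] TW_H[OF rTW] H_gens k by (simp add: H_mult mult.assoc)
  also have "pm \<dots> (\<tau> k * e * \<tau> k)" by (intro pm_mult_left pm_mult_right sq)
  also have "\<tau> k * e * \<tau> k = e" using k by (simp add: \<Phi>_1_right \<tau>_sq)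
  finally show ?thesis using rTW k by (simp add: refls_def TW_mult TW_\<tau>)
qed

lemma \<tau>_refls: "k \<in> t_index W n \<Longrightarrow> \<tau> k \<in> refls"
  by (simp add: refls_def TW_\<tau> \<tau>_sq pm_refl)

text \<open>Multiply \<open>t_k t_l t_k t_l = -1\<close> by \<open>t_k\<close> on the left and by
  \<open>t_l\<close> on the right.\<close>

lemma anticommute_of_sq:
  assumes k: "k \<in> t_index W n" and l: "l \<in> t_index W n"
    and "spin_weyl_rel W n ((tg k * tg l) ^ 2) (- 1)"
  shows "\<tau> k * \<tau> l = - (\<tau> l * \<tau> k)"
proof -
  have "\<tau> k * \<tau> l * (\<tau> k * \<tau> l) = - e"
    using \<Phi>_rel[OF spin_weyl[OF assms(3)]] by (simp add: power2_eq_square \<Phi>_mult \<Phi>_minus)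
  then have "\<tau> k * (\<tau> k * \<tau> l * (\<tau> k * \<tau> l)) * \<tau> l = \<tau> k * (- e) * \<tau> l" by simp
  moreover have "\<tau> k * (\<tau> k * \<tau> l * (\<tau> k * \<tau> l)) * \<tau> l = \<tau> k * (\<tau> k * (\<tau> l * \<tau> k * \<tau> l * \<tau> l))"
    by (simp add: mult.assoc)
  moreover have "\<dots> = \<tau> l * \<tau> k"
    using H_gens(3)[OF k] H_gens(3)[OF l] by (simp add: \<tau>\<tau> k l H_mult)
  ultimately show ?thesis by (simp add: \<Phi>_1_right)
qed

lemma anticommute_far: "k \<in> {1..<n} \<Longrightarrow> l \<in> {1..<n} \<Longrightarrow> k + 1 < l \<or> l + 1 < k \<Longrightarrow>
    \<tau> k * \<tau> l = - (\<tau> l * \<tau> k)"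
  by (intro anticommute_of_sq t_indexI far)

lemma braid_\<tau>: "1 \<le> k \<Longrightarrow> Suc k < n \<Longrightarrow> \<tau> k * \<tau> (Suc k) * \<tau> k = \<tau> (Suc k) * \<tau> k * \<tau> (Suc k)"
  using \<Phi>_rel[OF spin_weyl[OF braid[of k]]] by (simp add: \<Phi>_mult)

lemma conj_anti:
  assumes "k \<in> t_index W n" "l \<in> t_index W n" "\<tau> k * \<tau> l = - (\<tau> l * \<tau> k)"
  shows "pm (\<tau> k * \<tau> l * \<tau> k) (\<tau> l)"
proof -
  have "\<tau> k * \<tau> l * \<tau> k = - \<tau> l"
    unfolding assms(3) using \<tau>\<tau>[OF assms(1) H_gens(3)[OF assms(2)]] by simp
  then show ?thesis by (simp add: pm_def)
qed

lemma conj_ops_refls: "conj_ops n conj_set (cls_pm ` refls) (\<lambda>k. cls_pm (\<tau> k))"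
proof
  fix k x assume "1 \<le> k" "k < n" "x \<in> cls_pm ` refls"
  then show "conj_set k x \<in> cls_pm ` refls" "conj_set k (conj_set k x) = x"
    using refls_conj[OF t_indexI] conj_inv[OF t_indexI] TW_H
    by (auto simp: conj_set_cls refls_def)
next
  fix k l x assume "1 \<le> k" "k + 1 < l" "l < n" "x \<in> cls_pm ` refls"
  then show "conj_set k (conj_set l x) = conj_set l (conj_set k x)"
    using conj_far[OF anticommute_far[of k l]] by (auto simp: conj_set_cls)
next
  fix k x assume "1 \<le> k" "Suc k < n" "x \<in> cls_pm ` refls"
  then show "conj_set k (conj_set (Suc k) (conj_set k x)) =
      conj_set (Suc k) (conj_set k (conj_set (Suc k) x))"
    using conj_braid[OF braid_\<tau>[of k]] by (auto simp: conj_set_cls)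
next
  fix k l assume "1 \<le> k" "k < n" "1 \<le> l" "l < n" "k + 1 < l \<or> l + 1 < k"
  then show "conj_set k (cls_pm (\<tau> l)) = cls_pm (\<tau> l)"
    unfolding conj_set_cls by (intro cls_pm_eq conj_anti t_indexI anticommute_far) auto
next
  fix k assume k: "1 \<le> k" "k < n"
  then show "cls_pm (\<tau> k) \<in> cls_pm ` refls" using \<tau>_refls t_indexI by auto
  show "conj_set k (cls_pm (\<tau> k)) = cls_pm (\<tau> k)"
    using k \<tau>\<tau>[of k "\<tau> k"] H_gens(3)[OF t_indexI] t_indexI by (simp add: conj_set_cls mult.assoc)
next
  fix k assume "1 \<le> k" "Suc k < n"
  then show "conj_set (Suc k) (cls_pm (\<tau> k)) = conj_set k (cls_pm (\<tau> (Suc k)))"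
    using braid_\<tau>[of k] by (simp add: conj_set_cls)
qed

lemma finite_refls_A:
  "\<exists>F. finite F \<and> F \<subseteq> cls_pm ` refls \<and> (\<forall>k\<in>{1..<n}. cls_pm (\<tau> k) \<in> F \<and> conj_set k ` F \<subseteq> F)"
  by (rule conj_ops.finite_invariant_A[OF conj_ops_refls])

lemma finite_refls_B:
  assumes B: "W = TypeB"
  shows "\<exists>F. finite F \<and> F \<subseteq> cls_pm ` refls \<and> (\<forall>k\<in>{1..n}. cls_pm (\<tau> k) \<in> F \<and> conj_set k ` F \<subseteq> F)"
proof (rule conj_ops_B.finite_invariant, intro conj_ops_B.intro conj_ops_B_axioms.intro conj_ops_refls)
  have n: "2 \<le> n" using adm B by simp
  then show "2 \<le> n" .
  have I: "n \<in> t_index W n" "n - 1 \<in> t_index W n" using n B by auto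
  have far: "\<tau> k * \<tau> n = - (\<tau> n * \<tau> k)" "\<tau> n * \<tau> k = - (\<tau> k * \<tau> n)" "k \<in> t_index W n"
    if "1 \<le> k" "k + 1 < n" for k
  proof -
    show "k \<in> t_index W n" using that B by auto
    then show "\<tau> k * \<tau> n = - (\<tau> n * \<tau> k)"
      using anticommute_of_sq[of k n] far_B[OF B, of k n] that I by auto
    then show "\<tau> n * \<tau> k = - (\<tau> k * \<tau> n)" by simp
  qed
  let ?s = "\<tau> (n - 1)" and ?t = "\<tau> n"
  note H = H_gens(3)[OF I(1)] H_gens(3)[OF I(2)]
  have quad: "?s * ?t * ?s * ?t = - (?t * ?s * ?t * ?s)"
  proof -
    \<comment> \<open>\<open>m\<close> is half of the relation of type B:
      \<open>m * m = - e\<close>, while \<open>?t * ?s * ?t * ?s\<close> is inverse to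
      \<open>m\<close>, so the two agree up to the sign.\<close>
    define m where "m = ?s * ?t * ?s * ?t"
    have m: "m \<in> H" using H by (simp add: m_def H_mult)
    have "m * m = - e"
      using \<Phi>_rel[OF spin_weyl[OF quad_B[OF B]]]
      by (simp add: m_def eval_nat_numeral \<Phi>_mult \<Phi>_minus mult.assoc \<Phi>_1_right)
    moreover have "m * (?t * ?s * ?t * ?s) = e"
    proof -
      have "m * (?t * ?s * ?t * ?s) = ?s * ?t * ?s * (?t * (?t * (?s * ?t * ?s)))"
        by (simp add: m_def mult.assoc)
      also have "\<dots> = ?s * ?t * (?s * (?s * (?t * ?s)))" using H I by (simp add: \<tau>\<tau> H_mult mult.assoc)
      also have "\<dots> = ?s * (?t * (?t * ?s))" using H I by (simp add: \<tau>\<tau> H_mult mult.assoc)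
      also have "\<dots> = e" using H I by (simp add: \<tau>\<tau> \<tau>_sq)
      finally show ?thesis .
    qed
    then have "m * m * (?t * ?s * ?t * ?s) = m" using m by (simp add: mult.assoc e_right)
    ultimately have "m = - e * (?t * ?s * ?t * ?s)" by simp
    then show ?thesis using H by (simp add: m_def e_left H_mult)
  qed
  fix k x
  show "cls_pm ?t \<in> cls_pm ` refls" using \<tau>_refls I by blast
  show "conj_set n (cls_pm ?t) = cls_pm ?t" using H I by (simp add: conj_set_cls \<tau>\<tau> mult.assoc)
  show "conj_set k (cls_pm ?t) = cls_pm ?t" if "1 \<le> k" "k + 1 < n"
    unfolding conj_set_cls by (rule cls_pm_eq, rule conj_anti[OF far(3)[OF that] I(1) far(1)[OF that]])
  show "conj_set n (cls_pm (\<tau> k)) = cls_pm (\<tau> k)" if "1 \<le> k" "k + 1 < n"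
    unfolding conj_set_cls by (rule cls_pm_eq, rule conj_anti[OF I(1) far(3)[OF that] far(2)[OF that]])
  have "?t * (?s * ?t * ?s) * ?t = - (?s * ?t * ?s * ?t) * ?t"
    unfolding quad by (simp add: mult.assoc)
  then have "pm (?t * (?s * ?t * ?s) * ?t) (?s * ?t * ?s)"
    using \<tau>\<tau>(2)[OF I(1), of "?s * ?t * ?s"] H by (simp add: pm_def H_mult)
  then show "conj_set n (conj_set (n - 1) (cls_pm ?t)) = conj_set (n - 1) (cls_pm ?t)"
    unfolding conj_set_cls by (rule cls_pm_eq)
  have "?s * (?t * ?s * ?t) * ?s = - (?t * ?s * ?t * ?s) * ?s"
    using quad by (simp add: mult.assoc)
  then have "pm (?s * (?t * ?s * ?t) * ?s) (?t * ?s * ?t)"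
    using \<tau>\<tau>(2)[OF I(2), of "?t * ?s * ?t"] H by (simp add: pm_def H_mult)
  then show "conj_set (n - 1) (conj_set n (cls_pm ?s)) = conj_set n (cls_pm ?s)"
    unfolding conj_set_cls by (rule cls_pm_eq)
  assume "x \<in> cls_pm ` refls"
  then obtain r where r: "x = cls_pm r" "r \<in> refls" "r \<in> H" using TW_H by (auto simp: refls_def)
  then show "conj_set n x \<in> cls_pm ` refls" "conj_set n (conj_set n x) = x"
    using I refls_conj conj_inv by (auto simp: conj_set_cls)
  show "conj_set k (conj_set n x) = conj_set n (conj_set k x)" if "1 \<le> k" "k + 1 < n"
    using conj_far[OF far(1)[OF that]] by (simp add: r conj_set_cls)
  show "conj_set n (conj_set (n - 1) (conj_set n (conj_set (n - 1) x))) =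
      conj_set (n - 1) (conj_set n (conj_set (n - 1) (conj_set n x)))"
    using conj_quad[OF quad] by (simp add: r conj_set_cls)
qed

lemma finite_refls_D:
  assumes D: "W = TypeD"
  shows "\<exists>F. finite F \<and> F \<subseteq> cls_pm ` refls \<and> (\<forall>k\<in>{1..n}. cls_pm (\<tau> k) \<in> F \<and> conj_set k ` F \<subseteq> F)"
proof (rule conj_ops_D.finite_invariant, intro conj_ops_D.intro conj_ops_D_axioms.intro conj_ops_refls)
  have n: "4 \<le> n" using adm D by simp
  then show "4 \<le> n" .
  have I: "n \<in> t_index W n" "n - 2 \<in> t_index W n" using n D by auto
  have far: "\<tau> k * \<tau> n = - (\<tau> n * \<tau> k)" "\<tau> n * \<tau> k = - (\<tau> k * \<tau> n)" "k \<in> t_index W n"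
    if "1 \<le> k" "k < n" "k \<noteq> n - 2" for k
  proof -
    show "k \<in> t_index W n" using that D by auto
    then show "\<tau> k * \<tau> n = - (\<tau> n * \<tau> k)"
      using anticommute_of_sq[of k n] far_D[OF D, of k n] that I by auto
    then show "\<tau> n * \<tau> k = - (\<tau> k * \<tau> n)" by simp
  qed
  let ?s = "\<tau> (n - 2)" and ?t = "\<tau> n"
  note H = H_gens(3)[OF I(1)] H_gens(3)[OF I(2)]
  have br: "?s * ?t * ?s = ?t * ?s * ?t"
    using \<Phi>_rel[OF spin_weyl[OF braid_D[OF D]]] by (simp add: \<Phi>_mult)
  fix k x
  show "cls_pm ?t \<in> cls_pm ` refls" using \<tau>_refls I by blast
  show "conj_set n (cls_pm ?t) = cls_pm ?t" using H I by (simp add: conj_set_cls \<tau>\<tau> mult.assoc)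
  show "conj_set k (cls_pm ?t) = cls_pm ?t" if "1 \<le> k" "k < n" "k \<noteq> n - 2"
    unfolding conj_set_cls by (rule cls_pm_eq, rule conj_anti[OF far(3)[OF that] I(1) far(1)[OF that]])
  show "conj_set n (cls_pm (\<tau> k)) = cls_pm (\<tau> k)" if "1 \<le> k" "k < n" "k \<noteq> n - 2"
    unfolding conj_set_cls by (rule cls_pm_eq, rule conj_anti[OF I(1) far(3)[OF that] far(2)[OF that]])
  show "conj_set n (cls_pm ?s) = conj_set (n - 2) (cls_pm ?t)" by (simp add: conj_set_cls br)
  assume "x \<in> cls_pm ` refls"
  then obtain r where r: "x = cls_pm r" "r \<in> refls" "r \<in> H" using TW_H by (auto simp: refls_def)
  then show "conj_set n x \<in> cls_pm ` refls" "conj_set n (conj_set n x) = x"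
    using I refls_conj conj_inv by (auto simp: conj_set_cls)
  show "conj_set k (conj_set n x) = conj_set n (conj_set k x)" if "1 \<le> k" "k < n" "k \<noteq> n - 2"
    using conj_far[OF far(1)[OF that]] by (simp add: r conj_set_cls)
  show "conj_set (n - 2) (conj_set n (conj_set (n - 2) x)) =
      conj_set n (conj_set (n - 2) (conj_set n x))"
    using conj_braid[OF br] by (simp add: r conj_set_cls)
qed

lemma finite_refls:
  "\<exists>F. finite F \<and> F \<subseteq> cls_pm ` refls \<and>
    (\<forall>k\<in>t_index W n. cls_pm (\<tau> k) \<in> F \<and> conj_set k ` F \<subseteq> F)"
proof (cases W)
  case TypeA
  then have "t_index W n = {1..<n}" by simp
  then show ?thesis using finite_refls_A by simp
next
  case TypeB
  then have "t_index W n = {1..n}" by simp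
  then show ?thesis using finite_refls_B[OF TypeB] by simp
next
  case TypeD
  then have "t_index W n = {1..n}" by simp
  then show ?thesis using finite_refls_D[OF TypeD] by simp
qed

lemma finite_TW: "\<exists>B. finite B \<and> B \<subseteq> H \<and> (\<forall>x\<in>TW. \<exists>b\<in>B. pm x b)"
proof -
  obtain F where fin: "finite F" and FX: "F \<subseteq> cls_pm ` refls"
    and FK: "\<forall>k\<in>t_index W n. cls_pm (\<tau> k) \<in> F \<and> conj_set k ` F \<subseteq> F"
    using finite_refls by (elim exE conjE)
  have F: "finite F" "F \<subseteq> cls_pm ` refls"
    "\<And>k. k \<in> t_index W n \<Longrightarrow> cls_pm (\<tau> k) \<in> F"
    "\<And>k S. k \<in> t_index W n \<Longrightarrow> S \<in> F \<Longrightarrow> conj_set k S \<in> F"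
    using fin FX FK by auto
  define R where "R = \<Union> F"
  have finR: "finite R" using F(1,2) by (auto simp: R_def cls_pm_def)
  have R_refl: "\<exists>g\<in>refls. pm r g" if "r \<in> R" for r
    using that F(2) by (auto simp: R_def cls_pm_def pm_def)
  have R_H: "r \<in> H" if "r \<in> R" for r
    using R_refl[OF that] H_pm TW_H by (auto simp: refls_def)
  have R_conj: "\<tau> k * r * \<tau> k \<in> R" if k: "k \<in> t_index W n" and r: "r \<in> R" for k r
  proof -
    obtain S where "S \<in> F" "r \<in> S" using r by (auto simp: R_def)
    then have "\<tau> k * r * \<tau> k \<in> conj_set k S" "conj_set k S \<in> F"
      using F(4)[OF k] by (auto simp: conj_set_def)
    then show ?thesis by (auto simp: R_def)
  qed
  have \<tau>_R: "\<tau> k \<in> R" if "k \<in> t_index W n" for k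
    using F(3)[OF that] by (auto simp: R_def cls_pm_def)
  \<comment> \<open>Stability under the generators extends to all words in them, and so, up to sign,
    to the members of \<open>R\<close> themselves. Dietzmann's lemma needs the latter.\<close>
  have TW_conj: "\<forall>s\<in>R. \<exists>s'\<in>R. x * s = s' * x" if "x \<in> TW" for x
    using that unfolding TW_def
  proof (induct rule: words.induct)
    case words_unit
    then show ?case using R_H by (auto simp: e_left e_right)
  next
    case (words_step g w)
    then obtain k where k: "g = \<tau> k" "k \<in> t_index W n" by blast
    have w: "w \<in> H" using words_step(2) TW_H by (simp add: TW_def)
    show ?case
    proof
      fix s assume "s \<in> R"
      then obtain s' where s': "s' \<in> R" "w * s = s' * w" using words_step by blast
      have "\<tau> k * s' * \<tau> k * (\<tau> k * w) = \<tau> k * s' * (\<tau> k * (\<tau> k * w))" by (simp add: mult.assoc)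
      also have "\<dots> = \<tau> k * (w * s)" using \<tau>\<tau>[OF k(2) w] s' by (simp add: mult.assoc)
      finally have "g * w * s = \<tau> k * s' * \<tau> k * (g * w)" by (simp add: k mult.assoc)
      then show "\<exists>s'\<in>R. g * w * s = s' * (g * w)" using R_conj[OF k(2) s'(1)] by blast
    qed
  qed
  have "\<exists>B. finite B \<and> B \<subseteq> words e R \<and> (\<forall>x\<in>words e R. \<exists>b\<in>B. pm x b)"
  proof (rule dietzmann[OF finR])
    fix r assume r: "r \<in> R"
    then show "e * r = r" "r * e = r" using R_H by (simp_all add: e_left e_right)
    obtain g where g: "g \<in> refls" "pm r g" using R_refl[OF r] by blast
    then show "pm (r * r) e" by (auto simp: refls_def pm_def)
    fix s assume "s \<in> R"
    then obtain s' where s': "s' \<in> R" "g * s = s' * g" using TW_conj g by (auto simp: refls_def)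
    then have "pm (r * s) (s' * r)" using g(2) by (auto simp: pm_def)
    then show "\<exists>s'\<in>R. pm (r * s) (s' * r)" using s' by blast
  qed (simp add: \<Phi>_1_left)
  then obtain B where B: "finite B" "B \<subseteq> words e R" "\<And>x. x \<in> words e R \<Longrightarrow> \<exists>b\<in>B. pm x b" by blast
  have "R \<subseteq> H" using R_H by blast
  then have "B \<subseteq> H" using B(2) words_H[of _ R] by blast
  moreover have "\<tau> ` t_index W n \<subseteq> R" using \<tau>_R by blast
  then have "x \<in> words e R" if "x \<in> TW" for x
    using words_mono[of x e "\<tau> ` t_index W n" R] that by (simp only: TW_def)
  ultimately show ?thesis using B(1,3) by blast
qed

end

section \<open>Generation over the even center\<close>

context rsd_hom
begin

definition Z :: "'r set"
  where "Z = {z. (\<exists>f\<in>homog W n False. z = \<Phi> f) \<and> (\<forall>x\<in>H. z * x = x * z)}"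

lemma Z_I: "f \<in> homog W n False \<Longrightarrow> (\<And>x. x \<in> H \<Longrightarrow> \<Phi> f * x = x * \<Phi> f) \<Longrightarrow> \<Phi> f \<in> Z"
  unfolding Z_def by blast

lemma Z_H: "z \<in> Z \<Longrightarrow> z \<in> H"
  unfolding Z_def using H_homog by blast

lemma Z_commute: "z \<in> Z \<Longrightarrow> x \<in> H \<Longrightarrow> z * x = x * z"
  unfolding Z_def by blast

lemma Z_\<kappa>: "\<kappa> c \<in> Z"
  by (rule Z_I) (auto simp: homog_scal H_def \<kappa>_central)

lemma Z_e: "e \<in> Z"
  using Z_\<kappa>[of 1] by (simp add: scal_1)

lemma Z_0: "0 \<in> Z"
  using Z_\<kappa>[of 0] by (simp add: scal_0 \<Phi>_0)

lemma Z_add: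
  assumes "z \<in> Z" "w \<in> Z" shows "z + w \<in> Z"
proof -
  obtain f g where fg: "f \<in> homog W n False" "z = \<Phi> f" "g \<in> homog W n False" "w = \<Phi> g"
    using assms by (auto simp: Z_def)
  have "\<Phi> (f + g) \<in> Z"
  proof (rule Z_I)
    show "f + g \<in> homog W n False" using fg by (intro homog_add)
    show "\<Phi> (f + g) * x = x * \<Phi> (f + g)" if "x \<in> H" for x
      using Z_commute[OF assms(1) that] Z_commute[OF assms(2) that]
      by (simp add: fg \<Phi>_add distrib_left distrib_right)
  qed
  then show ?thesis by (simp add: fg \<Phi>_add)
qed

lemma Z_mult:
  assumes "z \<in> Z" "w \<in> Z" shows "z * w \<in> Z"
proof -
  obtain f g where fg: "f \<in> homog W n False" "z = \<Phi> f" "g \<in> homog W n False" "w = \<Phi> g"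
    using assms by (auto simp: Z_def)
  have "\<Phi> (f * g) \<in> Z"
  proof (rule Z_I)
    show "f * g \<in> homog W n False" using homog_mult[OF fg(1,3)] by simp
    show "\<Phi> (f * g) * x = x * \<Phi> (f * g)" if "x \<in> H" for x
      using commute_prod[OF Z_commute[OF assms(1) that, symmetric] Z_commute[OF assms(2) that, symmetric]]
      by (simp add: fg \<Phi>_mult)
  qed
  then show ?thesis by (simp add: fg \<Phi>_mult)
qed

lemma Z_minus: "z \<in> Z \<Longrightarrow> - z \<in> Z"
proof -
  assume z: "z \<in> Z"
  have "\<kappa> (- 1) = - e" by (simp add: scal_def single_uminus \<Phi>_minus)
  then have "\<kappa> (- 1) * z = - z" using e_left[OF Z_H[OF z]] by simp
  then show ?thesis using Z_mult[OF Z_\<kappa> z] by metis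
qed

section \<open>Finite spans over the even center\<close>

inductive_set zspan :: "'r set \<Rightarrow> 'r set" for B where
  zspan_0: "0 \<in> zspan B"
| zspan_step: "z \<in> Z \<Longrightarrow> b \<in> B \<Longrightarrow> x \<in> zspan B \<Longrightarrow> z * b + x \<in> zspan B"

lemma zspan_add: "x \<in> zspan B \<Longrightarrow> y \<in> zspan B \<Longrightarrow> x + y \<in> zspan B"
  by (induct rule: zspan.induct) (auto simp: add.assoc intro: zspan.intros)

lemma zspan_scale: "x \<in> zspan B \<Longrightarrow> z \<in> Z \<Longrightarrow> z * x \<in> zspan B"
  by (induct rule: zspan.induct)
    (auto simp: distrib_left Z_mult zspan_0 simp flip: mult.assoc intro!: zspan_step)

lemma zspan_base: "B \<subseteq> H \<Longrightarrow> b \<in> B \<Longrightarrow> b \<in> zspan B"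
  using zspan_step[OF Z_e _ zspan_0, of b B] e_left by auto

lemma zspan_minus: "x \<in> zspan B \<Longrightarrow> - x \<in> zspan B"
proof (induct rule: zspan.induct)
  case (zspan_step z b x)
  have "- z * b + - x \<in> zspan B" by (rule zspan.zspan_step[OF Z_minus]) (use zspan_step in auto)
  then show ?case by simp
qed (simp add: zspan_0)

lemma zspan_pm: "pm x y \<Longrightarrow> y \<in> zspan B \<Longrightarrow> x \<in> zspan B"
  using zspan_minus by (auto simp: pm_def)

lemma zspan_subset: "x \<in> zspan X \<Longrightarrow> X \<subseteq> zspan B \<Longrightarrow> x \<in> zspan B"
  by (induct rule: zspan.induct) (auto intro: zspan_0 zspan_add zspan_scale)

lemma zspan_mult:
  assumes "x \<in> zspan A" "y \<in> zspan B" "A \<subseteq> H" "B \<subseteq> H"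
  shows "x * y \<in> zspan ((\<lambda>(a, b). a * b) ` (A \<times> B))" (is "_ \<in> zspan ?AB")
proof -
  have *: "a * y \<in> zspan ?AB" if "a \<in> A" for a
    using assms(2)
  proof (induct rule: zspan.induct)
    case zspan_0
    then show ?case by (simp add: zspan.zspan_0)
  next
    case (zspan_step z b x)
    have "a * (z * b) = z * (a * b)"
      using Z_commute[OF zspan_step(1), of a] that assms(3) by (auto simp flip: mult.assoc)
    then show ?case using zspan.zspan_step[OF zspan_step(1) _ zspan_step(4), of "a * b"] zspan_step that
      by (auto simp: distrib_left)
  qed
  show ?thesis using assms(1)
    by (induct rule: zspan.induct)
      (auto simp: distrib_right mult.assoc zspan_0 intro!: zspan_add zspan_scale *)
qed

definition fin_spanned :: "'r set \<Rightarrow> bool"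
  where "fin_spanned X \<longleftrightarrow> (\<exists>B. finite B \<and> B \<subseteq> H \<and> X \<subseteq> zspan B)"

lemma fin_spanned_span:
  assumes "fin_spanned X" "X' \<subseteq> zspan X" shows "fin_spanned X'"
proof -
  obtain B where B: "finite B" "B \<subseteq> H" "X \<subseteq> zspan B" using assms(1) unfolding fin_spanned_def by (elim exE conjE)
  then have "X' \<subseteq> zspan B" using assms(2) zspan_subset[OF _ B(3)] by auto
  then show ?thesis unfolding fin_spanned_def using B by (intro exI[of _ B] conjI)
qed

lemma fin_spanned_mult:
  assumes "fin_spanned X" "fin_spanned X'" shows "fin_spanned ((\<lambda>(x, y). x * y) ` (X \<times> X'))"
proof -
  obtain A B where A: "finite A" "A \<subseteq> H" "X \<subseteq> zspan A" and B: "finite B" "B \<subseteq> H" "X' \<subseteq> zspan B"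
    using assms unfolding fin_spanned_def by (elim exE conjE)
  show ?thesis unfolding fin_spanned_def
  proof (intro exI conjI)
    show "finite ((\<lambda>(a, b). a * b) ` (A \<times> B))" using A B by simp
    show "(\<lambda>(a, b). a * b) ` (A \<times> B) \<subseteq> H" using A(2) B(2) by (auto intro: H_mult)
    show "(\<lambda>(x, y). x * y) ` (X \<times> X') \<subseteq> zspan ((\<lambda>(a, b). a * b) ` (A \<times> B))"
      using A(3) B(3) by (auto intro!: zspan_mult A(2) B(2))
  qed
qed

lemma fin_spanned_pm:
  assumes "finite B" "B \<subseteq> H" "\<And>x. x \<in> X \<Longrightarrow> \<exists>b\<in>B. pm x b" shows "fin_spanned X"
  unfolding fin_spanned_def
proof (intro exI conjI subsetI)
  fix x assume "x \<in> X"
  then obtain b where "b \<in> B" "pm x b" using assms(3) by blast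
  then show "x \<in> zspan B" by (intro zspan_pm[of x b] zspan_base assms(2))
qed (use assms in auto)

lemma fin_spanned_TW: "fin_spanned TW"
  using finite_TW fin_spanned_pm by metis

lemma \<Phi>_power_add: "\<Phi> (g ^ (a + b)) = \<Phi> (g ^ a) * \<Phi> (g ^ b)"
  by (simp add: power_add \<Phi>_mult)

text \<open>The relation is monic of degree \<open>n\<close> in the square of \<open>g\<close>, so
  every power from \<open>g ^ (2 * n)\<close> on reduces to lower ones.\<close>

lemma fin_spanned_powers:
  assumes g: "g \<in> carrier (free_alg W n)" and n: "1 \<le> n"
    and rel: "(\<Sum>k\<le>n. c k * \<Phi> (g ^ (2 * (n - k)))) = 0" and c: "c 0 = e" "\<And>k. c k \<in> Z"
  shows "fin_spanned (words e {\<Phi> g})"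
proof -
  have gH: "\<Phi> (g ^ k) \<in> H" for k
    by (induct k) (use g in \<open>auto simp: H_e \<Phi>_mult intro!: H_mult H_I\<close>)
  let ?B = "(\<lambda>k. \<Phi> (g ^ k)) ` {..<2 * n}"
  have pow: "\<Phi> (g ^ m) \<in> zspan ?B" for m
  proof (induct m rule: less_induct)
    case (less m)
    show ?case
    proof (cases "m < 2 * n")
      case True
      then show ?thesis by (intro zspan_base) (auto intro: gH)
    next
      case False
      then obtain d where m: "m = 2 * n + d" using le_Suc_ex not_less by blast
      have "0 = (\<Sum>k\<le>n. c k * \<Phi> (g ^ (2 * (n - k)))) * \<Phi> (g ^ d)" using rel by simp
      also have "\<dots> = (\<Sum>k\<le>n. c k * \<Phi> (g ^ (2 * (n - k) + d)))"
        by (simp add: sum_distrib_right mult.assoc \<Phi>_power_add)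
      \<comment> \<open>The term \<open>k = 0\<close> is the power to be reduced, because
        \<open>c 0 = e\<close>.\<close>
      also have "\<dots> = \<Phi> (g ^ m) + (\<Sum>k\<in>{1..n}. c k * \<Phi> (g ^ (2 * (n - k) + d)))"
        by (subst sum.atMost_shift) (simp add: c \<Phi>_1_left m sum.atLeast1_atMost_eq lessThan_Suc_atMost)
      finally have "\<Phi> (g ^ m) = - (\<Sum>k\<in>{1..n}. c k * \<Phi> (g ^ (2 * (n - k) + d)))"
        by (simp add: eq_neg_iff_add_eq_0)
      moreover have "(\<Sum>k\<in>K. c k * \<Phi> (g ^ (2 * (n - k) + d))) \<in> zspan ?B"
        if "finite K" "K \<subseteq> {1..n}" for K
        using that
      proof (induct K)
        case empty
        show ?case by (simp add: zspan_0)
      next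
        case (insert k K)
        then have "2 * (n - k) + d < m" using m by auto
        then show ?case using insert less c(2) by (simp add: zspan_add zspan_scale)
      qed
      ultimately show ?thesis using zspan_minus by auto
    qed
  qed
  have "\<exists>k. x = \<Phi> (g ^ k)" if "x \<in> words e {\<Phi> g}" for x
    using that
  proof (induct rule: words.induct)
    case words_unit
    show ?case by (rule exI[of _ 0]) simp
  next
    case (words_step h w)
    then show ?case by (metis \<Phi>_mult power_Suc singletonD)
  qed
  then show ?thesis unfolding fin_spanned_def using pow gH by (intro exI[of _ ?B]) blast
qed

lemma pm_swap_words:
  assumes "w \<in> words e {g}" "pm (h * g) (g * h)" "h \<in> H"
  shows "pm (h * w) (w * h)"
  using assms(1)
proof (induct rule: words.induct)
  case words_unit
  then show ?case using assms(3) by (simp add: e_left e_right pm_refl)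
next
  case (words_step g' w)
  have "pm (h * g * w) (g * h * w)" by (rule pm_mult_right[OF assms(2)])
  also have "pm (g * h * w) (g * (w * h))" using pm_mult_left[OF words_step(3)] by (simp add: mult.assoc)
  finally show ?case using words_step(1) by (simp add: mult.assoc)
qed

text \<open>Up to sign the factors equal to \<open>\<gamma> i\<close> can be collected in front, so
  a word splits into a power of one generator and a word in the others.\<close>

lemma fin_spanned_words:
  assumes "finite I" "\<And>i. i \<in> I \<Longrightarrow> \<gamma> i \<in> H" "\<And>i. i \<in> I \<Longrightarrow> fin_spanned (words e {\<gamma> i})"
    and "\<And>i j. i \<in> I \<Longrightarrow> j \<in> I \<Longrightarrow> pm (\<gamma> i * \<gamma> j) (\<gamma> j * \<gamma> i)"
  shows "fin_spanned (words e (\<gamma> ` I))"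
  using assms
proof (induct I)
  case empty
  have "x = e" if "x \<in> words e {}" for x using that by (induct rule: words.induct) auto
  then show ?case using fin_spanned_pm[of "{e}" "words e {}"] H_e pm_refl by auto
next
  case (insert i I)
  let ?P = "(\<lambda>(x, y). x * y) ` (words e {\<gamma> i} \<times> words e (\<gamma> ` I))"
  have sub: "{\<gamma> i} \<subseteq> H" "\<gamma> ` I \<subseteq> H" using insert.prems(1) by auto
  have PI: "a * b \<in> ?P" if "a \<in> words e {\<gamma> i}" "b \<in> words e (\<gamma> ` I)" for a b
    by (rule image_eqI[of _ _ "(a, b)"]) (use that in auto)
  have P: "\<exists>p\<in>?P. pm x p" if "x \<in> words e (\<gamma> ` insert i I)" for x
    using that
  proof (induct rule: words.induct)
    case words_unit
    have "e * e \<in> ?P" by (intro PI words.words_unit)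
    then show ?case by (rule bexI[rotated]) (simp add: \<Phi>_1_left pm_refl)
  next
    case (words_step h w)
    then obtain a b where ab: "a \<in> words e {\<gamma> i}" "b \<in> words e (\<gamma> ` I)" "pm w (a * b)" by auto
    show ?case
    proof (cases "h = \<gamma> i")
      case True
      then have "h * a * b \<in> ?P" using ab by (intro PI) (auto intro: words.intros)
      moreover have "pm (h * w) (h * a * b)" using pm_mult_left[OF ab(3)] by (simp add: mult.assoc)
      ultimately show ?thesis by (rule bexI[rotated])
    next
      case False
      then obtain j where j: "h = \<gamma> j" "j \<in> I" using words_step by auto
      have "pm (h * w) (h * a * b)" using pm_mult_left[OF ab(3)] by (simp add: mult.assoc)
      also have "pm (h * a * b) (a * h * b)"
        by (rule pm_mult_right, rule pm_swap_words[OF ab(1)]) (use insert.prems j in auto)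
      finally have "pm (h * w) (a * (h * b))" by (simp add: mult.assoc)
      moreover have "a * (h * b) \<in> ?P" using ab j by (intro PI) (auto intro: words.intros)
      ultimately show ?thesis by (rule bexI)
    qed
  qed
  have PH: "?P \<subseteq> H"
  proof
    fix p assume "p \<in> ?P"
    then obtain a b where "p = a * b" "a \<in> words e {\<gamma> i}" "b \<in> words e (\<gamma> ` I)" by auto
    then show "p \<in> H" using words_H[OF _ sub(1), of a] words_H[OF _ sub(2), of b] by (simp add: H_mult)
  qed
  have "words e (\<gamma> ` insert i I) \<subseteq> zspan ?P"
  proof
    fix x assume "x \<in> words e (\<gamma> ` insert i I)"
    from P[OF this] obtain p where "p \<in> ?P" "pm x p" by (elim bexE)
    then show "x \<in> zspan ?P" by (intro zspan_pm[of x p] zspan_base[OF PH])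
  qed
  moreover have "fin_spanned ?P"
  proof (rule fin_spanned_mult)
    show "fin_spanned (words e {\<gamma> i})" using insert.prems(2) by simp
    show "fin_spanned (words e (\<gamma> ` I))" using insert.prems by (intro insert.hyps(3)) auto
  qed
  ultimately show ?case by (rule fin_spanned_span[rotated])
qed

section \<open>Integrality of the generators over the even center\<close>

lemma eval_at_homog:
  assumes "\<And>i. i \<in> {1..n} \<Longrightarrow> z i \<in> homog W n False"
  shows "eval_at n z p \<in> homog W n False"
proof -
  have pl: "prod_list (map (\<lambda>i. z i ^ Poly_Mapping.lookup m i) l) \<in> homog W n False"
    if "set l \<subseteq> {1..n}" for l and m :: "nat \<Rightarrow>\<^sub>0 nat"
    using that
  proof (induct l)
    case (Cons i l)
    then have "z i ^ Poly_Mapping.lookup m i \<in> homog W n False"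
      using homog_pow[OF assms, of i] by simp
    then show ?case using Cons homog_mult by fastforce
  qed (simp add: homog_1)
  then show ?thesis unfolding eval_at_def by (intro homog_sum homog_scal_mult pl) auto
qed

lemma xg2_homog: "i \<in> {1..n} \<Longrightarrow> xg2 i \<in> homog W n False"
  using homog_pow[OF homog_x, of i n 2] by simp

lemma ev_y_Z: "p \<in> invariants W n act_y \<Longrightarrow> ev yg p \<in> Z"
  unfolding ev_def using y_invariant_central[of p]
  by (intro Z_I eval_at_homog homog_y) (auto simp: ev_def H_def)

lemma ev_xi_Z: "p \<in> invariants W n act_xi_sq \<Longrightarrow> ev xg2 p \<in> Z"
  unfolding ev_def using xi_sq_invariant_central[of p]
  by (intro Z_I eval_at_homog xg2_homog) (auto simp: ev_def H_def)

lemma weyl_permutes: "(\<sigma>, S) \<in> weyl W n \<Longrightarrow> \<sigma> permutes {1..n}"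
  by (cases W) auto

text \<open>Squares are taken because sign changes fix \<open>y_j^2\<close> but not
  \<open>y_j\<close>; this choice serves all three types at once.\<close>

lemma esym_y_invariant: "esym n (\<lambda>j. var j ^ 2) k \<in> invariants W n act_y"
proof -
  have "esym n (\<lambda>j. var j ^ 2) k \<in> polys n"
    by (intro esym_polys) (auto simp: power2_eq_square intro!: polys_mult polys_var)
  moreover have "subst (act_y w) (esym n (\<lambda>j. var j ^ 2) k) = esym n (\<lambda>j. var j ^ 2) k"
    if "w \<in> weyl W n" for w
  proof -
    obtain \<sigma> S where w: "w = (\<sigma>, S)" by (cases w)
    show ?thesis using weyl_permutes[of \<sigma> S] that
      by (intro subst_esym[of \<sigma>]) (auto simp: w subst_power subst_var)
  qed
  ultimately show ?thesis by (auto simp: invariants_def polys_def)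
qed

lemma esym_xi_invariant: "esym n var k \<in> invariants W n act_xi_sq"
proof -
  have "esym n var k \<in> polys n" by (intro esym_polys polys_var)
  moreover have "subst (act_xi_sq w) (esym n var k) = esym n var k" if "w \<in> weyl W n" for w
  proof -
    obtain \<sigma> S where w: "w = (\<sigma>, S)" by (cases w)
    show ?thesis using weyl_permutes[of \<sigma> S] that
      by (intro subst_esym[of \<sigma>]) (auto simp: w subst_var)
  qed
  ultimately show ?thesis by (auto simp: invariants_def polys_def)
qed

lemma ev_sum: "ev z (sum f A) = (\<Sum>a\<in>A. ev z (f a))"
  by (induct A rule: infinite_finite_induct) (simp_all add: ev_0 ev_add)

lemma ev_y_power: "i \<in> {1..n} \<Longrightarrow> ev yg (var i ^ m) = \<Phi> (yg i ^ m)"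
  by (induct m) (simp_all add: ev_1 ev_y_mult ev_var \<Phi>_mult)

lemma ev_xi_power: "i \<in> {1..n} \<Longrightarrow> ev xg2 (var i ^ m) = \<Phi> (xg2 i ^ m)"
  by (induct m) (simp_all add: ev_1 ev_xi_mult ev_var \<Phi>_mult)

lemma fin_spanned_y: assumes "i \<in> {1..n}" shows "fin_spanned (words e {\<eta> i})"
proof (rule fin_spanned_powers)
  show "yg i \<in> carrier (free_alg W n)" using homog_y[OF assms] carrier_homog by blast
  have "ev yg (\<Sum>k\<le>n. esym n (\<lambda>j. var j ^ 2) k * (var i ^ 2) ^ (n - k)) = 0"
    using esym_root[OF assms, of "\<lambda>j. var j ^ 2"] by (simp add: ev_0)
  then show "(\<Sum>k\<le>n. ev yg (esym n (\<lambda>j. var j ^ 2) k) * \<Phi> (yg i ^ (2 * (n - k)))) = 0"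
    by (simp add: ev_sum ev_y_mult ev_y_power[OF assms] flip: power_mult)
qed (use assms in \<open>auto simp: esym_0 ev_1 intro: ev_y_Z esym_y_invariant\<close>)

lemma fin_spanned_xi: assumes "i \<in> {1..n}" shows "fin_spanned (words e {\<xi> i})"
proof (rule fin_spanned_powers)
  show "xg i \<in> carrier (free_alg W n)" using homog_x[OF assms] carrier_homog by blast
  have "ev xg2 (\<Sum>k\<le>n. esym n var k * var i ^ (n - k)) = 0"
    using esym_root[OF assms, of var] by (simp add: ev_0)
  then show "(\<Sum>k\<le>n. ev xg2 (esym n var k) * \<Phi> (xg i ^ (2 * (n - k)))) = 0"
    by (simp add: ev_sum ev_xi_mult ev_xi_power[OF assms] power_mult)
qed (use assms in \<open>auto simp: esym_0 ev_1 intro: ev_xi_Z esym_xi_invariant\<close>)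

section \<open>Normal products span the algebra\<close>

definition YW :: "'r set" where "YW = words e (\<eta> ` {1..n})"
definition XW :: "'r set" where "XW = words e (\<xi> ` {1..n})"

lemma fin_spanned_YW: "fin_spanned YW"
  unfolding YW_def
proof (intro fin_spanned_words fin_spanned_y)
  fix i j assume "i \<in> {1..n}" "j \<in> {1..n}"
  from y_commute[OF this] show "pm (\<eta> i * \<eta> j) (\<eta> j * \<eta> i)" by (simp add: pm_def)
qed (auto intro: H_gens)

lemma fin_spanned_XW: "fin_spanned XW"
  unfolding XW_def
proof (intro fin_spanned_words fin_spanned_xi)
  fix i j assume ij: "i \<in> {1..n}" "j \<in> {1..n}"
  show "pm (\<xi> i * \<xi> j) (\<xi> j * \<xi> i)"
  proof (cases "i = j")
    case False
    from xi_anticommute[OF ij this] show ?thesis by (simp add: pm_def)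
  qed (simp add: pm_refl)
qed (auto intro: H_gens)

definition normal_products :: "'r set"
  where "normal_products = (\<lambda>(y, s). y * s) ` (YW \<times> (\<lambda>(x, t). x * t) ` (XW \<times> TW))"

lemma fin_spanned_normal_products: "fin_spanned normal_products"
  unfolding normal_products_def by (intro fin_spanned_mult fin_spanned_YW fin_spanned_XW fin_spanned_TW)

lemma normal_productsI: "y \<in> YW \<Longrightarrow> x \<in> XW \<Longrightarrow> t \<in> TW \<Longrightarrow> y * (x * t) \<in> normal_products"
  unfolding normal_products_def by force

lemma normal_productsE:
  assumes "m \<in> normal_products" obtains y x t where "m = y * (x * t)" "y \<in> YW" "x \<in> XW" "t \<in> TW"
  using assms by (auto simp: normal_products_def)

lemma YW_H: "y \<in> YW \<Longrightarrow> y \<in> H" and XW_H: "x \<in> XW \<Longrightarrow> x \<in> H"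
  unfolding YW_def XW_def by (erule words_H, use H_gens in blast)+

lemma normal_products_H: "normal_products \<subseteq> H"
proof
  fix m assume "m \<in> normal_products"
  then obtain y x t where "m = y * (x * t)" "y \<in> YW" "x \<in> XW" "t \<in> TW" by (rule normal_productsE)
  then show "m \<in> H" by (simp add: H_mult YW_H XW_H TW_H)
qed

text \<open>Its members form a subring containing the scalars, so only the generators have to be
  tested. Applied to the unit, which is a normal product, this yields spanning.\<close>

definition stab :: "'r set" where "stab = {c \<in> H. \<forall>m\<in>zspan normal_products. c * m \<in> zspan normal_products}"

lemma stabI:
  assumes "c \<in> H" "\<And>y x t. y \<in> YW \<Longrightarrow> x \<in> XW \<Longrightarrow> t \<in> TW \<Longrightarrow> c * (y * (x * t)) \<in> zspan normal_products"
  shows "c \<in> stab"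
proof -
  have "c * m \<in> zspan normal_products" if "m \<in> zspan normal_products" for m
    using that
  proof (induct rule: zspan.induct)
    case zspan_0
    then show ?case by (simp add: zspan.zspan_0)
  next
    case (zspan_step z b x)
    have "c * b \<in> zspan normal_products" using zspan_step(2) assms(2) by (auto elim!: normal_productsE)
    moreover have "c * (z * b) = z * (c * b)"
      using Z_commute[OF zspan_step(1) assms(1)] by (simp flip: mult.assoc)
    ultimately show ?case using zspan_step by (simp add: distrib_left zspan_add zspan_scale)
  qed
  then show ?thesis using assms(1) by (simp add: stab_def)
qed

lemma stab_add: "c \<in> stab \<Longrightarrow> d \<in> stab \<Longrightarrow> c + d \<in> stab"
  by (auto simp: stab_def distrib_right intro: H_add zspan_add)

lemma stab_minus: "c \<in> stab \<Longrightarrow> - c \<in> stab"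
  by (auto simp: stab_def intro: H_minus zspan_minus)

lemma stab_mult: "c \<in> stab \<Longrightarrow> d \<in> stab \<Longrightarrow> c * d \<in> stab"
  by (auto simp: stab_def mult.assoc intro: H_mult)

lemma stab_\<kappa>: "\<kappa> c \<in> stab"
  by (auto simp: stab_def intro: Z_H Z_\<kappa> zspan_scale)

lemma stab_0: "0 \<in> stab" and stab_e: "e \<in> stab"
  using stab_\<kappa>[of 0] stab_\<kappa>[of 1] by (simp_all add: scal_0 scal_1 \<Phi>_0)

lemma stab_sum: "(\<And>a. a \<in> A \<Longrightarrow> f a \<in> stab) \<Longrightarrow> sum f A \<in> stab"
  by (induct A rule: infinite_finite_induct) (auto intro: stab_add stab_0)

lemma stab_\<eta>: assumes "i \<in> {1..n}" shows "\<eta> i \<in> stab"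
proof (rule stabI)
  fix y x t assume "y \<in> YW" "x \<in> XW" "t \<in> TW"
  then have "\<eta> i * y \<in> YW" "x \<in> XW" "t \<in> TW" using assms by (auto simp: YW_def intro: words.intros)
  then have "\<eta> i * y * (x * t) \<in> zspan normal_products" by (intro zspan_base normal_products_H normal_productsI)
  then show "\<eta> i * (y * (x * t)) \<in> zspan normal_products" by (simp add: mult.assoc)
qed (rule H_gens(2)[OF assms])

lemma \<tau>_swap_words:
  assumes "w \<in> words e (\<gamma> ` I)" "t \<in> H" "\<And>i. i \<in> I \<Longrightarrow> \<exists>j\<in>I. pm (t * \<gamma> i) (\<gamma> j * t)"
  shows "\<exists>w'\<in>words e (\<gamma> ` I). pm (t * w) (w' * t)"
  using assms(1)
proof (induct rule: words.induct)
  case words_unit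
  show ?case using assms(2) by (auto simp: e_left e_right pm_refl intro!: bexI[of _ e] words.intros)
next
  case (words_step g w)
  then obtain i w' where iw: "g = \<gamma> i" "i \<in> I" "w' \<in> words e (\<gamma> ` I)" "pm (t * w) (w' * t)" by auto
  obtain j where j: "j \<in> I" "pm (t * \<gamma> i) (\<gamma> j * t)" using assms(3) iw by blast
  have "pm (t * \<gamma> i * w) (\<gamma> j * t * w)" by (rule pm_mult_right[OF j(2)])
  also have "pm (\<gamma> j * t * w) (\<gamma> j * (w' * t))" using pm_mult_left[OF iw(4)] by (simp add: mult.assoc)
  finally have "pm (t * (g * w)) (\<gamma> j * w' * t)" by (simp add: iw mult.assoc)
  then show ?case using iw j by (auto intro!: bexI[of _ "\<gamma> j * w'"] words.intros)
qed

lemma stab_\<tau>: assumes k: "k \<in> t_index W n" shows "\<tau> k \<in> stab"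
proof (rule stabI)
  obtain \<sigma> S where s: "moves (tg k) \<sigma> S" "\<sigma> permutes {1..n}" using t_weyl[OF k] by metis
  have \<sigma>: "\<sigma> i \<in> {1..n}" if "i \<in> {1..n}" for i using permutes_in_image[OF s(2)] that by blast
  have \<eta>: "\<exists>j\<in>{1..n}. pm (\<tau> k * \<eta> i) (\<eta> j * \<tau> k)" if "i \<in> {1..n}" for i
    using s(1) that \<sigma>[OF that] by (intro bexI[of _ "\<sigma> i"]) (auto simp: moves_def pm_def)
  have \<xi>: "\<exists>j\<in>{1..n}. pm (\<tau> k * \<xi> i) (\<xi> j * \<tau> k)" if "i \<in> {1..n}" for i
    using s(1) that \<sigma>[OF that] by (intro bexI[of _ "\<sigma> i"]) (auto simp: moves_def pm_def)
  fix y x t assume yxt: "y \<in> YW" "x \<in> XW" "t \<in> TW"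
  obtain y' where y': "y' \<in> YW" "pm (\<tau> k * y) (y' * \<tau> k)"
    using \<tau>_swap_words[OF yxt(1)[unfolded YW_def] H_gens(3)[OF k] \<eta>] by (auto simp: YW_def)
  obtain x' where x': "x' \<in> XW" "pm (\<tau> k * x) (x' * \<tau> k)"
    using \<tau>_swap_words[OF yxt(2)[unfolded XW_def] H_gens(3)[OF k] \<xi>] by (auto simp: XW_def)
  have "pm (\<tau> k * y * (x * t)) (y' * \<tau> k * (x * t))" by (rule pm_mult_right[OF y'(2)])
  also have "y' * \<tau> k * (x * t) = y' * (\<tau> k * x * t)" by (simp add: mult.assoc)
  also have "pm \<dots> (y' * (x' * \<tau> k * t))" by (intro pm_mult_left pm_mult_right x'(2))
  also have "y' * (x' * \<tau> k * t) = y' * (x' * (\<tau> k * t))" by (simp add: mult.assoc)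
  finally have "pm (\<tau> k * (y * (x * t))) (y' * (x' * (\<tau> k * t)))" by (simp add: mult.assoc)
  moreover have "y' * (x' * (\<tau> k * t)) \<in> zspan normal_products"
    by (intro zspan_base normal_products_H normal_productsI y' x' TW_mult TW_\<tau> k yxt)
  ultimately show "\<tau> k * (y * (x * t)) \<in> zspan normal_products" by (rule zspan_pm)
qed (rule H_gens(3)[OF k])

lemma stab_\<tau>s: "set l \<subseteq> t_index W n \<Longrightarrow> \<Phi> (prod_list (map tg l)) \<in> stab"
  by (induct l) (auto simp: stab_e \<Phi>_mult intro: stab_mult stab_\<tau>)

lemma stab_up: "1 \<le> i \<Longrightarrow> j < n \<Longrightarrow> \<Phi> (t_up i j) \<in> stab"
  and stab_down: "1 \<le> i \<Longrightarrow> j < n \<Longrightarrow> \<Phi> (t_down j i) \<in> stab"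
  unfolding t_up_def t_down_def by (intro stab_\<tau>s; auto simp del: upt_Suc intro!: t_indexI)+

lemma stab_sgn: "\<Phi> ((- 1) ^ k) \<in> stab"
  unfolding \<Phi>_sgn by (auto intro: stab_e stab_minus)

lemmas stab_intros = stab_mult stab_sgn stab_up stab_down stab_\<tau>

lemma stab_br:
  assumes "i \<in> {1..n}" "j \<in> {1..n}" "i \<noteq> j" shows "\<Phi> (br i j) \<in> stab"
proof -
  have "\<Phi> (br_less i j) \<in> stab" if "1 \<le> i" "i < j" "j \<le> n" for i j
    unfolding br_less_def \<Phi>_mult using that by (intro stab_intros t_indexI) auto
  then show ?thesis using assms by (auto simp: br_def \<Phi>_minus intro!: stab_minus)
qed

lemma stab_bar:
  assumes "i \<in> {1..n}" "j \<in> {1..n}" "i \<noteq> j" shows "\<Phi> (bar i j) \<in> stab"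
proof -
  have "\<Phi> (obarD_less n i j) \<in> stab" if "1 \<le> i" "i < j" "j \<le> n" "W = TypeD" for i j
    unfolding obarD_less_def \<Phi>_mult using that by (intro stab_intros) auto
  moreover have "\<Phi> (obarB_less n i j) \<in> stab" if "1 \<le> i" "i < j" "j \<le> n" "W = TypeB" for i j
    unfolding obarB_less_def \<Phi>_mult using that by (intro stab_intros) auto
  ultimately show ?thesis using assms stab_0 by (cases W) (auto simp: obarB_def obarD_def \<Phi>_0)
qed

lemma stab_sing: assumes "i \<in> {1..n}" shows "\<Phi> (sing i) \<in> stab"
proof -
  have "\<Phi> (obarB1 n i) \<in> stab" if "W = TypeB"
    unfolding obarB1_def \<Phi>_mult using that assms by (intro stab_intros) auto
  then show ?thesis using stab_0 by (cases W) (auto simp: \<Phi>_0)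
qed

text \<open>The commutator is a combination of products of the \<open>t_k\<close>, which are in
  \<open>stab\<close> already; nothing about the \<open>\<xi>\<close> as multipliers is
  presupposed.\<close>

lemma stab_commutator:
  assumes "i \<in> {1..n}" "j \<in> {1..n}" shows "\<eta> j * \<xi> i - \<xi> i * \<eta> j \<in> stab"
proof (cases "i = j")
  case True
  show ?thesis unfolding True y_xi_commutator_same[OF assms(2)]
    by (intro stab_add stab_mult stab_\<kappa> stab_sum stab_br stab_bar stab_sing assms) auto
next
  case False
  show ?thesis unfolding y_xi_commutator[OF assms False] unfolding diff_conv_add_uminus
    by (intro stab_add stab_mult stab_\<kappa> stab_minus stab_br stab_bar assms False)
qed

text \<open>Induction on the \<open>y\<close>-word: \<open>\<xi> i * \<eta> j\<close> is
  \<open>\<eta> j * \<xi> i\<close> minus the commutator. The first term is settled by the induction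
  hypothesis and \<open>stab_\<eta>\<close>, the second by \<open>stab_commutator\<close>.\<close>

lemma stab_\<xi>: assumes i: "i \<in> {1..n}" shows "\<xi> i \<in> stab"
proof (rule stabI)
  fix y x t assume "y \<in> YW" and xt: "x \<in> XW" "t \<in> TW"
  from \<open>y \<in> YW\<close> show "\<xi> i * (y * (x * t)) \<in> zspan normal_products"
    unfolding YW_def
  proof (induct rule: words.induct)
    case words_unit
    have "\<xi> i * x \<in> XW" using xt i by (auto simp: XW_def intro: words.intros)
    then have "e * (\<xi> i * x * t) \<in> zspan normal_products"
      by (intro zspan_base normal_products_H normal_productsI xt) (auto simp: YW_def intro: words.intros)
    moreover have "x * t \<in> H" "\<xi> i * x * t \<in> H" using XW_H[OF xt(1)] TW_H[OF xt(2)] H_gens i by (auto intro!: H_mult)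
    ultimately show ?case by (simp add: e_left mult.assoc)
  next
    case (words_step g w)
    then obtain j where j: "g = \<eta> j" "j \<in> {1..n}" by blast
    let ?m = "w * (x * t)"
    have m: "?m \<in> zspan normal_products" using words_step(2) by (intro zspan_base normal_products_H normal_productsI xt) (simp add: YW_def)
    have "\<eta> j * (\<xi> i * ?m) \<in> zspan normal_products" "(\<eta> j * \<xi> i - \<xi> i * \<eta> j) * ?m \<in> zspan normal_products"
      using stab_\<eta>[OF j(2)] stab_commutator[OF i j(2)] m words_step(3) by (auto simp: stab_def)
    then have "\<eta> j * (\<xi> i * ?m) + - ((\<eta> j * \<xi> i - \<xi> i * \<eta> j) * ?m) \<in> zspan normal_products"
      by (intro zspan_add zspan_minus)
    then show ?case by (simp add: j algebra_simps)
  qed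
qed (rule H_gens(1)[OF i])

lemma H_zspan: "H \<subseteq> zspan normal_products"
proof
  fix x assume "x \<in> H"
  then obtain f where f: "f \<in> carrier (free_alg W n)" "x = \<Phi> f" by (auto simp: H_def)
  from f(1) have "\<Phi> f \<in> stab"
  proof (induct f rule: carrier_free_induct)
    case (gen g)
    then show ?case using stab_\<xi> stab_\<eta> stab_\<tau> by (auto simp: gens_def)
  qed (auto simp: stab_\<kappa> \<Phi>_add \<Phi>_mult intro: stab_add stab_mult)
  moreover have "e * (e * e) \<in> zspan normal_products"
    by (intro zspan_base normal_products_H normal_productsI) (auto simp: YW_def XW_def TW_def intro: words.intros)
  then have "e \<in> zspan normal_products" by (simp add: \<Phi>_1_left)
  ultimately have "\<Phi> f * e \<in> zspan normal_products" unfolding stab_def by blast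
  then show "x \<in> zspan normal_products" by (simp add: f \<Phi>_1_right)
qed

theorem H_module_finite:
  "\<exists>B. finite B \<and> B \<subseteq> H \<and> (\<forall>x\<in>H. \<exists>c. (\<forall>b\<in>B. c b \<in> Z) \<and> x = (\<Sum>b\<in>B. c b * b))"
proof -
  obtain B where B: "finite B" "B \<subseteq> H" "H \<subseteq> zspan B"
    using fin_spanned_span[OF fin_spanned_normal_products H_zspan] unfolding fin_spanned_def by (elim exE conjE)
  have "\<exists>c. (\<forall>b\<in>B. c b \<in> Z) \<and> x = (\<Sum>b\<in>B. c b * b)" if "x \<in> zspan B" for x
    using that
  proof (induct rule: zspan.induct)
    case zspan_0
    show ?case by (rule exI[of _ "\<lambda>_. 0"]) (simp add: Z_0)
  next
    case (zspan_step z b x)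
    then obtain c where c: "\<forall>b\<in>B. c b \<in> Z" "x = (\<Sum>b\<in>B. c b * b)" by blast
    let ?c = "c(b := z + c b)"
    have "(\<Sum>b'\<in>B. ?c b' * b') = (\<Sum>b'\<in>B. c b' * b' + (if b' = b then z * b else 0))"
      by (intro sum.cong) (auto simp: distrib_right add.commute)
    also have "\<dots> = z * b + x" using B(1) zspan_step(2) by (simp add: sum.distrib c add.commute)
    finally show ?case using c zspan_step by (intro exI[of _ ?c]) (auto intro: Z_add)
  qed
  then show ?thesis using B by (intro exI[of _ B] conjI ballI) auto
qed

end

section \<open>Transfer to the quotient algebra\<close>

text \<open>A retraction of the free algebra on all letters onto \<open>free_alg W n\<close>.
  Killing words with foreign letters is multiplicative, as a concatenation avoids such letters iff
  both parts do. It makes a map on all of \<open>free\<close> available, as \<open>rsd_hom\<close>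
  demands.\<close>

definition proj :: "weyl_type \<Rightarrow> nat \<Rightarrow> free \<Rightarrow> free"
  where "proj W n = lin_ext scal
    (\<lambda>w. if set (letters w) \<subseteq> gens W n then Poly_Mapping.single w 1 else 0)"

lemma proj_add: "proj W n (f + g) = proj W n f + proj W n g"
  unfolding proj_def by (rule lin_ext_add) (simp_all add: scal_0 scal_add)

lemma proj_mult: "proj W n (f * g) = proj W n f * proj W n g"
  unfolding proj_def
  by (rule lin_ext_mult; (rule scal_0 scal_add scal_mult scal_central[symmetric])?)
    (auto simp: mult_single plus_fword_def)

lemma proj_0: "proj W n 0 = 0"
  using proj_add[of W n 0 0] by simp

lemma proj_minus: "proj W n (- f) = - proj W n f"
  using proj_add[of W n f "- f"] by (simp add: proj_0 eq_neg_iff_add_eq_0 add.commute)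

lemma proj_diff: "proj W n (f - g) = proj W n f - proj W n g"
  using proj_add[of W n f "- g"] by (simp add: proj_minus)

lemma proj_carrier: "proj W n f \<in> carrier (free_alg W n)"
proof (induct f rule: poly_mapping_induct_add)
  case (single w c)
  show ?case by (auto simp: proj_def lin_ext_single scal_0 scal_def mult_single free_alg_def)
next
  case (add f g)
  then show ?case by (simp add: proj_add free_alg_add_closed)
qed

lemma proj_id: "f \<in> carrier (free_alg W n) \<Longrightarrow> proj W n f = f"
proof (induct f rule: carrier_free_induct)
  case (scal c)
  then show ?case by (simp add: proj_def lin_ext_single scal_0 scal_def mult_single zero_fword_def plus_fword_def)
next
  case (gen g)
  then show ?case by (simp add: proj_def lin_ext_single scal_0 scal_1 gen_def)
qed (simp_all add: proj_add proj_mult)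

lemma rel_carrier:
  assumes "rsd_rel W n u v a b" "admissible W n"
  shows "a \<in> carrier (free_alg W n)" "b \<in> carrier (free_alg W n)"
  using rsd_rel_homog[OF assms] by (auto simp: homog_def free_alg_def)

lemma free_alg_minus: "f \<in> carrier (free_alg W n) \<Longrightarrow> - f \<in> carrier (free_alg W n)"
  by (simp add: free_alg_def)

lemma rel_ideal: "rsd_rel W n u v a b \<Longrightarrow> admissible W n \<Longrightarrow> a - b \<in> rsd_ideal W n u v"
  and ideal_rsd: "admissible W n \<Longrightarrow> ideal (rsd_ideal W n u v) (free_alg W n)"
proof -
  assume adm: "admissible W n"
  have "a - b \<in> carrier (free_alg W n)" if "rsd_rel W n u v a b" for a b
    using free_alg_add_closed[OF rel_carrier(1)[OF that adm] free_alg_minus[OF rel_carrier(2)[OF that adm]]]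
    by simp
  then have sub: "{a - b | a b. rsd_rel W n u v a b} \<subseteq> carrier (free_alg W n)" by auto
  show "ideal (rsd_ideal W n u v) (free_alg W n)"
    unfolding rsd_ideal_def by (rule ring.genideal_ideal[OF ring_free_alg sub])
  show "a - b \<in> rsd_ideal W n u v" if "rsd_rel W n u v a b"
    unfolding rsd_ideal_def using ring.genideal_self[OF ring_free_alg sub] that by blast
qed

lemma rsd_ideal_closed:
  assumes adm: "admissible W n"
  shows "rsd_ideal W n u v \<subseteq> carrier (free_alg W n)" "0 \<in> rsd_ideal W n u v"
    "a \<in> rsd_ideal W n u v \<Longrightarrow> b \<in> rsd_ideal W n u v \<Longrightarrow> a + b \<in> rsd_ideal W n u v"
    "a \<in> rsd_ideal W n u v \<Longrightarrow> x \<in> carrier (free_alg W n) \<Longrightarrow> x * a \<in> rsd_ideal W n u v"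
    "a \<in> rsd_ideal W n u v \<Longrightarrow> x \<in> carrier (free_alg W n) \<Longrightarrow> a * x \<in> rsd_ideal W n u v"
    "a \<in> rsd_ideal W n u v \<Longrightarrow> - a \<in> rsd_ideal W n u v"
proof -
  interpret ideal "rsd_ideal W n u v" "free_alg W n" by (rule ideal_rsd[OF adm])
  show "rsd_ideal W n u v \<subseteq> carrier (free_alg W n)" by (rule a_subset)
  show "0 \<in> rsd_ideal W n u v" using additive_subgroup.zero_closed[OF is_additive_subgroup] by simp
  show "a + b \<in> rsd_ideal W n u v" if "a \<in> rsd_ideal W n u v" "b \<in> rsd_ideal W n u v" for a b
    using additive_subgroup.a_closed[OF is_additive_subgroup that] by simp
  show l: "x * a \<in> rsd_ideal W n u v" if "a \<in> rsd_ideal W n u v" "x \<in> carrier (free_alg W n)" for a x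
    using I_l_closed[OF that] by simp
  show "a * x \<in> rsd_ideal W n u v" if "a \<in> rsd_ideal W n u v" "x \<in> carrier (free_alg W n)" for a x
    using I_r_closed[OF that] by simp
  show "- a \<in> rsd_ideal W n u v" if "a \<in> rsd_ideal W n u v" for a
    using l[OF that free_alg_minus[of 1]] by (simp add: free_alg_def zero_fword_def)
qed

text \<open>
  A type cannot depend on the parameters \<open>W\<close>, \<open>n\<close>, \<open>u\<close>, \<open>v\<close>. The type \<open>rsd_prod\<close> is therefore the
  product of the quotient algebras over all admissible parameters, and each single algebra is
  embedded as a factor. Its unit then is an idempotent different from the unit of the product,
  which is why \<open>rsd_hom\<close> asks for a class \<open>ring\<close> without unit.
\<close>

type_synonym params = "weyl_type \<times> nat \<times> complex \<times> complex"

text \<open>The implication collapses every factor with inadmissible parameters to the zero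
  ring.\<close>

definition param_rel :: "params \<Rightarrow> free \<Rightarrow> bool"
  where "param_rel = (\<lambda>(W, n, u, v) f. admissible W n \<longrightarrow> proj W n f \<in> rsd_ideal W n u v)"

definition rsd_eq :: "(params \<Rightarrow> free) \<Rightarrow> (params \<Rightarrow> free) \<Rightarrow> bool"
  where "rsd_eq f g \<longleftrightarrow> (\<forall>p. param_rel p (f p - g p))"

lemma rsd_eqD: "rsd_eq f g \<Longrightarrow> param_rel p (f p - g p)"
  by (simp only: rsd_eq_def)

lemma param_rel_closed:
  "param_rel p 0" "param_rel p a \<Longrightarrow> param_rel p b \<Longrightarrow> param_rel p (a + b)"
  "param_rel p a \<Longrightarrow> param_rel p (- a)" "param_rel p a \<Longrightarrow> param_rel p (x * a)"
  "param_rel p a \<Longrightarrow> param_rel p (a * x)"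
  unfolding param_rel_def
  by (cases p; simp add: proj_0 proj_add proj_minus proj_mult rsd_ideal_closed proj_carrier)+

quotient_type rsd_prod = "params \<Rightarrow> free" / rsd_eq
proof (rule equivpI)
  show "reflp rsd_eq" by (rule reflpI) (simp add: rsd_eq_def param_rel_closed)
  show "symp rsd_eq"
  proof (rule sympI)
    fix f g assume fg: "rsd_eq f g"
    then have "param_rel p (- (f p - g p))" for p by (intro param_rel_closed(3) rsd_eqD)
    then show "rsd_eq g f" by (simp add: rsd_eq_def)
  qed
  show "transp rsd_eq"
  proof (rule transpI)
    fix f g h assume "rsd_eq f g" "rsd_eq g h"
    then have "param_rel p ((f p - g p) + (g p - h p))" for p
      by (intro param_rel_closed(2,3) rsd_eqD)
    then show "rsd_eq f h" by (simp add: rsd_eq_def)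
  qed
qed

instantiation rsd_prod :: ring
begin

lift_definition zero_rsd_prod :: rsd_prod is "\<lambda>_. 0" .

lift_definition plus_rsd_prod :: "rsd_prod \<Rightarrow> rsd_prod \<Rightarrow> rsd_prod" is "\<lambda>f g p. f p + g p"
  using param_rel_closed(2) by (fastforce simp: rsd_eq_def add_diff_add)

lift_definition uminus_rsd_prod :: "rsd_prod \<Rightarrow> rsd_prod" is "\<lambda>f p. - f p"
  using param_rel_closed(3) by (fastforce simp: rsd_eq_def)

lift_definition minus_rsd_prod :: "rsd_prod \<Rightarrow> rsd_prod \<Rightarrow> rsd_prod" is "\<lambda>f g p. f p - g p"
proof -
  fix f f' g g' assume "rsd_eq f f'" "rsd_eq g g'"
  then have "param_rel p ((f p - f' p) + - (g p - g' p))" for p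
    by (intro param_rel_closed(2,3) rsd_eqD)
  then show "rsd_eq (\<lambda>p. f p - g p) (\<lambda>p. f' p - g' p)" by (simp add: rsd_eq_def algebra_simps)
qed

lift_definition times_rsd_prod :: "rsd_prod \<Rightarrow> rsd_prod \<Rightarrow> rsd_prod" is "\<lambda>f g p. f p * g p"
proof -
  fix f f' g g' assume "rsd_eq f f'" "rsd_eq g g'"
  then have "param_rel p ((f p - f' p) * g p + f' p * (g p - g' p))" for p
    by (intro param_rel_closed(2,4,5) rsd_eqD)
  then show "rsd_eq (\<lambda>p. f p * g p) (\<lambda>p. f' p * g' p)" by (simp add: rsd_eq_def algebra_simps)
qed

instance
  by (standard; transfer) (simp_all add: rsd_eq_def param_rel_closed algebra_simps)

end

definition embed :: "params \<Rightarrow> free \<Rightarrow> rsd_prod"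
  where "embed p f = abs_rsd_prod (\<lambda>q. if q = p then f else 0)"

lemma embed_add: "embed p (f + g) = embed p f + embed p g"
  and embed_mult: "embed p (f * g) = embed p f * embed p g"
  unfolding embed_def plus_rsd_prod.abs_eq times_rsd_prod.abs_eq
  by (rule arg_cong[of _ _ abs_rsd_prod], force)+

lemma embed_eq_iff: "embed p f = embed p g \<longleftrightarrow> param_rel p (f - g)"
proof -
  let ?d = "\<lambda>q. (if q = p then f else 0) - (if q = p then g else 0)"
  have "(\<forall>q. param_rel q (?d q)) \<longleftrightarrow> param_rel p (f - g)"
  proof
    show "param_rel p (f - g)" if "\<forall>q. param_rel q (?d q)" using spec[OF that, of p] by simp
    show "\<forall>q. param_rel q (?d q)" if "param_rel p (f - g)"
    proof
      fix q show "param_rel q (?d q)" by (cases "q = p") (simp_all add: that param_rel_closed(1))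
    qed
  qed
  then show ?thesis by (simp only: embed_def rsd_prod.abs_eq_iff rsd_eq_def)
qed

lemma embed_eq_iff_ideal:
  assumes "admissible W n" "f \<in> carrier (free_alg W n)" "g \<in> carrier (free_alg W n)"
  shows "embed (W, n, u, v) f = embed (W, n, u, v) g \<longleftrightarrow> f - g \<in> rsd_ideal W n u v"
  using assms by (simp add: embed_eq_iff param_rel_def proj_diff proj_id)

lemma rsd_hom_embed:
  assumes adm: "admissible W n"
  shows "rsd_hom W n u v (embed (W, n, u, v))"
proof
  fix a b assume "rsd_rel W n u v a b"
  then show "embed (W, n, u, v) a = embed (W, n, u, v) b"
    using embed_eq_iff_ideal[OF adm rel_carrier[OF _ adm]] rel_ideal[OF _ adm] by blast
qed (simp_all add: adm embed_add embed_mult)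

lemma cls_eq_iff:
  assumes adm: "admissible W n" and "f \<in> carrier (free_alg W n)" "g \<in> carrier (free_alg W n)"
  shows "cls W n u v f = cls W n u v g \<longleftrightarrow> embed (W, n, u, v) f = embed (W, n, u, v) g"
proof -
  note I = rsd_ideal_closed[OF adm, where u = u and v = v]
  have cls: "cls W n u v f = {h + f | h. h \<in> rsd_ideal W n u v}" for f
    by (auto simp: cls_def a_r_coset_def')
  have "cls W n u v f = cls W n u v g \<longleftrightarrow> f - g \<in> rsd_ideal W n u v"
  proof
    assume "cls W n u v f = cls W n u v g"
    moreover have "f \<in> cls W n u v f" using I(2) by (auto simp: cls intro: exI[of _ 0])
    ultimately obtain h where "f = h + g" "h \<in> rsd_ideal W n u v" by (auto simp: cls)
    then show "f - g \<in> rsd_ideal W n u v" by simp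
  next
    have *: "cls W n u v f \<subseteq> cls W n u v g" if "f - g \<in> rsd_ideal W n u v" for f g
    proof
      fix x assume "x \<in> cls W n u v f"
      then obtain h where "x = h + f" "h \<in> rsd_ideal W n u v" by (auto simp: cls)
      then have "x = (h + (f - g)) + g" "h + (f - g) \<in> rsd_ideal W n u v" using I(3) that by auto
      then show "x \<in> cls W n u v g" unfolding cls by blast
    qed
    assume "f - g \<in> rsd_ideal W n u v"
    then show "cls W n u v f = cls W n u v g" using *[of f g] *[of g f] I(6)[of "f - g"] by auto
  qed
  then show ?thesis using embed_eq_iff_ideal[OF assms] by simp
qed

theorem proposition6p7:
  fixes W :: weyl_type and n :: nat and u v :: complex
  assumes "admissible W n"
  shows "y_invariants W n u v \<subseteq> even_center W n u v
    \<and> xi_sq_invariants W n u v \<subseteq> even_center W n u v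
    \<and> module_finite_over (rsdaha W n u v) (even_center W n u v)"
proof -
  let ?F = "free_alg W n" and ?R = "rsdaha W n u v" and ?cls = "cls W n u v"
  let ?\<Phi> = "embed (W, n, u, v)"
  interpret rsd_hom W n u v ?\<Phi> by (rule rsd_hom_embed[OF assms])
  interpret I: ideal "rsd_ideal W n u v" ?F by (rule ideal_rsd[OF assms])
  interpret R: ring ?R by (rule ring_rsdaha[OF assms])
  have hom: "?cls \<in> ring_hom ?F ?R"
    using I.rcos_ring_hom unfolding rsdaha_def cls_def by (simp add: eta_contract_eq)
  have cls_mult: "?cls f \<otimes>\<^bsub>?R\<^esub> ?cls g = ?cls (f * g)" and cls_add: "?cls f \<oplus>\<^bsub>?R\<^esub> ?cls g = ?cls (f + g)"
    if "f \<in> carrier ?F" "g \<in> carrier ?F" for f g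
    using ring_hom_mult[OF hom that] ring_hom_add[OF hom that] by simp_all
  have carrier_R: "carrier ?R = ?cls ` carrier ?F"
    by (auto simp: rsdaha_def FactRing_def A_RCOSETS_def' cls_def)
  have cls_0: "?cls 0 = \<zero>\<^bsub>?R\<^esub>"
    using ring_hom_zero[OF hom ring_free_alg R.ring_axioms] by simp
  \<comment> \<open>On \<open>carrier ?F\<close>, \<open>?\<Phi>\<close> and \<open>?cls\<close>
    identify the same elements, so the choice of a representative is immaterial and
    \<open>\<psi>\<close> maps \<open>H\<close> isomorphically onto the quotient ring.\<close>
  define \<psi> where "\<psi> x = ?cls (SOME f. f \<in> carrier ?F \<and> ?\<Phi> f = x)" for x
  have \<psi>: "\<psi> (?\<Phi> f) = ?cls f" if "f \<in> carrier ?F" for f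
  proof -
    let ?g = "SOME g. g \<in> carrier ?F \<and> ?\<Phi> g = ?\<Phi> f"
    have "?g \<in> carrier ?F \<and> ?\<Phi> ?g = ?\<Phi> f" by (rule someI) (use that in blast)
    then show ?thesis unfolding \<psi>_def using cls_eq_iff[OF assms _ that] by blast
  qed
  have \<psi>_carrier: "\<psi> x \<in> carrier ?R" if "x \<in> H" for x
    using that \<psi> by (auto simp: H_def carrier_R)
  have \<psi>_mult: "\<psi> (x * y) = \<psi> x \<otimes>\<^bsub>?R\<^esub> \<psi> y" and \<psi>_add: "\<psi> (x + y) = \<psi> x \<oplus>\<^bsub>?R\<^esub> \<psi> y"
    if "x \<in> H" "y \<in> H" for x y
    using that \<psi> cls_mult cls_add free_alg_mult_closed free_alg_add_closed
    by (auto simp: H_def simp flip: \<Phi>_mult \<Phi>_add)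
  have \<psi>_inj: "inj_on \<psi> H"
    using cls_eq_iff[OF assms] \<psi> by (auto simp: H_def inj_on_def)
  have \<psi>_0: "\<psi> 0 = \<zero>\<^bsub>?R\<^esub>"
    using \<psi>[of 0] cls_0 homog_0[of W n False] carrier_homog by (auto simp: \<Phi>_0)
  have center: "\<psi> z \<in> even_center W n u v" if z: "z \<in> Z" for z
  proof -
    obtain f where f: "f \<in> homog W n False" "z = ?\<Phi> f" using z by (auto simp: Z_def)
    have fc: "f \<in> carrier ?F" using f(1) carrier_homog by blast
    have "?cls f \<in> even_part W n u v"
      unfolding even_part_def by (rule imageI) (use f fc in \<open>auto simp: homog_def\<close>)
    moreover have "?cls f \<otimes>\<^bsub>?R\<^esub> x = x \<otimes>\<^bsub>?R\<^esub> ?cls f" if "x \<in> carrier ?R" for x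
    proof -
      obtain g where g: "x = ?cls g" "g \<in> carrier ?F" using \<open>x \<in> carrier ?R\<close> by (auto simp: carrier_R)
      have "?\<Phi> (f * g) = ?\<Phi> (g * f)"
        using Z_commute[OF z, of "?\<Phi> g"] g(2) f(2) by (simp add: \<Phi>_mult H_I)
      then have "?cls (f * g) = ?cls (g * f)"
        using cls_eq_iff[OF assms] free_alg_mult_closed fc g(2) by blast
      then show ?thesis using g fc by (simp add: cls_mult)
    qed
    ultimately show ?thesis using \<psi>[OF fc] f(2) by (simp add: even_center_def)
  qed
  have "y_invariants W n u v \<subseteq> even_center W n u v"
  proof
    fix x assume "x \<in> y_invariants W n u v"
    then obtain p where p: "x = ?cls (eval_at n yg p)" "p \<in> invariants W n act_y"
      by (auto simp: y_invariants_def)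
    have "eval_at n yg p \<in> carrier ?F" using eval_at_homog[of yg p] homog_y carrier_homog by blast
    then show "x \<in> even_center W n u v" using center[OF ev_y_Z[OF p(2)]] \<psi> p(1) by (simp add: ev_def)
  qed
  moreover have "xi_sq_invariants W n u v \<subseteq> even_center W n u v"
  proof
    fix x assume "x \<in> xi_sq_invariants W n u v"
    then obtain p where p: "x = ?cls (eval_at n xg2 p)" "p \<in> invariants W n act_xi_sq"
      by (auto simp: xi_sq_invariants_def)
    have "eval_at n xg2 p \<in> carrier ?F" using eval_at_homog[of xg2 p] xg2_homog carrier_homog by blast
    then show "x \<in> even_center W n u v" using center[OF ev_xi_Z[OF p(2)]] \<psi> p(1) by (simp add: ev_def)
  qed
  moreover have "module_finite_over ?R (even_center W n u v)"
  proof -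
    obtain B where B: "finite B" "B \<subseteq> H"
      "\<And>x. x \<in> H \<Longrightarrow> \<exists>c. (\<forall>b\<in>B. c b \<in> Z) \<and> x = (\<Sum>b\<in>B. c b * b)"
      using H_module_finite by (elim exE conjE) blast
    have inj: "inj_on \<psi> B" using \<psi>_inj B(2) by (rule inj_on_subset)
    have "\<exists>c. c \<in> \<psi> ` B \<rightarrow> even_center W n u v \<and> x = (\<Oplus>\<^bsub>?R\<^esub>b\<in>\<psi> ` B. c b \<otimes>\<^bsub>?R\<^esub> b)"
      if x: "x \<in> carrier ?R" for x
    proof -
      obtain f where f: "x = ?cls f" "f \<in> carrier ?F" using x by (auto simp: carrier_R)
      obtain c where c: "\<And>b. b \<in> B \<Longrightarrow> c b \<in> Z" "?\<Phi> f = (\<Sum>b\<in>B. c b * b)"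
        using B(3)[OF H_I[OF f(2)]] by blast
      \<comment> \<open>Coefficients in \<open>module_finite_over\<close> are attached to the
        spanning elements themselves, here the \<open>\<psi> b\<close>; injectivity of
        \<open>\<psi>\<close> lets those of \<open>b\<close> be carried over.\<close>
      let ?c = "\<lambda>b. \<psi> (c (the_inv_into B \<psi> b))"
      have c\<psi>: "?c (\<psi> b) = \<psi> (c b)" if "b \<in> B" for b using the_inv_into_f_f[OF inj that] by simp
      have cH: "\<psi> (c b) \<otimes>\<^bsub>?R\<^esub> \<psi> b \<in> carrier ?R" if "b \<in> B" for b
        using c(1) B(2) that Z_H by (intro R.m_closed \<psi>_carrier) auto
      have "\<psi> (\<Sum>b\<in>A. c b * b) = (\<Oplus>\<^bsub>?R\<^esub>b\<in>A. \<psi> (c b) \<otimes>\<^bsub>?R\<^esub> \<psi> b) \<and> (\<Sum>b\<in>A. c b * b) \<in> H"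
        if "finite A" "A \<subseteq> B" for A
        using that
      proof (induct A)
        case empty
        then show ?case by (simp add: \<psi>_0 H_0)
      next
        case (insert a A)
        then have a: "c a \<in> H" "a \<in> H" using c(1) Z_H B(2) by auto
        have "(\<Oplus>\<^bsub>?R\<^esub>b\<in>insert a A. \<psi> (c b) \<otimes>\<^bsub>?R\<^esub> \<psi> b) =
            \<psi> (c a) \<otimes>\<^bsub>?R\<^esub> \<psi> a \<oplus>\<^bsub>?R\<^esub> (\<Oplus>\<^bsub>?R\<^esub>b\<in>A. \<psi> (c b) \<otimes>\<^bsub>?R\<^esub> \<psi> b)"
          using insert cH by (intro R.finsum_insert) auto
        then show ?case using insert a by (simp add: \<psi>_add \<psi>_mult H_mult H_add)
      qed
      from this[OF B(1)] have "x = (\<Oplus>\<^bsub>?R\<^esub>b\<in>B. \<psi> (c b) \<otimes>\<^bsub>?R\<^esub> \<psi> b)"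
        using \<psi>[OF f(2)] f(1) by (simp add: c(2))
      also have "\<dots> = (\<Oplus>\<^bsub>?R\<^esub>b\<in>B. ?c (\<psi> b) \<otimes>\<^bsub>?R\<^esub> \<psi> b)"
        using cH by (intro R.finsum_cong') (auto simp: c\<psi>)
      also have "\<dots> = (\<Oplus>\<^bsub>?R\<^esub>b\<in>\<psi> ` B. ?c b \<otimes>\<^bsub>?R\<^esub> b)"
        using cH by (intro R.finsum_reindex[symmetric] inj) (auto simp: c\<psi>)
      finally show ?thesis using center c(1) c\<psi> by (intro exI[of _ ?c]) auto
    qed
    moreover have "finite (\<psi> ` B)" "\<psi> ` B \<subseteq> carrier ?R" using B \<psi>_carrier by auto
    ultimately show ?thesis unfolding module_finite_over_def by (intro exI[of _ "\<psi> ` B"]) auto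
  qed
  ultimately show ?thesis by blast
qed

end
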